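(* Let $g:[0,\infty)\to(0,\infty)$ with $\rho=\int_0^\infty g(u)\,\mathrm{d}u<1$, and $G(x)=\int_0^x g(u)\,\mathrm{d}u$. Consider the following randomized algorithm (all random draws being independent except as indicated by their dependence on $N$). 1. Generate $N\sim\mathsf{Borel}(\rho)$. If $N=1$, output $A_0=0$ and stop. 2. Generate $\Lambda\in\mathbb{R}_+^{N-1}$ as follows. (a) Draw $\pi_1,\dots,\pi_{N-1}$ i.i.d. uniform on $\{1,\dots,N\}$ and set $\sigma=(0,\dots,0)\in\{0,1\}^N$. (b)–(c) For $i=1,\dots,N-1$ in order: if $\sigma_{\pi_i}=0$, set $\sigma_{\pi_i}=1$; otherwise set $\sigma_{j^*\,\mathsf{mod}\,N}=1$, where $j^*=\min\{j>\pi_i\mid\sigma_{j\,\mathsf{mod}\,N}=0\}$. (d) Let $\ell$ be the index with $\sigma_\ell=0$ and replace $\pi$ by $(\pi-\ell)\ \mathsf{mod}\ N$ (entrywise). (e) Draw $U_1,\dots,U_{N-1}$ i.i.d. $\mathsf{Uni}(0,1)$ and let $\Lambda$ be $\rho$ times the increasing rearrangement of $\pi-U$. 3. Output $A_0=0$ and $A_1,\dots,A_{N-1}$ given as the unique solution, with $0<A_1<\dots<A_{N-1}$, of the system of equations $\Lambda_i=\sum_{j=0}^{i-1}G(A_i-A_j)$, $i\in\{1,\dots,N-1\}$. Then the output $(N;A_0,A_1,\dots,A_{N-1})$ of this algorithm has exactly the joint distribution of the size and the arrival epochs of a Hawkes process cluster with excitation kernel $g$.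
   Context: Residues modulo $N$ are represented by elements of $\{1,\dots,N\}$ (the indices of $N$ spaces arranged on a circle). $\mathsf{Borel}(\rho)$ is the distribution on the positive integers with $\mathrm{P}(N=k)=\frac{e^{-\rho k}}{k!}(\rho k)^{k-1}$. Hawkes process cluster with excitation kernel $g$: a point process $(N_t)_{t\ge0}$ with natural filtration $(\mathcal{F}_t)$, started with one event at time $A_0=0$ (which is counted by $N_t$), with epochs $A_0<A_1<\cdots$, such that as $\delta\downarrow 0$, $\mathrm{P}(N_{t+\delta}-N_t=1\mid\mathcal{F}_t)=\lambda_t\delta+o(\delta)$, $\mathrm{P}(N_{t+\delta}-N_t=0\mid\mathcal{F}_t)=1-\lambda_t\delta+o(\delta)$, $\mathrm{P}(N_{t+\delta}-N_t>1\mid\mathcal{F}_t)=o(\delta)$, where the conditional intensity is $\lambda_t=\sum_{i=0}^{N_t-1}g(t-A_i)$ (no exogenous baseline intensity). Equivalently (Hawkes and Oakes), starting from the time-$0$ event, each event at time $s$ independently generates direct offspring according to an inhomogeneous Poisson process with rate $g(t-s)$, $t>s$, and the cluster consists of the initial event and all its descendants. The cluster size is $N=\lim_{t\to\infty}N_t$, almost surely finite since $\rho<1$, and the arrival epochs of the cluster are $0=A_0<A_1<\dots<A_{N-1}$. *)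

theory Defs
  imports "HOL-Probability.Probability"
begin

section \<open>Outcomes\<close>

text \<open>
  A finite increasing sequence of random length is encoded as a pair: its length \<open>n\<close> and
  the function listing its entries at \<open>0, \<dots>, n - 1\<close>, padded with \<open>0\<close> from index \<open>n\<close> on.
  A law on \<open>outcome_space\<close> is then the joint law of the length and the entries.
\<close>

definition outcome_space :: "(nat \<times> (nat \<Rightarrow> real)) measure" where
  "outcome_space = count_space UNIV \<Otimes>\<^sub>M (\<Pi>\<^sub>M i\<in>UNIV. borel)"

section \<open>Hawkes process clusters\<close>

definition config_space :: "real set measure" where
  "config_space = sigma {C. finite C \<and> C \<subseteq> {0<..}}
     {{C. finite C \<and> C \<subseteq> {0<..} \<and> card (C \<inter> B) = k} | B k. B \<in> sets borel}"

text \<open>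
  Inhomogeneous Poisson process on \<open>(0, \<infinity>)\<close> with rate function \<open>g\<close>. Only rates of finite total
  mass are considered, so that the configurations of points are finite sets.
\<close>

definition poisson_process ::
    "'w measure \<Rightarrow> (real \<Rightarrow> real) \<Rightarrow> ('w \<Rightarrow> real set) \<Rightarrow> bool" where
  "poisson_process M g X \<longleftrightarrow>
     X \<in> M \<rightarrow>\<^sub>M config_space \<and>
     (\<forall>B\<in>sets borel. \<forall>k.
        measure M {\<omega> \<in> space M. card (X \<omega> \<inter> B) = k} =
          exp (- (LINT t:B \<inter> {0<..}|lborel. g t)) *
            (LINT t:B \<inter> {0<..}|lborel. g t) ^ k / fact k) \<and>
     (\<forall>B :: nat \<Rightarrow> real set. range B \<subseteq> sets borel \<longrightarrow> disjoint_family B \<longrightarrow>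
        prob_space.indep_vars M (\<lambda>_. count_space UNIV) (\<lambda>i \<omega>. card (X \<omega> \<inter> B i)) UNIV)"

text \<open>
  Hawkes--Oakes branching description. Individuals carry Ulam--Harris labels: \<open>[]\<close> is the
  initial event and \<open>u @ [k]\<close> is the \<open>k\<close>-th earliest direct offspring of \<open>u\<close>, counting from \<open>0\<close>.
  The set \<open>X u\<close> consists of the ages of \<open>u\<close> at the births of its direct offspring; if \<open>u\<close> occurs at
  time \<open>s\<close> and \<open>X u\<close> is a Poisson process with rate \<open>g\<close>, then its offspring occur at the points
  of a Poisson process with rate \<open>g (t - s)\<close>, \<open>t > s\<close>.
\<close>

definition hawkes_cluster ::
    "'w measure \<Rightarrow> (real \<Rightarrow> real) \<Rightarrow> (nat list \<Rightarrow> 'w \<Rightarrow> real set) \<Rightarrow> bool" where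
  "hawkes_cluster M g X \<longleftrightarrow>
     prob_space M \<and>
     (\<forall>u. poisson_process M g (X u)) \<and>
     prob_space.indep_vars M (\<lambda>_. config_space) X UNIV"

inductive_set cluster_events :: "(nat list \<Rightarrow> real set) \<Rightarrow> (nat list \<times> real) set"
  for X :: "nat list \<Rightarrow> real set" where
  initial: "([], 0) \<in> cluster_events X"
| offspring: "(u, s) \<in> cluster_events X \<Longrightarrow> k < card (X u) \<Longrightarrow>
    (u @ [k], s + sorted_list_of_set (X u) ! k) \<in> cluster_events X"

text \<open>
  Size and arrival epochs. An infinite cluster (a null event for subcritical rates) has
  \<open>card\<close> equal to \<open>0\<close> here, and is thus mapped to the fixed value \<open>(0, \<lambda>_. 0)\<close>.
\<close>

definition cluster_size :: "(nat list \<Rightarrow> real set) \<Rightarrow> nat" where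
  "cluster_size X = card (cluster_events X)"

definition cluster_epochs :: "(nat list \<Rightarrow> real set) \<Rightarrow> nat \<Rightarrow> real" where
  "cluster_epochs X i =
     (if i < cluster_size X
      then sorted_list_of_multiset (image_mset snd (mset_set (cluster_events X))) ! i
      else 0)"

definition cluster_law ::
    "'w measure \<Rightarrow> (nat list \<Rightarrow> 'w \<Rightarrow> real set) \<Rightarrow> (nat \<times> (nat \<Rightarrow> real)) measure" where
  "cluster_law M X =
     distr M outcome_space
       (\<lambda>\<omega>. (cluster_size (\<lambda>u. X u \<omega>), cluster_epochs (\<lambda>u. X u \<omega>)))"

section \<open>The sampling algorithm\<close>

definition borel_dist :: "real \<Rightarrow> nat measure" where
  "borel_dist \<rho> = density (count_space UNIV)
     (\<lambda>k. if k = 0 then 0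
          else ennreal (exp (- \<rho> * real k) / fact k * (\<rho> * real k) ^ (k - 1)))"

text \<open>The representative in \<open>{1, \<dots>, n}\<close> of the residue class of \<open>j\<close> modulo \<open>n\<close>.\<close>

definition circ :: "nat \<Rightarrow> int \<Rightarrow> nat" where
  "circ n j = nat ((j - 1) mod int n) + 1"

definition park :: "nat \<Rightarrow> (nat \<Rightarrow> nat) \<Rightarrow> nat \<Rightarrow> nat \<Rightarrow> nat" where
  "park n \<sigma> p =
     (if \<sigma> p = 0 then \<sigma>(p := 1)
      else \<sigma>(circ n (int (LEAST j. j > p \<and> \<sigma> (circ n (int j)) = 0)) := 1))"

text \<open>The state \<open>\<sigma>\<close> after the first \<open>m\<close> cars, with preferences \<open>\<pi> 1, \<dots>, \<pi> m\<close>.\<close>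

primrec spaces_after :: "nat \<Rightarrow> (nat \<Rightarrow> nat) \<Rightarrow> nat \<Rightarrow> nat \<Rightarrow> nat" where
  "spaces_after n \<pi> 0 = (\<lambda>_. 0)"
| "spaces_after n \<pi> (Suc m) = park n (spaces_after n \<pi> m) (\<pi> (Suc m))"

definition empty_space :: "nat \<Rightarrow> (nat \<Rightarrow> nat) \<Rightarrow> nat" where
  "empty_space n \<pi> = (THE l. l \<in> {1..n} \<and> spaces_after n \<pi> (n - 1) l = 0)"

definition shifted :: "nat \<Rightarrow> (nat \<Rightarrow> nat) \<Rightarrow> nat \<Rightarrow> nat" where
  "shifted n \<pi> i = circ n (int (\<pi> i) - int (empty_space n \<pi>))"

text \<open>Meaningful for indices \<open>i\<close> in \<open>{1, \<dots>, n - 1}\<close>.\<close>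

definition Lam :: "real \<Rightarrow> nat \<Rightarrow> (nat \<Rightarrow> nat) \<Rightarrow> (nat \<Rightarrow> real) \<Rightarrow> nat \<Rightarrow> real" where
  "Lam \<rho> n \<pi> U i = \<rho> * sort (map (\<lambda>k. real (shifted n \<pi> k) - U k) [1..<n]) ! (i - 1)"

definition kernel_mass :: "(real \<Rightarrow> real) \<Rightarrow> real" where
  "kernel_mass g = (LINT u:{0..}|lborel. g u)"

definition kernel_primitive :: "(real \<Rightarrow> real) \<Rightarrow> real \<Rightarrow> real" where
  "kernel_primitive g x = (LINT u:{0..x}|lborel. g u)"

definition solves_epochs ::
    "(real \<Rightarrow> real) \<Rightarrow> nat \<Rightarrow> (nat \<Rightarrow> real) \<Rightarrow> (nat \<Rightarrow> real) \<Rightarrow> bool" where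
  "solves_epochs g n L A \<longleftrightarrow>
     A 0 = 0 \<and>
     strict_mono_on {0..<n} A \<and>
     (\<forall>i\<in>{1..<n}. L i = (\<Sum>j=0..<i. kernel_primitive g (A i - A j))) \<and>
     (\<forall>i\<ge>n. A i = 0)"

text \<open>
  For \<open>n = 1\<close> the index set \<open>{1..<n}\<close> is empty, so no draws are made in the last two steps and
  the output is \<open>(1, \<lambda>_. 0)\<close>.
\<close>

definition sampler_law :: "(real \<Rightarrow> real) \<Rightarrow> (nat \<times> (nat \<Rightarrow> real)) measure" where
  "sampler_law g =
     borel_dist (kernel_mass g) \<bind> (\<lambda>n.
     measure_pmf (Pi_pmf {1..<n} 0 (\<lambda>_. pmf_of_set {1..n})) \<bind> (\<lambda>\<pi>.
     distr (\<Pi>\<^sub>M i\<in>{1..<n}. uniform_measure lborel {0<..<1}) outcome_space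
       (\<lambda>U. (n, THE A. solves_epochs g n (Lam (kernel_mass g) n \<pi> U) A))))"

end

theory Submission
  imports Defs "HOL-Complex_Analysis.Conformal_Mappings"
begin

text \<open>
  Write \<open>h\<close> for \<open>g\<close> restricted to \<open>(0, \<infinity>)\<close> and \<open>\<nu>\<^sub>n\<close> for the measure with density
  \<open>exp (- n \<rho>) (\<Prod>i. \<Sum>j<i. h (a\<^sub>i - a\<^sub>j))\<close> on \<open>0 < a\<^sub>1 < \<dots> < a\<^sub>n\<^sub>-\<^sub>1\<close>. It is enough to show that
  sampler \<open>\<le> \<Sum>n. \<nu>\<^sub>n \<le>\<close> cluster, since both laws are probability measures.

  Sampler: the shifted preferences are dominated by \<open>n\<close> times the counting measure on parking
  functions, the unit cubes below the parking functions lie in the region where the sorted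
  coordinates satisfy \<open>x\<^sub>(\<^sub>i\<^sub>) < i\<close>, and the map from the epochs to \<open>\<Lambda>\<close> is triangular with Jacobian
  \<open>\<Prod>i. \<Sum>j<i. h (a\<^sub>i - a\<^sub>j)\<close>. That the sampler law has mass 1 amounts to the Borel weights
  summing to 1.

  Cluster: expand the product over maps \<open>p\<close> with \<open>p i < i\<close>. Such a map is the genealogy of the
  events listed in order of time; for a given genealogy, independence of the offspring processes
  gives the density \<open>exp (- n \<rho>) (\<Prod>i. h (a\<^sub>i - a\<^sub>p\<^sub>i))\<close>, and different genealogies are disjoint events.
\<close>

text \<open>Working with one-sided bounds allows ties, infinite clusters and choices of sorting
  permutations to be discarded or overcounted; the masses then restore equality, and almost sure
  finiteness of the cluster comes out as a by-product. The factor exp (- n \<rho>) arises because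
  each of the n offspring processes is observed on all of (0, \<infinity>), with total mass \<rho>.
  The Borel weight is matched to it: n rotations, (n - 1)! orderings, n^(n-1) equally likely
  preference lists and cells of volume \<rho>^(n-1) give exp (- n \<rho>) (n \<rho>)^(n-1) / n!
  times n (n - 1)! / (n \<rho>)^(n-1), which is exp (- n \<rho>). Two obstacles shape the rest.
  First, \<open>g\<close> is only integrable, so \<open>G\<close> need not be differentiable
  everywhere and its inverse has no formula; substitutions go through distribution functions.
  Second, a Poisson process is given by its counts on disjoint sets, so the joint law of its ordered
  points must be recovered from boxes whose sides are disjoint and in order.\<close>

section \<open>Total mass of the Borel distribution\<close>

text \<open>Up to sign this is the m-th finite difference at 0 of the polynomial x^j, of degree
  below m. One factor k is absorbed into the binomial coefficient, which lowers both m and the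
  degree.\<close>

lemma alternating_binomial_power_sum:
  assumes "j < m"
  shows "(\<Sum>k\<le>m. (-1) ^ k * real (m choose k) * real k ^ j) = 0"
  using assms
proof (induction m arbitrary: j)
  case 0
  then show ?case by simp
next
  case (Suc m)
  show ?case
  proof (cases j)
    case 0
    have "(\<Sum>k\<le>Suc m. (-1) ^ k * real (Suc m choose k)) = 0"
      by (rule choose_alternating_sum) simp
    then show ?thesis using 0 by simp
  next
    case (Suc i)
    have "(\<Sum>k\<le>Suc m. (-1) ^ k * real (Suc m choose k) * real k ^ j)
        = (\<Sum>k\<le>m. (-1) ^ Suc k * real (Suc m choose Suc k) * real (Suc k) ^ j)"
      by (subst sum.atMost_Suc_shift) (simp add: Suc)
    also have "\<dots> = (\<Sum>k\<le>m. - real (Suc m) * ((-1) ^ k * real (m choose k) * real (Suc k) ^ i))"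
    proof (rule sum.cong[OF refl])
      fix k
      have "real (Suc k) * real (Suc m choose Suc k) = real (Suc m) * real (m choose k)"
        by (metis Suc_times_binomial_eq mult.commute of_nat_mult)
      then show "(-1) ^ Suc k * real (Suc m choose Suc k) * real (Suc k) ^ j =
          - real (Suc m) * ((-1) ^ k * real (m choose k) * real (Suc k) ^ i)"
        unfolding Suc power_Suc by (metis (no_types, opaque_lifting) mult.assoc mult.commute mult_minus_left mult_minus_right mult_1_left)
    qed
    also have "\<dots> = - real (Suc m) * (\<Sum>k\<le>m. \<Sum>l\<le>i. real (i choose l) * ((-1) ^ k * real (m choose k) * real k ^ l))"
    proof -
      have "real (Suc k) ^ i = (\<Sum>l\<le>i. real (i choose l) * real k ^ l)" for k
        using binomial_ring[of "real k" 1 i] by (simp add: add.commute)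
      then show ?thesis by (simp only: sum_distrib_left mult_ac)
    qed
    also have "\<dots> = - real (Suc m) * (\<Sum>l\<le>i. real (i choose l) * (\<Sum>k\<le>m. (-1) ^ k * real (m choose k) * real k ^ l))"
      by (subst sum.swap) (simp add: sum_distrib_left)
    also have "\<dots> = 0"
      using Suc.IH Suc.prems Suc by (simp add: sum.neutral)
    finally show ?thesis .
  qed
qed

text \<open>
  The coefficients of \<open>T y / y\<close>, where \<open>T y = y exp (T y)\<close> is the tree function. Up to the factor
  \<open>exp (- x)\<close>, the Borel weights with parameter \<open>x\<close> are the terms of this series at \<open>y = x exp (- x)\<close>.
\<close>

definition tree_coeff :: "nat \<Rightarrow> real" where
  "tree_coeff n = real (Suc n) ^ n / fact (Suc n)"

lemma tree_coeff_nonneg: "0 \<le> tree_coeff n"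
  by (simp add: tree_coeff_def)

text \<open>A single term of the exponential series of n + 1 is at most its sum. The resulting
  radius of convergence 1/e is the value of x exp (- x) at x = 1, so that all x in [0, 1) are
  reached.\<close>

lemma tree_coeff_le: "tree_coeff n \<le> exp 1 ^ Suc n"
proof -
  have "real (Suc n) ^ Suc n / fact (Suc n) \<le> exp (real (Suc n))"
  proof -
    have "(\<Sum>k\<in>{Suc n}. real (Suc n) ^ k /\<^sub>R fact k) \<le> (\<Sum>k. real (Suc n) ^ k /\<^sub>R fact k)"
      by (rule sum_le_suminf[OF summable_exp_generic]) auto
    then show ?thesis by (simp add: exp_def divide_inverse mult.commute)
  qed
  moreover have "tree_coeff n \<le> real (Suc n) ^ Suc n / fact (Suc n)"
    unfolding tree_coeff_def by (intro divide_right_mono) auto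
  ultimately show ?thesis
    by (simp add: exp_of_nat_mult[symmetric] mult.commute del: of_nat_Suc power_Suc)
qed

lemma summable_tree_coeff:
  assumes "\<bar>y\<bar> * exp 1 < 1"
  shows "summable (\<lambda>n. tree_coeff n * \<bar>y\<bar> ^ n)"
proof (rule summable_comparison_test')
  show "summable (\<lambda>n. exp 1 * (\<bar>y\<bar> * exp 1) ^ n)"
    using assms by (intro summable_mult summable_geometric) auto
  fix n
  show "norm (tree_coeff n * \<bar>y\<bar> ^ n) \<le> exp 1 * (\<bar>y\<bar> * exp 1) ^ n"
    using mult_right_mono[OF tree_coeff_le[of n], of "\<bar>y\<bar> ^ n"] tree_coeff_nonneg[of n]
    by (simp add: power_mult_distrib abs_mult mult_ac)
qed

text \<open>
  Expanding the exponentials gives a double series that converges absolutely for small \<open>x\<close> only;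
  the result is then extended to \<open>[0, 1)\<close> by analytic continuation.
\<close>

lemma tree_series_small:
  fixes x :: real
  assumes x: "0 < x" "x < 1 / 10"
  shows "(\<Sum>n. tree_coeff n * (x * exp (- x)) ^ n) * exp (- x) = 1"
proof -
  define a where "a = (\<lambda>(n, m). tree_coeff n * x ^ n * ((- (real (Suc n) * x)) ^ m / fact m))"
  \<comment> \<open>In absolute values the factors exp (- (n + 1) x) become exp ((n + 1) x), so the
    double series needs this stronger smallness. With e \<le> 3 it follows from 9 x < 1, whence the
    bound 1/10.\<close>
  have xe: "x * exp x * exp 1 < 1"
  proof -
    have "exp x * exp 1 \<le> exp 1 * exp (1 :: real)" using x by simp
    also have "\<dots> \<le> 3 * 3" by (intro mult_mono exp_le) auto
    finally have "x * (exp x * exp 1) \<le> x * 9" using x by (intro mult_left_mono) auto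
    moreover have "x * 9 < 1" using x by simp
    ultimately show ?thesis by (simp add: mult.assoc)
  qed
  have exp_hs: "((\<lambda>m. y ^ m / fact m) has_sum exp y) UNIV" for y :: real
  proof (rule norm_summable_imp_has_sum)
    show "summable (\<lambda>m. norm (y ^ m / fact m))"
      using summable_exp_generic[of "\<bar>y\<bar>"] by (simp add: abs_mult power_abs divide_inverse mult.commute)
    show "(\<lambda>m. y ^ m / fact m) sums exp y"
      using exp_converges[of y] by (simp add: divide_inverse mult.commute)
  qed
  have summ: "summable (\<lambda>n. tree_coeff n * (x * exp x) ^ n)"
    using summable_tree_coeff[of "x * exp x"] xe x by simp
  have absum: "(\<lambda>p. norm (a p)) summable_on UNIV \<times> UNIV"
  proof (subst Infinite_Sum.abs_summable_on_Sigma_iff, intro conjI ballI)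
    have abs_inner: "((\<lambda>m. norm (a (n, m))) has_sum tree_coeff n * x ^ n * exp (real (Suc n) * x)) UNIV" for n
      using has_sum_cmult_right[OF exp_hs[of "real (Suc n) * x"], of "tree_coeff n * x ^ n"] x
      by (simp add: a_def abs_mult tree_coeff_nonneg power_abs del: of_nat_Suc)
    show "(\<lambda>m. norm (a (n, m))) summable_on UNIV" for n
      using abs_inner[of n] by (rule has_sum_imp_summable)
    have "(\<lambda>n. infsum (\<lambda>m. norm (a (n, m))) UNIV) = (\<lambda>n. exp x * (tree_coeff n * (x * exp x) ^ n))"
    proof (rule ext)
      fix n
      have "exp (real (Suc n) * x) = exp x * exp x ^ n"
        by (simp add: exp_of_nat_mult[symmetric] exp_add[symmetric] algebra_simps)
      then show "infsum (\<lambda>m. norm (a (n, m))) UNIV = exp x * (tree_coeff n * (x * exp x) ^ n)"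
        by (simp only: infsumI[OF abs_inner] power_mult_distrib mult_ac)
    qed
    moreover have "(\<lambda>n. \<bar>exp x * (tree_coeff n * (x * exp x) ^ n)\<bar>) summable_on UNIV"
      using summable_mult[OF summ, of "exp x"] x
      by (intro norm_summable_imp_summable_on) (auto simp: abs_mult tree_coeff_nonneg)
    ultimately show "(\<lambda>n. norm (\<Sum>\<^sub>\<infinity>m. norm (a (n, m)))) summable_on UNIV"
      by (simp only: real_norm_def fun_eq_iff)
  qed
  have summa: "a summable_on UNIV \<times> UNIV"
    using absum by (rule abs_summable_summable)
  have "infsum a (UNIV \<times> UNIV) = (\<Sum>\<^sub>\<infinity>n. \<Sum>\<^sub>\<infinity>m. a (n, m))"
    using infsum_Sigma'_banach[of "\<lambda>n m. a (n, m)" UNIV "\<lambda>_. UNIV"] summa by simp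
  also have "\<dots> = (\<Sum>\<^sub>\<infinity>n. exp (- x) * (tree_coeff n * (x * exp (- x)) ^ n))"
  proof (rule infsum_cong)
    fix n
    have "((\<lambda>m. a (n, m)) has_sum tree_coeff n * x ^ n * exp (- (real (Suc n) * x))) UNIV"
      using has_sum_cmult_right[OF exp_hs[of "- (real (Suc n) * x)"], of "tree_coeff n * x ^ n"]
      by (simp add: a_def del: of_nat_Suc)
    moreover have "exp (- (real (Suc n) * x)) = exp (- x) * exp (- x) ^ n"
      by (simp add: exp_of_nat_mult[symmetric] exp_add[symmetric] algebra_simps)
    ultimately show "(\<Sum>\<^sub>\<infinity>m. a (n, m)) = exp (- x) * (tree_coeff n * (x * exp (- x)) ^ n)"
      by (simp only: infsumI power_mult_distrib mult_ac)
  qed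
  also have "\<dots> = exp (- x) * (\<Sum>n. tree_coeff n * (x * exp (- x)) ^ n)"
  proof -
    have "x * exp (- x) * exp 1 < 1"
    proof -
      have "x * exp (- x) * exp 1 \<le> x * exp x * exp 1" using x by simp
      then show ?thesis using xe by simp
    qed
    then have "summable (\<lambda>n. tree_coeff n * (x * exp (- x)) ^ n)"
      using summable_tree_coeff[of "x * exp (- x)"] x by simp
    then have s: "summable (\<lambda>n. exp (- x) * (tree_coeff n * (x * exp (- x)) ^ n))"
      by (rule summable_mult)
    then have "(\<Sum>\<^sub>\<infinity>n. exp (- x) * (tree_coeff n * (x * exp (- x)) ^ n))
        = (\<Sum>n. exp (- x) * (tree_coeff n * (x * exp (- x)) ^ n))"
      using x by (intro infsumI norm_summable_imp_has_sum summable_sums) (auto simp: abs_mult tree_coeff_nonneg)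
    then show ?thesis
      using suminf_mult[OF \<open>summable (\<lambda>n. tree_coeff n * (x * exp (- x)) ^ n)\<close>] by simp
  qed
  finally have 1: "infsum a (UNIV \<times> UNIV) = exp (- x) * (\<Sum>n. tree_coeff n * (x * exp (- x)) ^ n)" .
  \<comment> \<open>Regrouping by N = n + m collects the coefficient of x^N.\<close>
  define b where "b = (\<lambda>(N, n). a (n, N - n))"
  have reindex: "infsum a (UNIV \<times> UNIV) = infsum b (SIGMA N:UNIV. {..N})"
    by (rule infsum_reindex_bij_witness[of _ "\<lambda>(N, n). (n, N - n)" "\<lambda>(n, m). (n + m, n)"])
       (auto simp: b_def)
  have "b summable_on (SIGMA N:UNIV. {..N})"
    using summa
    by (rule iffD1[OF summable_on_reindex_bij_witness[of _ "\<lambda>(N, n). (n, N - n)" "\<lambda>(n, m). (n + m, n)"], rotated -1])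
       (auto simp: b_def)
  then have "infsum b (SIGMA N:UNIV. {..N}) = (\<Sum>\<^sub>\<infinity>N. \<Sum>\<^sub>\<infinity>n\<in>{..N}. b (N, n))"
    using infsum_Sigma'_banach[of "\<lambda>N n. b (N, n)" UNIV "\<lambda>N. {..N}"] by simp
  also have "\<dots> = (\<Sum>\<^sub>\<infinity>N::nat. if N = 0 then 1 else 0)"
  proof (rule infsum_cong)
    fix N :: nat
    have "(\<Sum>\<^sub>\<infinity>n\<in>{..N}. b (N, n)) = (\<Sum>n\<le>N. b (N, n))" by simp
    also have "\<dots> = (\<Sum>n\<le>N. (-1) ^ N * x ^ N / fact (Suc N) * - ((-1) ^ Suc n * real (Suc N choose Suc n) * real (Suc n) ^ N))"
    proof (rule sum.cong[OF refl])
      fix n assume "n \<in> {..N}"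
      then have n: "n \<le> N" by simp
      have bin: "real (Suc N choose Suc n) = fact (Suc N) / (fact (Suc n) * fact (N - n))"
        using binomial_fact[of "Suc n" "Suc N", where ?'a = real] n by simp
      have p1: "(- (real (Suc n) * x)) ^ (N - n) = (-1) ^ (N - n) * real (Suc n) ^ (N - n) * x ^ (N - n)"
        by (simp only: power_minus[of "real (Suc n) * x"] power_mult_distrib mult.assoc)
      have s: "(-1) ^ (N - n) = (-1 :: real) ^ N * (-1) ^ n"
      proof -
        have "(-1 :: real) ^ N = (-1) ^ (N - n) * (-1) ^ n" using n by (simp flip: power_add)
        moreover have "(-1 :: real) ^ n * (-1) ^ n = 1" by (simp flip: power_mult_distrib)
        ultimately show ?thesis by (simp only: mult.assoc mult_1_right)
      qed
      have "real (Suc n) ^ N = real (Suc n) ^ n * real (Suc n) ^ (N - n)" "x ^ N = x ^ n * x ^ (N - n)"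
        using n by (simp_all add: power_add[symmetric])
      then show "b (N, n) = (-1) ^ N * x ^ N / fact (Suc N) * - ((-1) ^ Suc n * real (Suc N choose Suc n) * real (Suc n) ^ N)"
        unfolding b_def a_def prod.case bin p1 s tree_coeff_def
        by (simp add: field_simps del: fact_Suc of_nat_Suc)
    qed
    also have "\<dots> = (-1) ^ N * x ^ N / fact (Suc N) * - (\<Sum>n\<le>N. (-1) ^ Suc n * real (Suc N choose Suc n) * real (Suc n) ^ N)"
      by (simp only: sum_distrib_left[symmetric] sum_negf)
    \<comment> \<open>Only the term k = 0 is missing from an alternating sum of order N + 1 with
      exponent N, which vanishes. Its value 0^N is 1 for N = 0 and 0 otherwise, so only the constant
      coefficient survives.\<close>
    also have "(\<Sum>n\<le>N. (-1) ^ Suc n * real (Suc N choose Suc n) * real (Suc n) ^ N)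
        = (\<Sum>k\<le>Suc N. (-1) ^ k * real (Suc N choose k) * real k ^ N) - 0 ^ N"
      by (subst sum.atMost_Suc_shift) (simp)
    also have "\<dots> = - (0 ^ N)"
      by (subst alternating_binomial_power_sum) auto
    finally show "(\<Sum>\<^sub>\<infinity>n\<in>{..N}. b (N, n)) = (if N = 0 then 1 else 0)"
      by (simp add: power_0_left)
  qed
  also have "\<dots> = 1"
    by (subst infsum_cong_neutral[where T = "{0}" and g = "\<lambda>_. 1"]) auto
  finally show ?thesis using 1 reindex by (simp add: mult.commute)
qed

text \<open>Equality in ln x \<le> x - 1 holds at x = 1 only. This is how subcriticality enters the
  normalization of the Borel weights.\<close>

lemma tree_radius:
  fixes x :: real
  assumes "0 \<le> x" "x < 1"
  shows "x * exp (- x) * exp 1 < 1"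
proof (cases "x = 0")
  case False
  then have "ln x < x - 1"
    using assms ln_le_minus_one[of x] ln_eq_minus_one[of x] by fastforce
  then have "x < exp (x - 1)"
    using assms False by (metis exp_less_mono exp_ln order_le_less)
  then show ?thesis
    by (simp add: exp_diff exp_minus field_simps)
qed simp

lemma tree_series:
  fixes x :: real
  assumes "0 \<le> x" "x < 1"
  shows "(\<Sum>n. tree_coeff n * (x * exp (- x)) ^ n) * exp (- x) = 1"
proof -
  define F where "F = Abs_fps (\<lambda>n. complex_of_real (tree_coeff n))"
  define S0 where "S0 = {z :: complex. norm (z * exp (- z)) * exp 1 < 1}"
  \<comment> \<open>\<open>S0\<close> also contains the reals beyond 1, where the identity fails
    because T (x exp (- x)) is then the other solution, below 1. The component of 0 contains [0, 1)
    and makes analytic continuation legitimate.\<close>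
  define S where "S = connected_component_set S0 0"
  have rad: "fps_conv_radius F \<ge> ereal (exp (- 1))"
    unfolding fps_conv_radius_def
  proof (rule conv_radius_geI_ex')
    fix r :: real assume r: "0 < r" "ereal r < ereal (exp (- 1))"
    then have "\<bar>r\<bar> * exp 1 < 1" by (simp add: exp_minus field_simps)
    from summable_of_real[OF summable_tree_coeff[OF this], where ?'a = complex]
    show "summable (\<lambda>n. fps_nth F n * of_real r ^ n)" using r by (simp add: F_def)
  qed
  have evalF: "eval_fps F (of_real y) = of_real (\<Sum>n. tree_coeff n * y ^ n)" if "0 \<le> y" "y * exp 1 < 1" for y
  proof -
    have "summable (\<lambda>n. tree_coeff n * y ^ n)"
      using summable_tree_coeff[of y] that by simp
    then show ?thesis
      by (simp add: eval_fps_def F_def suminf_of_real)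
  qed
  have "open S0"
    unfolding S0_def by (intro open_Collect_less continuous_intros)
  then have opS: "open S" unfolding S_def by (rule open_connected_component)
  have sub: "S \<subseteq> S0" unfolding S_def by (rule connected_component_subset)
  have I: "complex_of_real ` {0..<1} \<subseteq> S"
    unfolding S_def
  proof (rule connected_component_maximal)
    show "connected (complex_of_real ` {0..<1})"
      by (intro connected_continuous_image continuous_intros convex_connected) simp
    show "complex_of_real ` {0..<1} \<subseteq> S0"
      using tree_radius by (auto simp: S0_def norm_mult norm_exp_eq_Re simp flip: of_real_minus exp_of_real)
  qed auto
  define f where "f = (\<lambda>z. eval_fps F (z * exp (- z)) * exp (- z) - 1)"
  have f_real: "f (of_real y) = of_real ((\<Sum>n. tree_coeff n * (y * exp (- y)) ^ n) * exp (- y) - 1)"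
    if "0 \<le> y" "y < 1" for y
    using evalF[of "y * exp (- y)"] tree_radius[of y] that
    by (simp add: f_def exp_of_real flip: of_real_minus)
  have "f (of_real x) = 0"
  proof (rule analytic_continuation[of f S "complex_of_real ` {0<..<1/10}" 0])
    have "(eval_fps F \<circ> (\<lambda>z. z * exp (- z))) holomorphic_on S"
    proof (rule holomorphic_on_compose)
      show "eval_fps F holomorphic_on (\<lambda>z. z * exp (- z)) ` S"
      proof (rule holomorphic_on_eval_fps)
        have "ereal (norm (z * exp (- z))) < ereal (exp (- 1))" if "z \<in> S" for z
          using that sub by (auto simp: S0_def exp_minus field_simps)
        from less_le_trans[OF this rad] show "(\<lambda>z. z * exp (- z)) ` S \<subseteq> eball 0 (fps_conv_radius F)"
          by (auto simp: in_eball_iff)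
      qed
    qed (intro holomorphic_intros)
    then show "f holomorphic_on S"
      unfolding f_def by (intro holomorphic_intros) (simp add: o_def)
    show "complex_of_real ` {0<..<1/10} \<subseteq> S" using I by fastforce
    show "0 islimpt complex_of_real ` {0<..<1/10}"
    proof (subst islimpt_approachable, intro allI impI)
      fix e :: real assume "0 < e"
      then show "\<exists>x'\<in>complex_of_real ` {0<..<1/10}. x' \<noteq> 0 \<and> dist x' 0 < e"
        by (intro bexI[of _ "of_real (min (e / 2) (1 / 20))"]) auto
    qed
    show "f z = 0" if z: "z \<in> complex_of_real ` {0<..<1/10}" for z
    proof -
      obtain y where y: "z = of_real y" "0 < y" "y < 1 / 10" using z by auto
      then show ?thesis using f_real[of y] tree_series_small[of y] by simp
    qed
    have "(0 :: complex) = of_real 0" by simp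
    then show "0 \<in> S" using I by (metis atLeastLessThan_iff imageI less_numeral_extra(1) order_refl subsetD)
    show "of_real x \<in> S" using I assms by auto
    show "open S" by (fact opS)
    show "connected S" unfolding S_def by (rule connected_connected_component)
  qed
  then have "complex_of_real ((\<Sum>n. tree_coeff n * (x * exp (- x)) ^ n) * exp (- x) - 1) = 0"
    using f_real[OF assms] by (simp only:)
  then show ?thesis by (simp only: of_real_eq_0_iff right_minus_eq)
qed

lemma borel_dist_sets [simp, measurable_cong]: "sets (borel_dist \<rho>) = UNIV"
  by (simp add: borel_dist_def)

lemma borel_dist_space [simp]: "space (borel_dist \<rho>) = UNIV"
  by (simp add: borel_dist_def)

lemma nn_integral_borel_dist:
  assumes "f 0 = 0"
  shows "(\<integral>\<^sup>+ k. f k \<partial>borel_dist \<rho>) =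
    (\<Sum>k. ennreal (exp (- \<rho> * real (Suc k)) / fact (Suc k) * (\<rho> * real (Suc k)) ^ k) * f (Suc k))"
proof -
  define b where "b = (\<lambda>k. if k = 0 then 0
          else ennreal (exp (- \<rho> * real k) / fact k * (\<rho> * real k) ^ (k - 1)))"
  have "(\<integral>\<^sup>+ k. f k \<partial>borel_dist \<rho>) = (\<integral>\<^sup>+ k. b k * f k \<partial>count_space UNIV)"
    unfolding borel_dist_def b_def by (subst nn_integral_density) auto
  also have "\<dots> = (\<Sum>k. b k * f k)" by (simp add: nn_integral_count_space_nat)
  also have "\<dots> = (\<Sum>k. b (Suc k) * f (Suc k))"
    using suminf_offset[of "\<lambda>k. b k * f k" 1] assms by (simp add: summableI)
  finally show ?thesis by (simp add: b_def del: of_nat_Suc fact_Suc)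
qed

lemma emeasure_borel_dist:
  assumes "0 \<le> \<rho>" "\<rho> < 1"
  shows "emeasure (borel_dist \<rho>) UNIV = 1"
proof -
  have "emeasure (borel_dist \<rho>) UNIV = (\<integral>\<^sup>+ k. indicator {0<..} k \<partial>borel_dist \<rho>)"
  proof -
    have "(UNIV :: nat set) = {0} \<union> {0<..}" by auto
    then have "emeasure (borel_dist \<rho>) UNIV = emeasure (borel_dist \<rho>) {0} + emeasure (borel_dist \<rho>) {0<..}"
      using plus_emeasure[of "{0}" "borel_dist \<rho>" "{0<..}"] by simp
    moreover have "emeasure (borel_dist \<rho>) {0} = 0" by (simp add: borel_dist_def emeasure_density)
    ultimately have "emeasure (borel_dist \<rho>) UNIV = emeasure (borel_dist \<rho>) {0<..}" by simp
    then show ?thesis by simp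
  qed
  also have "\<dots> = (\<Sum>k. ennreal (exp (- \<rho>) * (tree_coeff k * (\<rho> * exp (- \<rho>)) ^ k)))"
  proof (subst nn_integral_borel_dist, simp, intro suminf_cong)
    fix k
    have "exp (- \<rho> * real (Suc k)) = exp (- \<rho>) * exp (- \<rho>) ^ k"
      by (simp add: exp_of_nat_mult[symmetric] exp_add[symmetric] algebra_simps)
    then have "exp (- \<rho> * real (Suc k)) / fact (Suc k) * (\<rho> * real (Suc k)) ^ k
        = exp (- \<rho>) * (tree_coeff k * (\<rho> * exp (- \<rho>)) ^ k)"
      by (simp only: tree_coeff_def power_mult_distrib times_divide_eq_left times_divide_eq_right mult_ac)
    then show "ennreal (exp (- \<rho> * real (Suc k)) / fact (Suc k) * (\<rho> * real (Suc k)) ^ k) * indicator {0<..} (Suc k) =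
         ennreal (exp (- \<rho>) * (tree_coeff k * (\<rho> * exp (- \<rho>)) ^ k))"
      by simp
  qed
  also have "\<dots> = ennreal (exp (- \<rho>) * (\<Sum>k. tree_coeff k * (\<rho> * exp (- \<rho>)) ^ k))"
  proof -
    have s: "summable (\<lambda>k. tree_coeff k * (\<rho> * exp (- \<rho>)) ^ k)"
      using summable_tree_coeff[of "\<rho> * exp (- \<rho>)"] tree_radius assms by simp
    show ?thesis
      using summable_mult[OF s, of "exp (- \<rho>)"] s assms
      by (subst suminf_ennreal2) (auto simp: tree_coeff_nonneg suminf_mult)
  qed
  finally show ?thesis using tree_series[OF assms] by (simp add: mult.commute)
qed

section \<open>Measures on finite products of the real line\<close>

abbreviation vec :: "nat \<Rightarrow> (nat \<Rightarrow> real) measure" where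
  "vec n \<equiv> Pi\<^sub>M {1..<n} (\<lambda>_. borel)"

abbreviation lvec :: "nat \<Rightarrow> (nat \<Rightarrow> real) measure" where
  "lvec n \<equiv> Pi\<^sub>M {1..<n} (\<lambda>_. lborel)"

abbreviation uvec :: "nat \<Rightarrow> (nat \<Rightarrow> real) measure" where
  "uvec n \<equiv> Pi\<^sub>M {1..<n} (\<lambda>_. uniform_measure lborel {0<..<1})"

abbreviation seqs :: "(nat \<Rightarrow> real) measure" where
  "seqs \<equiv> Pi\<^sub>M UNIV (\<lambda>_. borel)"

section \<open>Measures that agree on ordered boxes\<close>

lemma emeasure_eq_on_countable_cover:
  assumes sets: "sets \<mu> = sets \<nu>"
    and C: "countable \<C>" "\<C> \<subseteq> sets \<mu>"
    and eq: "\<And>C A. C \<in> \<C> \<Longrightarrow> A \<in> sets \<mu> \<Longrightarrow> A \<subseteq> C \<Longrightarrow> emeasure \<mu> A = emeasure \<nu> A"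
    and A: "A \<in> sets \<mu>" "A \<subseteq> \<Union>\<C>"
  shows "emeasure \<mu> A = emeasure \<nu> A"
proof (cases "\<C> = {}")
  case True
  then show ?thesis using A by simp
next
  case False
  define D where "D = from_nat_into \<C>"
  have D: "range D = \<C>" unfolding D_def using False C(1) by (rule range_from_nat_into)
  then have Dm: "range D \<subseteq> sets \<mu>" using C by simp
  define E where "E i = A \<inter> disjointed D i" for i
  have Em: "E i \<in> sets \<mu>" for i
    using sets.range_disjointed_sets[OF Dm] A unfolding E_def by auto
  have AE: "A = (\<Union>i. E i)"
    using A(2) D unfolding E_def by (simp flip: Int_UN_distrib add: UN_disjointed_eq) blast
  have dj: "disjoint_family E"
    using disjoint_family_disjointed[of D] by (auto simp: E_def disjoint_family_on_def)
  have "emeasure \<mu> (E i) = emeasure \<nu> (E i)" for i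
    using D disjointed_subset[of D i] by (intro eq[of "D i"] Em) (auto simp: E_def)
  moreover have "emeasure \<mu> A = (\<Sum>i. emeasure \<mu> (E i))"
    unfolding AE by (rule suminf_emeasure[symmetric]) (use Em dj in auto)
  moreover have "emeasure \<nu> A = (\<Sum>i. emeasure \<nu> (E i))"
    unfolding AE by (rule suminf_emeasure[symmetric]) (use Em dj sets in auto)
  ultimately show ?thesis by simp
qed

text \<open>
  The region \<open>x j < x k\<close>, \<open>(j, k) \<in> R\<close>, is a countable union of grid cells; a grid cell is a
  box whose sides are separated, and so are its intersections with boxes.
\<close>

lemma emeasure_eq_on_ordered:
  fixes \<mu> \<nu> :: "(nat \<Rightarrow> real) measure"
  assumes I: "finite I" and R: "R \<subseteq> I \<times> I"
    and sets: "sets \<mu> = sets (Pi\<^sub>M I (\<lambda>_. borel))" "sets \<nu> = sets (Pi\<^sub>M I (\<lambda>_. borel))"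
    and fin: "finite_measure \<mu>"
    and box: "\<And>B. (\<And>i. i \<in> I \<Longrightarrow> B i \<in> sets borel) \<Longrightarrow>
        (\<And>j k x y. (j, k) \<in> R \<Longrightarrow> x \<in> B j \<Longrightarrow> y \<in> B k \<Longrightarrow> x < y) \<Longrightarrow>
        emeasure \<mu> (Pi\<^sub>E I B) = emeasure \<nu> (Pi\<^sub>E I B)"
    and A: "A \<in> sets \<mu>" "\<And>x j k. x \<in> A \<Longrightarrow> (j, k) \<in> R \<Longrightarrow> x j < x k"
  shows "emeasure \<mu> A = emeasure \<nu> A"
proof -
  define D where "D N c i = {y :: real. \<lfloor>real N * y\<rfloor> = c i}" for N and c :: "nat \<Rightarrow> int" and i :: nat
  define K where "K = (UNIV :: nat set) \<times> (\<Pi>\<^sub>E i\<in>I. (UNIV :: int set))"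
  define K' where "K' = {(N, c) \<in> K. \<forall>(j, k)\<in>R. c j < c k}"
  have Dm [measurable]: "D N c i \<in> sets borel" for N c i
    unfolding D_def by measurable
  have "countable K" unfolding K_def
    by (intro countable_SIGMA countable_PiE I) auto
  then have cK: "countable K'" by (rule countable_subset[rotated]) (auto simp: K'_def)
  have PiE_m: "Pi\<^sub>E I B \<in> sets (Pi\<^sub>M I (\<lambda>_. borel))" if "\<And>i. i \<in> I \<Longrightarrow> B i \<in> sets borel" for B :: "nat \<Rightarrow> real set"
    using I that by (rule sets_PiM_I_finite)
  have sep: "x < y" if "(N, c) \<in> K'" "(j, k) \<in> R" "x \<in> D N c j" "y \<in> D N c k" for N c j k x y
  proof (rule ccontr)
    assume "\<not> x < y"
    then have "real N * y \<le> real N * x" by (intro mult_left_mono) auto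
    then have "\<lfloor>real N * y\<rfloor> \<le> \<lfloor>real N * x\<rfloor>" by (rule floor_mono)
    then show False using that unfolding K'_def D_def by fastforce
  qed
  show ?thesis
  proof (rule emeasure_eq_on_countable_cover[where \<C> = "(\<lambda>(N, c). Pi\<^sub>E I (D N c)) ` K'"])
    show "countable ((\<lambda>(N, c). Pi\<^sub>E I (D N c)) ` K')" using cK by simp
    show "(\<lambda>(N, c). Pi\<^sub>E I (D N c)) ` K' \<subseteq> sets \<mu>" using PiE_m sets by auto
    show "A \<subseteq> \<Union> ((\<lambda>(N, c). Pi\<^sub>E I (D N c)) ` K')"
    proof
      fix x assume x: "x \<in> A"
      \<comment> \<open>As soon as 1/N is at most every gap x k - x j, the floors of N x j and N x k
        differ. \<open>R\<close> is finite, so one N serves all pairs.\<close>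
      have "\<forall>\<^sub>F N in sequentially. \<forall>r\<in>R. real N * (x (snd r) - x (fst r)) \<ge> 1"
      proof (rule eventually_ball_finite)
        show "finite R" using R I by (meson finite_SigmaI finite_subset)
        show "\<forall>r\<in>R. \<forall>\<^sub>F N in sequentially. real N * (x (snd r) - x (fst r)) \<ge> 1"
        proof
          fix r assume "r \<in> R"
          then have d: "x (snd r) - x (fst r) > 0" using A(2)[OF x, of "fst r" "snd r"] by simp
          show "\<forall>\<^sub>F N in sequentially. real N * (x (snd r) - x (fst r)) \<ge> 1"
            using eventually_ge_at_top[of "nat \<lceil>1 / (x (snd r) - x (fst r))\<rceil>"]
          proof eventually_elim
            case (elim N)
            then have "1 / (x (snd r) - x (fst r)) \<le> real N" by linarith
            then show ?case using d by (simp add: divide_le_eq)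
          qed
        qed
      qed
      then obtain N where N: "\<And>j k. (j, k) \<in> R \<Longrightarrow> real N * (x k - x j) \<ge> 1"
        by (force simp: eventually_sequentially)
      define c where "c = (\<lambda>i\<in>I. \<lfloor>real N * x i\<rfloor>)"
      have "c j < c k" if "(j, k) \<in> R" for j k
      proof -
        have "\<lfloor>real N * x j\<rfloor> + 1 \<le> \<lfloor>real N * x k\<rfloor>"
          using N[OF that] by (simp add: algebra_simps le_floor_iff) linarith
        then show ?thesis using R that by (auto simp: c_def)
      qed
      moreover have "c \<in> (\<Pi>\<^sub>E i\<in>I. UNIV)" by (simp add: c_def)
      ultimately have "(N, c) \<in> K'" unfolding K'_def K_def by blast
      moreover have "x \<in> extensional I"
        using x A(1) sets sets.sets_into_space[of A "Pi\<^sub>M I (\<lambda>_. borel)"] by (auto simp: space_PiM PiE_def)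
      then have "x \<in> Pi\<^sub>E I (D N c)" by (auto simp: PiE_def D_def c_def)
      ultimately show "x \<in> \<Union> ((\<lambda>(N, c). Pi\<^sub>E I (D N c)) ` K')" by force
    qed
    show "sets \<mu> = sets \<nu>" using sets by simp
    fix C A' assume "C \<in> (\<lambda>(N, c). Pi\<^sub>E I (D N c)) ` K'" and A': "A' \<in> sets \<mu>" "A' \<subseteq> C"
    then obtain N c where Nc: "(N, c) \<in> K'" and C: "C = Pi\<^sub>E I (D N c)" by auto
    have Cm: "C \<in> sets (Pi\<^sub>M I (\<lambda>_. borel))" unfolding C by (rule PiE_m) simp
    \<comment> \<open>Restricted to one cell, both measures are determined by their values on boxes:
      a box intersected with the cell has separated sides, so \<open>box\<close> applies to
      it.\<close>
    have "density \<mu> (indicator C) = density \<nu> (indicator C)"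
    proof (rule measure_eqI_PiM_finite[OF I])
      show "sets (density \<mu> (indicator C)) = sets (Pi\<^sub>M I (\<lambda>_. borel))"
        "sets (density \<nu> (indicator C)) = sets (Pi\<^sub>M I (\<lambda>_. borel))" using sets by simp_all
      show "range (\<lambda>_ :: nat. \<Pi>\<^sub>E i\<in>I. UNIV) \<subseteq> prod_algebra I (\<lambda>_. borel :: real measure)"
        using prod_algebraI_finite[OF I, of "\<lambda>_. UNIV" "\<lambda>_. borel"] by auto
      show "(\<Union>i :: nat. \<Pi>\<^sub>E i\<in>I. UNIV) = space (Pi\<^sub>M I (\<lambda>_. borel :: real measure))"
        by (simp add: space_PiM)
      have "emeasure (density \<mu> (indicator C)) X = emeasure \<mu> (C \<inter> X)" if "X \<in> sets \<mu>" for X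
        using that Cm sets by (simp add: emeasure_density indicator_inter_arith[symmetric] sets.Int)
      from this[of "\<Pi>\<^sub>E i\<in>I. UNIV"]
      show "emeasure (density \<mu> (indicator C)) (\<Pi>\<^sub>E i\<in>I. UNIV) \<noteq> \<infinity>" for i :: nat
        using PiE_m[of "\<lambda>_. UNIV"] sets finite_measure.emeasure_finite[OF fin] by simp
      fix B :: "nat \<Rightarrow> real set" assume B: "\<And>i. i \<in> I \<Longrightarrow> B i \<in> sets borel"
      have eq: "C \<inter> Pi\<^sub>E I B = Pi\<^sub>E I (\<lambda>i. D N c i \<inter> B i)" unfolding C by auto
      have "emeasure \<mu> (C \<inter> Pi\<^sub>E I B) = emeasure \<nu> (C \<inter> Pi\<^sub>E I B)"
        unfolding eq by (rule box) (use B sep[OF Nc] in auto)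
      then show "emeasure (density \<mu> (indicator C)) (Pi\<^sub>E I B) = emeasure (density \<nu> (indicator C)) (Pi\<^sub>E I B)"
        using Cm PiE_m[OF B] sets
        by (simp add: emeasure_density indicator_inter_arith[symmetric] sets.Int)
    qed
    then have "emeasure (density \<mu> (indicator C)) A' = emeasure (density \<nu> (indicator C)) A'" by simp
    moreover have "C \<inter> A' = A'" using A' by auto
    ultimately show "emeasure \<mu> A' = emeasure \<nu> A'"
      using Cm sets A' by (simp add: emeasure_density indicator_inter_arith[symmetric])
  qed (fact A)
qed

section \<open>Changes of variables\<close>

lemma nn_integral_PiM_permute:
  fixes f :: "('i \<Rightarrow> real) \<Rightarrow> ennreal"
  assumes I: "finite I" and \<sigma>: "\<sigma> permutes I"
    and f: "f \<in> borel_measurable (Pi\<^sub>M I (\<lambda>_. borel))"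
  shows "(\<integral>\<^sup>+x. f (\<lambda>i\<in>I. x (\<sigma> i)) \<partial>Pi\<^sub>M I (\<lambda>_. lborel)) = (\<integral>\<^sup>+x. f x \<partial>Pi\<^sub>M I (\<lambda>_. lborel))"
proof -
  interpret product_sigma_finite "\<lambda>_ :: 'i. lborel :: real measure" by standard
  let ?P = "Pi\<^sub>M I (\<lambda>_. lborel :: real measure)"
  have [measurable]: "(\<lambda>x. \<lambda>i\<in>I. x (\<sigma> i)) \<in> ?P \<rightarrow>\<^sub>M ?P"
    by (rule measurable_restrict, rule measurable_component_singleton) (simp add: permutes_in_image[OF \<sigma>])
  have P: "distr ?P ?P (\<lambda>x. \<lambda>i\<in>I. x (\<sigma> i)) = ?P"
  proof (rule PiM_eqI[OF I])
    fix A assume A: "\<And>i. i \<in> I \<Longrightarrow> A i \<in> sets (lborel :: real measure)"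
    have "(\<lambda>x. \<lambda>i\<in>I. x (\<sigma> i)) -` Pi\<^sub>E I A \<inter> space ?P = Pi\<^sub>E I (\<lambda>i. A (inv \<sigma> i))"
      (is "?l = ?r")
    proof
      show "?l \<subseteq> ?r"
      proof
        fix x assume x: "x \<in> ?l"
        have "x i \<in> A (inv \<sigma> i)" if "i \<in> I" for i
        proof -
          have "inv \<sigma> i \<in> I" using that \<sigma> by (metis permutes_in_image permutes_inv)
          then have "x (\<sigma> (inv \<sigma> i)) \<in> A (inv \<sigma> i)" using x by (auto simp: PiE_iff)
          then show ?thesis using \<sigma> by (simp add: permutes_inverses)
        qed
        then show "x \<in> ?r" using x by (auto simp: space_PiM PiE_iff)
      qed
      show "?r \<subseteq> ?l"
        using \<sigma> permutes_in_image[OF \<sigma>] by (force simp: space_PiM PiE_iff permutes_inverses)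
    qed
    moreover have "(\<Prod>i\<in>I. emeasure lborel (A (inv \<sigma> i))) = (\<Prod>i\<in>I. emeasure lborel (A i))"
      using prod.permute[OF permutes_inv[OF \<sigma>], of "\<lambda>i. emeasure lborel (A i)"] by (simp add: o_def)
    moreover have "A (inv \<sigma> i) \<in> sets lborel" if "i \<in> I" for i
      using A that \<sigma> by (metis permutes_in_image permutes_inv)
    ultimately show "emeasure (distr ?P ?P (\<lambda>x. \<lambda>i\<in>I. x (\<sigma> i))) (Pi\<^sub>E I A) = (\<Prod>i\<in>I. emeasure lborel (A i))"
      using A I by (subst emeasure_distr) (auto simp: emeasure_PiM intro!: sets_PiM_I_finite)
  qed simp
  have "f \<in> borel_measurable ?P"
    using f by (simp cong: measurable_cong_sets sets_PiM_cong)
  then have "(\<integral>\<^sup>+x. f x \<partial>distr ?P ?P (\<lambda>x. \<lambda>i\<in>I. x (\<sigma> i))) = (\<integral>\<^sup>+x. f (\<lambda>i\<in>I. x (\<sigma> i)) \<partial>?P)"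
    by (subst nn_integral_distr) auto
  then show ?thesis unfolding P by simp
qed

text \<open>
  Change of variables for a map whose \<open>i\<close>-th coordinate depends on the first \<open>i\<close> coordinates only,
  reduced to one variable by integrating out the last coordinate.
\<close>

lemma nn_integral_triangular:
  fixes N :: "real measure" and w v :: "nat \<Rightarrow> (nat \<Rightarrow> real) \<Rightarrow> real \<Rightarrow> ennreal"
    and t :: "nat \<Rightarrow> (nat \<Rightarrow> real) \<Rightarrow> real \<Rightarrow> real"
  assumes N: "sigma_finite_measure N" "sets N = sets borel"
    and w_cong: "\<And>i a b y. (\<And>j. j \<in> {1..<i} \<Longrightarrow> a j = b j) \<Longrightarrow> w i a y = w i b y"
    and t_cong: "\<And>i a b y. (\<And>j. j \<in> {1..<i} \<Longrightarrow> a j = b j) \<Longrightarrow> t i a y = t i b y"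
    and v_cong: "\<And>i a b y. (\<And>j. j \<in> {1..<i} \<Longrightarrow> a j = b j) \<Longrightarrow> v i a y = v i b y"
    and w_meas: "\<And>i k. 1 \<le> i \<Longrightarrow> i \<le> k \<Longrightarrow>
        case_prod (w i) \<in> borel_measurable (vec k \<Otimes>\<^sub>M borel)"
    and t_meas: "\<And>i k. 1 \<le> i \<Longrightarrow> i \<le> k \<Longrightarrow>
        case_prod (t i) \<in> borel_measurable (vec k \<Otimes>\<^sub>M borel)"
    and v_meas: "\<And>i k. 1 \<le> i \<Longrightarrow> i \<le> k \<Longrightarrow>
        case_prod (v i) \<in> borel_measurable (vec k \<Otimes>\<^sub>M borel)"
    and step: "\<And>i a \<psi>. 1 \<le> i \<Longrightarrow> (\<And>j. j \<in> {1..<i} \<Longrightarrow> w j a (a j) \<noteq> 0) \<Longrightarrow>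
        \<psi> \<in> borel_measurable borel \<Longrightarrow>
        (\<integral>\<^sup>+y. w i a y * \<psi> (t i a y) \<partial>N) = (\<integral>\<^sup>+z. v i (\<lambda>j. t j a (a j)) z * \<psi> z \<partial>lborel)"
    and \<Psi>: "\<Psi> \<in> borel_measurable (vec n)"
  shows "(\<integral>\<^sup>+a. (\<Prod>j\<in>{1..<n}. w j a (a j)) * \<Psi> (\<lambda>j\<in>{1..<n}. t j a (a j)) \<partial>Pi\<^sub>M {1..<n} (\<lambda>_. N)) =
    (\<integral>\<^sup>+L. (\<Prod>j\<in>{1..<n}. v j L (L j)) * \<Psi> L \<partial>lvec n)"
  using \<Psi>
proof (induction n arbitrary: \<Psi>)
  case 0
  then show ?case by (simp add: PiM_empty restrict_def nn_integral_count_space_finite)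
next
  case (Suc n)
  show ?case
  proof (cases "n = 0")
    case True
    then show ?thesis by (simp add: PiM_empty restrict_def nn_integral_count_space_finite)
  next
    case False
    then have n: "1 \<le> n" and ins: "{1..<Suc n} = insert n {1..<n}" by auto
    interpret N: sigma_finite_measure N by fact
    interpret PN: product_sigma_finite "\<lambda>_ :: nat. N" by standard
    interpret PL: product_sigma_finite "\<lambda>_ :: nat. lborel :: real measure" by standard
    note [measurable_cong] = N(2)
    have sN: "sets (Pi\<^sub>M I (\<lambda>_ :: nat. N)) = sets (Pi\<^sub>M I (\<lambda>_ :: nat. borel))" for I
      by (rule sets_PiM_cong) (use N in auto)
    have sL: "sets (Pi\<^sub>M I (\<lambda>_ :: nat. lborel :: real measure)) = sets (Pi\<^sub>M I (\<lambda>_ :: nat. borel))" for I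
      by (rule sets_PiM_cong) auto
    note meas = measurable_cong_sets[OF sN refl] measurable_cong_sets[OF sL refl]
      measurable_cong_sets[OF N(2) refl] measurable_lborel1
    let ?B = "\<lambda>I. Pi\<^sub>M I (\<lambda>_ :: nat. borel :: real measure)"
    have diag: "(\<lambda>a. f j a (a j)) \<in> borel_measurable (?B {1..<k})"
      if "\<And>i k. 1 \<le> i \<Longrightarrow> i \<le> k \<Longrightarrow> case_prod (f i) \<in> borel_measurable (?B {1..<k} \<Otimes>\<^sub>M borel)"
        "j \<in> {1..<k}" for f :: "nat \<Rightarrow> (nat \<Rightarrow> real) \<Rightarrow> real \<Rightarrow> 'c :: {second_countable_topology, t2_space}" and j k
    proof -
      have "(\<lambda>a. (a, a j)) \<in> ?B {1..<k} \<rightarrow>\<^sub>M ?B {1..<k} \<Otimes>\<^sub>M borel"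
        using that by measurable
      from measurable_compose[OF this that(1)[of j k]] that(2) show ?thesis by simp
    qed
    have tm: "(\<lambda>a. \<lambda>j\<in>{1..<k}. t j a (a j)) \<in> ?B {1..<k} \<rightarrow>\<^sub>M ?B {1..<k}" for k
      by (rule measurable_restrict) (rule diag[OF t_meas])
    have upd: "case_prod (\<lambda>L z. L(n := z)) \<in> ?B {1..<n} \<Otimes>\<^sub>M borel \<rightarrow>\<^sub>M ?B {1..<Suc n}"
      unfolding ins by (rule measurable_add_dim)
    \<comment> \<open>Integrating out the last image coordinate gives the test function for the
      induction hypothesis.\<close>
    define \<Psi>' where "\<Psi>' L = (\<integral>\<^sup>+z. v n L z * \<Psi> (L(n := z)) \<partial>lborel)" for L
    have vP: "case_prod (\<lambda>L z. v n L z * \<Psi> (L(n := z))) \<in> borel_measurable (?B {1..<n} \<Otimes>\<^sub>M borel)"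
      using borel_measurable_times_ennreal[OF v_meas[OF n order_refl] measurable_compose[OF upd Suc.prems]]
      by (simp add: split_def fun_upd_def)
    have "\<Psi>' \<in> borel_measurable (?B {1..<n})"
    proof -
      have "case_prod (\<lambda>L z. v n L z * \<Psi> (L(n := z))) \<in> borel_measurable (?B {1..<n} \<Otimes>\<^sub>M lborel)"
        using vP by (simp cong: measurable_cong_sets)
      from lborel.borel_measurable_nn_integral[OF this] show ?thesis
        unfolding \<Psi>'_def .
    qed
    from Suc.IH[OF this]
    have IH: "(\<integral>\<^sup>+a. (\<Prod>j\<in>{1..<n}. w j a (a j)) * \<Psi>' (\<lambda>j\<in>{1..<n}. t j a (a j)) \<partial>Pi\<^sub>M {1..<n} (\<lambda>_. N)) =
      (\<integral>\<^sup>+L. (\<Prod>j\<in>{1..<n}. v j L (L j)) * \<Psi>' L \<partial>lvec n)" .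
    have wu: "w j (a(n := y)) = w j a" "t j (a(n := y)) = t j a" "v j (a(n := y)) = v j a" if "j \<le> n" for j a y
      using that by (auto intro!: ext w_cong t_cong v_cong)
    have prodm: "(\<lambda>a. \<Prod>j\<in>{1..<k}. f j a (a j)) \<in> borel_measurable (?B {1..<k})"
      if "\<And>i k. 1 \<le> i \<Longrightarrow> i \<le> k \<Longrightarrow> case_prod (f i) \<in> borel_measurable (?B {1..<k} \<Otimes>\<^sub>M borel)"
      for f :: "nat \<Rightarrow> (nat \<Rightarrow> real) \<Rightarrow> real \<Rightarrow> ennreal" and k
      by (rule borel_measurable_prod_ennreal) (rule diag[OF that])
    have sect: "(\<lambda>z. L(n := z)) \<in> borel \<rightarrow>\<^sub>M ?B {1..<Suc n}" if "L \<in> space (?B {1..<n})" for L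
      using measurable_compose[OF measurable_Pair1'[OF that] upd] by simp
    have sect2: "f n L \<in> borel_measurable borel"
      if "\<And>i k. 1 \<le> i \<Longrightarrow> i \<le> k \<Longrightarrow> case_prod (f i) \<in> borel_measurable (?B {1..<k} \<Otimes>\<^sub>M borel)"
        "L \<in> space (?B {1..<n})" for f :: "nat \<Rightarrow> (nat \<Rightarrow> real) \<Rightarrow> real \<Rightarrow> 'c :: {second_countable_topology, t2_space}" and L
      using measurable_compose[OF measurable_Pair1'[OF that(2)] that(1)[OF n order_refl]] by simp
    have "(\<integral>\<^sup>+a. (\<Prod>j\<in>{1..<Suc n}. w j a (a j)) * \<Psi> (\<lambda>j\<in>{1..<Suc n}. t j a (a j)) \<partial>Pi\<^sub>M {1..<Suc n} (\<lambda>_. N))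
      = (\<integral>\<^sup>+a. (\<integral>\<^sup>+y. (\<Prod>j\<in>{1..<Suc n}. w j (a(n := y)) ((a(n := y)) j)) *
            \<Psi> (\<lambda>j\<in>{1..<Suc n}. t j (a(n := y)) ((a(n := y)) j)) \<partial>N) \<partial>Pi\<^sub>M {1..<n} (\<lambda>_. N))"
    proof (rule PN.product_nn_integral_insert[of "{1..<n}" n, unfolded ins[symmetric]])
      show "(\<lambda>a. (\<Prod>j\<in>{1..<Suc n}. w j a (a j)) * \<Psi> (\<lambda>j\<in>{1..<Suc n}. t j a (a j)))
          \<in> borel_measurable (Pi\<^sub>M {1..<Suc n} (\<lambda>_. N))"
        unfolding meas
        by (intro borel_measurable_times_ennreal prodm w_meas measurable_compose[OF tm Suc.prems]) auto
    qed auto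
    also have "\<dots> = (\<integral>\<^sup>+a. (\<Prod>j\<in>{1..<n}. w j a (a j)) * \<Psi>' (\<lambda>j\<in>{1..<n}. t j a (a j)) \<partial>Pi\<^sub>M {1..<n} (\<lambda>_. N))"
    proof (rule nn_integral_cong)
      fix a assume "a \<in> space (Pi\<^sub>M {1..<n} (\<lambda>_. N))"
      then have a: "a \<in> space (?B {1..<n})" using sets_eq_imp_space_eq[OF sN] by blast
      define T where "T = (\<lambda>j\<in>{1..<n}. t j a (a j))"
      have T: "T \<in> space (?B {1..<n})" by (simp add: T_def space_PiM)
      have upT: "(\<lambda>j\<in>{1..<Suc n}. t j (a(n := y)) ((a(n := y)) j)) = T(n := t n a y)" for y
        using n by (auto simp: T_def fun_eq_iff wu)
      have pr: "(\<Prod>j\<in>{1..<Suc n}. w j (a(n := y)) ((a(n := y)) j)) = (\<Prod>j\<in>{1..<n}. w j a (a j)) * w n a y" for y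
        unfolding ins by (simp add: wu mult.commute)
      have tu: "(\<lambda>z. \<Psi> (T(n := z))) \<in> borel_measurable borel"
        by (rule measurable_compose[OF sect[OF T] Suc.prems])
      have "(\<integral>\<^sup>+y. (\<Prod>j\<in>{1..<Suc n}. w j (a(n := y)) ((a(n := y)) j)) *
            \<Psi> (\<lambda>j\<in>{1..<Suc n}. t j (a(n := y)) ((a(n := y)) j)) \<partial>N)
        = (\<integral>\<^sup>+y. (\<Prod>j\<in>{1..<n}. w j a (a j)) * (w n a y * \<Psi> (T(n := t n a y))) \<partial>N)"
        unfolding upT pr by (simp add: mult.assoc)
      also have "\<dots> = (\<Prod>j\<in>{1..<n}. w j a (a j)) * (\<integral>\<^sup>+y. w n a y * \<Psi> (T(n := t n a y)) \<partial>N)"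
      proof (rule nn_integral_cmult)
        show "(\<lambda>y. w n a y * \<Psi> (T(n := t n a y))) \<in> borel_measurable N"
          unfolding meas
          by (intro borel_measurable_times_ennreal sect2[OF w_meas a] measurable_compose[OF sect2[OF t_meas a] tu])
      qed
      also have "\<dots> = (\<Prod>j\<in>{1..<n}. w j a (a j)) * \<Psi>' T"
      \<comment> \<open>Prefixes of weight 0 contribute nothing on either side, so
        \<open>step\<close> is invoked only where all earlier weights are nonzero, as its premise
        demands.\<close>
      proof (cases "(\<Prod>j\<in>{1..<n}. w j a (a j)) = 0")
        case False
        then have "(\<integral>\<^sup>+y. w n a y * \<Psi> (T(n := t n a y)) \<partial>N)
            = (\<integral>\<^sup>+z. v n (\<lambda>j. t j a (a j)) z * \<Psi> (T(n := z)) \<partial>lborel)"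
          by (intro step n tu) auto
        also have "v n (\<lambda>j. t j a (a j)) = v n T" by (intro ext v_cong) (simp add: T_def)
        finally show ?thesis by (simp only: \<Psi>'_def)
      next
        case True
        then show ?thesis by (simp only: mult_zero_left)
      qed
      finally show "(\<integral>\<^sup>+y. (\<Prod>j\<in>{1..<Suc n}. w j (a(n := y)) ((a(n := y)) j)) *
            \<Psi> (\<lambda>j\<in>{1..<Suc n}. t j (a(n := y)) ((a(n := y)) j)) \<partial>N) =
          (\<Prod>j\<in>{1..<n}. w j a (a j)) * \<Psi>' (\<lambda>j\<in>{1..<n}. t j a (a j))" unfolding T_def .
    qed
    also note IH
    also have "(\<integral>\<^sup>+L. (\<Prod>j\<in>{1..<n}. v j L (L j)) * \<Psi>' L \<partial>lvec n)
      = (\<integral>\<^sup>+L. (\<integral>\<^sup>+z. (\<Prod>j\<in>{1..<Suc n}. v j (L(n := z)) ((L(n := z)) j)) * \<Psi> (L(n := z)) \<partial>lborel)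
            \<partial>lvec n)"
    proof (rule nn_integral_cong)
      fix L assume "L \<in> space (lvec n)"
      then have L: "L \<in> space (?B {1..<n})" using sets_eq_imp_space_eq[OF sL] by blast
      have pr: "(\<Prod>j\<in>{1..<Suc n}. v j (L(n := z)) ((L(n := z)) j)) = (\<Prod>j\<in>{1..<n}. v j L (L j)) * v n L z" for z
        unfolding ins by (simp add: wu mult.commute)
      show "(\<Prod>j\<in>{1..<n}. v j L (L j)) * \<Psi>' L
        = (\<integral>\<^sup>+z. (\<Prod>j\<in>{1..<Suc n}. v j (L(n := z)) ((L(n := z)) j)) * \<Psi> (L(n := z)) \<partial>lborel)"
        unfolding pr \<Psi>'_def mult.assoc
      proof (rule nn_integral_cmult[symmetric])
        show "(\<lambda>z. v n L z * \<Psi> (L(n := z))) \<in> borel_measurable lborel"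
          unfolding measurable_lborel2
          by (intro borel_measurable_times_ennreal sect2[OF v_meas L] measurable_compose[OF sect[OF L] Suc.prems])
      qed
    qed
    also have "\<dots> = (\<integral>\<^sup>+L. (\<Prod>j\<in>{1..<Suc n}. v j L (L j)) * \<Psi> L \<partial>lvec (Suc n))"
    proof (rule PL.product_nn_integral_insert[of "{1..<n}" n, unfolded ins[symmetric], symmetric])
      show "(\<lambda>L. (\<Prod>j\<in>{1..<Suc n}. v j L (L j)) * \<Psi> L) \<in> borel_measurable (lvec (Suc n))"
        unfolding meas
        by (intro borel_measurable_times_ennreal prodm v_meas Suc.prems) auto
    qed auto
    finally show ?thesis .
  qed
qed

text \<open>Reading the primitive as the distribution function of a finite measure turns continuity
  into the absence of atoms and strict increase into positive mass of intervals.\<close>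

lemma primitive_cdf:
  fixes k :: "real \<Rightarrow> real"
  assumes k: "integrable lborel k" "\<And>y. 0 \<le> k y"
  defines "K \<equiv> \<lambda>y. LINT u:{..y}|lborel. k u" and "D \<equiv> density lborel (\<lambda>u. ennreal (k u))"
  shows "finite_borel_measure D" "cdf D = K" "isCont K y" "measure D (space D) = (LINT u|lborel. k u)"
    and "x < y \<Longrightarrow> (\<And>u. x < u \<Longrightarrow> u \<le> y \<Longrightarrow> 0 < k u) \<Longrightarrow> K x < K y"
proof -
  have km [measurable]: "k \<in> borel_measurable borel" using k(1) by measurable
  have em: "emeasure D A = ennreal (LINT u:A|lborel. k u)" if [measurable]: "A \<in> sets borel" for A
  proof -
    have "emeasure D A = (\<integral>\<^sup>+u. ennreal (indicator A u * k u) \<partial>lborel)"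
      unfolding D_def by (subst emeasure_density) (auto intro!: nn_integral_cong split: split_indicator)
    also have "\<dots> = ennreal (LINT u:A|lborel. k u)"
      unfolding set_lebesgue_integral_def
      using k integrable_mult_indicator[of A lborel k] by (subst nn_integral_eq_integral) auto
    finally show ?thesis .
  qed
  have pos: "0 \<le> (LINT u:A|lborel. k u)" for A
    unfolding set_lebesgue_integral_def using k by (intro integral_nonneg_AE) auto
  have meas: "measure D A = (LINT u:A|lborel. k u)" if "A \<in> sets borel" for A
    using em[OF that] pos by (simp add: measure_def)
  have sD [simp, measurable_cong]: "sets D = sets borel" by (simp add: D_def)
  show fin: "finite_borel_measure D"
  proof (intro finite_borel_measure.intro finite_measureI finite_borel_measure_axioms.intro)
    show "emeasure D (space D) \<noteq> \<infinity>" using em[of UNIV] by (simp add: D_def)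
  qed (simp add: D_def)
  interpret D: finite_borel_measure D by (fact fin)
  show K: "cdf D = K" by (simp add: fun_eq_iff K_def cdf_def meas)
  show "measure D (space D) = (LINT u|lborel. k u)"
    using meas[of UNIV] by (simp add: D_def set_lebesgue_integral_def)
  show "isCont K y"
  proof -
    have "measure D {y} = 0"
      unfolding measure_def D_def by (subst emeasure_density) (auto simp: nn_integral_cmult_indicator)
    then show ?thesis unfolding K[symmetric] D.isCont_cdf .
  qed
  assume xy: "x < y" and kp: "\<And>u. x < u \<Longrightarrow> u \<le> y \<Longrightarrow> 0 < k u"
  have "emeasure D {x<..y} \<noteq> 0"
  proof
    assume "emeasure D {x<..y} = 0"
    then have "AE u in lborel. ennreal (k u) * indicator {x<..y} u = 0"
      unfolding D_def by (subst (asm) emeasure_density) (auto simp: nn_integral_0_iff_AE)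
    then have "AE u in lborel. u \<notin> {x<..y}"
    proof eventually_elim
      case (elim u)
      have "ennreal (k u) \<noteq> 0" if "x < u" "u \<le> y" using kp[OF that] by simp
      then show ?case using elim by (auto split: split_indicator_asm)
    qed
    then have "emeasure lborel {x<..y} = 0"
      by (subst (asm) AE_iff_measurable[of "{x<..y}"]) auto
    then show False using xy by simp
  qed
  then have "measure D {x<..y} > 0" by (simp add: D.emeasure_eq_measure zero_less_measure_iff)
  then show "K x < K y" using D.cdf_diff_eq[OF xy] K by simp
qed

text \<open>As k is only integrable, K need not be differentiable at every point. Instead, the image
  under K of the measure with density k on (b, \<infinity>) is identified with Lebesgue measure on
  [K b, R), where R is the integral of k, by comparing distribution functions; this is the
  probability integral transform.\<close>

lemma nn_integral_primitive_substitution: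
  fixes k :: "real \<Rightarrow> real" and b :: real
  assumes k: "integrable lborel k" "\<And>y. 0 \<le> k y" "\<And>y. b < y \<Longrightarrow> 0 < k y"
    and \<psi> [measurable]: "\<psi> \<in> borel_measurable borel"
  defines "K \<equiv> \<lambda>y. LINT u:{..y}|lborel. k u"
  shows "(\<integral>\<^sup>+y. indicator {b<..} y * ennreal (k y) * \<psi> (K y) \<partial>lborel) =
    (\<integral>\<^sup>+z. indicator {K b..<LINT u|lborel. k u} z * \<psi> z \<partial>lborel)"
proof -
  have km [measurable]: "k \<in> borel_measurable borel" using k(1) by measurable
  define D where "D = density lborel (\<lambda>u. ennreal (k u))"
  define R where "R = (LINT u|lborel. k u)"
  have sD [simp, measurable_cong]: "sets D = sets borel" by (simp add: D_def)
  interpret D: finite_borel_measure D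
    unfolding D_def by (rule primitive_cdf(1)[OF k(1,2)])
  have K: "K = cdf D" unfolding D_def K_def by (rule primitive_cdf(2)[OF k(1,2), symmetric])
  have cont: "isCont K y" for y unfolding K_def by (rule primitive_cdf(3)[OF k(1,2)])
  have R: "measure D (space D) = R" unfolding R_def D_def by (rule primitive_cdf(4)[OF k(1,2)])
  have strict: "K x < K y" if "b \<le> x" "x < y" for x y
    unfolding K_def using that k(3) by (intro primitive_cdf(5)[OF k(1,2)]) auto
  have lessR: "K x < R" if "b \<le> x" for x
    using strict[OF that, of "x + 1"] D.cdf_bounded[of "x + 1"] K R by simp
  define \<mu> where "\<mu> = distr (density D (indicator {b<..})) borel K"
  define \<nu> where "\<nu> = density lborel (indicator {K b..<R} :: real \<Rightarrow> ennreal)"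
  have Km [measurable]: "K \<in> borel_measurable borel"
    unfolding K by (rule borel_measurable_mono) (simp add: mono_def D.cdf_nondecreasing)
  have mu: "emeasure \<mu> A = emeasure D ({b<..} \<inter> (K -` A))" if [measurable]: "A \<in> sets borel" for A
    unfolding \<mu>_def using measurable_sets_borel[OF Km that]
    by (subst emeasure_distr; (subst emeasure_density)?)
       (auto simp: indicator_inter_arith[symmetric] D.borel_UNIV measurable_sets_borel Int_commute intro!: sets.Int)
  have nu: "emeasure \<nu> A = emeasure lborel ({K b..<R} \<inter> A)" if [measurable]: "A \<in> sets borel" for A
    unfolding \<nu>_def by (subst emeasure_density) (auto simp: indicator_inter_arith[symmetric])
  have "\<mu> = \<nu>"
  proof (rule cdf_unique')
    have "emeasure \<mu> UNIV \<noteq> \<infinity>" using mu[of UNIV] by simp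
    then show "finite_borel_measure \<mu>"
      by (intro finite_borel_measure.intro finite_measureI finite_borel_measure_axioms.intro) (simp_all add: \<mu>_def)
    have "emeasure \<nu> UNIV \<noteq> \<infinity>" using nu[of UNIV] lessR[of b] by simp
    then show "finite_borel_measure \<nu>"
      by (intro finite_borel_measure.intro finite_measureI finite_borel_measure_axioms.intro) (simp_all add: \<nu>_def)
    show "cdf \<mu> = cdf \<nu>"
    proof
      fix c
      have "emeasure D ({b<..} \<inter> K -` {..c}) = emeasure lborel ({K b..<R} \<inter> {..c})"
      proof -
        \<comment> \<open>By strict monotonicity the part of (b, \<infinity>) where K is at most c
          is empty, an interval (b, z] with K z = c, or everything. At c = K b it is empty, while
          the target interval has the single null point K b.\<close>
        consider "c < K b" | "c = K b" | "K b < c" "c < R" | "R \<le> c" by linarith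
        then show ?thesis
        proof cases
          case 1
          then have "{b<..} \<inter> K -` {..c} = {}" "{K b..<R} \<inter> {..c} = {}"
            by (auto dest!: strict[OF order_refl])
          then show ?thesis by simp
        next
          case 2
          then have "{b<..} \<inter> K -` {..c} = {}" "{K b..<R} \<inter> {..c} = {K b}"
            using lessR[of b] by (auto dest!: strict[OF order_refl])
          then show ?thesis by simp
        next
          case 3
          have "eventually (\<lambda>x. c < K x) at_top"
            using order_tendstoD(1)[OF D.cdf_lim_at_top, of c] 3 R K by simp
          then obtain y0 where "c < K y0" "b \<le> y0"
            by (metis (mono_tags, lifting) eventually_at_top_linorder linorder_le_cases order_refl)
          then obtain z where z: "b \<le> z" "K z = c"
            using IVT'[of K b c y0] 3 cont by (metis continuous_at_imp_continuous_on less_imp_le)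
          then have bz: "b < z" using 3 by (metis order_le_less order_less_irrefl)
          have "{b<..} \<inter> K -` {..c} = {b<..z}"
          proof -
            have "K x \<le> c \<longleftrightarrow> x \<le> z" if "b < x" for x
              using strict[of x z] strict[of z x] z bz that by (cases x z rule: linorder_cases) auto
            then show ?thesis by auto
          qed
          moreover have "{K b..<R} \<inter> {..c} = {K b..c}" using 3 by auto
          ultimately show ?thesis
            using D.emeasure_Ioc[of b z] bz z 3 K by simp
        next
          case 4
          have "{b<..} \<inter> K -` {..c} = {b<..}" "{K b..<R} \<inter> {..c} = {K b..<R}"
            using 4 less_le_trans[OF lessR 4] by (auto intro: less_imp_le)
          moreover have "measure D {b<..} = R - K b"
            using D.finite_measure_compl[of "{..b}"] R K by (simp add: cdf_def D.borel_UNIV Compl_eq_Diff_UNIV[symmetric])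
          ultimately show ?thesis using lessR[of b] by (simp add: D.emeasure_eq_measure)
        qed
      qed
      then show "cdf \<mu> c = cdf \<nu> c" by (simp add: cdf_def measure_def mu nu)
    qed
  qed
  then have "(\<integral>\<^sup>+z. \<psi> z \<partial>\<mu>) = (\<integral>\<^sup>+z. \<psi> z \<partial>\<nu>)" by simp
  moreover have "(\<integral>\<^sup>+z. \<psi> z \<partial>\<mu>) = (\<integral>\<^sup>+y. indicator {b<..} y * ennreal (k y) * \<psi> (K y) \<partial>lborel)"
    unfolding \<mu>_def D_def
    by (subst nn_integral_distr; (subst nn_integral_density)?; (subst nn_integral_density)?)
       (auto simp: mult_ac intro!: nn_integral_cong)
  moreover have "(\<integral>\<^sup>+z. \<psi> z \<partial>\<nu>) = (\<integral>\<^sup>+z. indicator {K b..<R} z * \<psi> z \<partial>lborel)"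
    unfolding \<nu>_def by (subst nn_integral_density) auto
  ultimately show ?thesis by (simp add: R_def)
qed

section \<open>Parking functions\<close>

lemma circ_Suc_mod:
  assumes "1 \<le> n"
  shows "int (circ n j) = (j - 1) mod int n + 1"
  using assms by (simp add: circ_def)

text \<open>Number of steps forward from space \<open>l\<close> to space \<open>p\<close>, where p =
  l counts as a full circle of n steps and not as 0.\<close>

abbreviation ahead :: "nat \<Rightarrow> nat \<Rightarrow> nat \<Rightarrow> nat" where
  "ahead n l p \<equiv> circ n (int p - int l)"

lemma circ_eq:
  assumes "1 \<le> p" "p \<le> n" "1 \<le> l" "l \<le> n"
  shows "ahead n l p = (if l < p then p - l else p + n - l)"
proof (cases "l < p")
  case True
  then have "(int p - int l - 1) mod int n = int p - int l - 1"
    using assms by (intro mod_pos_pos_trivial) auto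
  then have "int (ahead n l p) = int (p - l)"
    using circ_Suc_mod[of n "int p - int l"] assms True by simp
  then show ?thesis using True by simp
next
  case False
  have "(int p - int l - 1) mod int n = (int p - int l - 1 + int n) mod int n" by simp
  also have "\<dots> = int p - int l - 1 + int n"
    using assms False by (intro mod_pos_pos_trivial) auto
  finally have "int (ahead n l p) = int (p + n - l)"
    using circ_Suc_mod[of n "int p - int l"] assms False by simp
  then show ?thesis using False by simp
qed

lemma circ_int:
  assumes "1 \<le> j" "j \<le> 2 * n"
  shows "circ n (int j) = (if j \<le> n then j else j - n)"
proof (cases "j \<le> n")
  case True
  then have "(int j - 1) mod int n = int j - 1"
    using assms by (intro mod_pos_pos_trivial) auto
  then have "int (circ n (int j)) = int j"
    using circ_Suc_mod[of n "int j"] assms True by simp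
  then show ?thesis using True by simp
next
  case False
  have "(int j - 1) mod int n = (int j - 1 - int n) mod int n" by simp
  also have "\<dots> = int j - 1 - int n"
    using assms False by (intro mod_pos_pos_trivial) auto
  finally have "int (circ n (int j)) = int (j - n)"
    using circ_Suc_mod[of n "int j"] assms False by simp
  then show ?thesis using False by simp
qed

text \<open>A car does not drive past a space that stays empty.\<close>

lemma park_cases:
  assumes p: "p \<in> {1..n}" and free: "\<exists>s\<in>{1..n}. \<sigma> s = 0"
  obtains s where "s \<in> {1..n}" "\<sigma> s = 0" "park n \<sigma> p = \<sigma>(s := 1)"
    "\<And>l. l \<in> {1..n} \<Longrightarrow> \<sigma> l = 0 \<Longrightarrow> l \<noteq> s \<Longrightarrow>
      ahead n l p \<le> ahead n l s"
proof (cases "\<sigma> p = 0")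
  case True
  then show thesis using that[of p] p by (simp add: park_def)
next
  case False
  define P where "P j \<longleftrightarrow> j > p \<and> \<sigma> (circ n (int j)) = 0" for j
  \<comment> \<open>\<open>J l\<close> is the first integer after p in the residue class of l. The
    least admissible j is therefore at most \<open>J l\<close> for every empty l, and smaller unless
    l is the space that is taken.\<close>
  define J where "J l = (if p < l then l else l + n)" for l
  have J: "P (J l)" "circ n (int (J l)) = l" "J l \<le> p + n" if "l \<in> {1..n}" "\<sigma> l = 0" for l
  proof -
    have c: "circ n (int (J l)) = l"
      using that p by (subst circ_int) (auto simp: J_def)
    have "l \<noteq> p" using that False by auto
    then show "P (J l)" "circ n (int (J l)) = l" "J l \<le> p + n"
      using that p c by (auto simp: P_def J_def)
  qed
  define j where "j = (LEAST j. P j)"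
  obtain s0 where s0: "s0 \<in> {1..n}" "\<sigma> s0 = 0" using free by auto
  have Pj: "P j" unfolding j_def by (rule LeastI[of P, OF J(1)[OF s0]])
  have jl: "j \<le> J l" if "l \<in> {1..n}" "\<sigma> l = 0" for l
    unfolding j_def by (rule Least_le[of P, OF J(1)[OF that]])
  have jb: "p < j" "j \<le> p + n" using Pj jl[OF s0] J(3)[OF s0] by (auto simp: P_def)
  define s where "s = circ n (int j)"
  have s: "s = (if j \<le> n then j else j - n)"
    unfolding s_def using jb p by (intro circ_int) auto
  have sn: "s \<in> {1..n}" using s jb p by auto
  show thesis
  proof (rule that[OF sn])
    show "\<sigma> s = 0" using Pj by (simp add: P_def s_def)
    show "park n \<sigma> p = \<sigma>(s := 1)" using False by (simp add: park_def s_def j_def P_def)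
    fix l assume l: "l \<in> {1..n}" "\<sigma> l = 0" "l \<noteq> s"
    have "j \<noteq> J l" using J(2)[OF l(1,2)] l(3) s_def by auto
    then have jJ: "j < J l" using jl[OF l(1,2)] by simp
    have lp: "l \<noteq> p" using l False by auto
    have cp: "ahead n l p = (if l < p then p - l else p + n - l)"
      using p l by (intro circ_eq) auto
    have cs: "ahead n l s = (if l < s then s - l else s + n - l)"
      using sn l by (intro circ_eq) auto
    show "ahead n l p \<le> ahead n l s"
    proof (cases "p < l")
      case True
      then have "s = j" "s < l" using jJ s l by (auto simp: J_def)
      then show ?thesis unfolding cp cs using True jb l by auto
    next
      case False
      then show ?thesis unfolding cp cs using lp jJ s l jb p by (auto simp: J_def)
    qed
  qed
qed

text \<open>Seen from a space l that is still empty, a car never parks nearer than its preference,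
  since it would have had to pass l. Hence occupied spaces within distance k are at most as many as
  preferences within distance k. All empty l are covered at once because the one that stays empty is
  known only at the end.\<close>

lemma spaces_after_invariant:
  assumes \<pi>: "\<And>i. i \<in> {1..<n} \<Longrightarrow> \<pi> i \<in> {1..n}" and m: "m < n"
  shows "card {s\<in>{1..n}. spaces_after n \<pi> m s \<noteq> 0} = m \<and>
    (\<forall>l\<in>{1..n}. spaces_after n \<pi> m l = 0 \<longrightarrow> (\<forall>k.
      card {s\<in>{1..n}. spaces_after n \<pi> m s \<noteq> 0 \<and> ahead n l s \<le> k}
        \<le> card {i\<in>{1..m}. ahead n l (\<pi> i) \<le> k}))"
  using m
proof (induction m)
  case 0
  then show ?case by simp
next
  case (Suc m)
  define \<sigma> where "\<sigma> = spaces_after n \<pi> m"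
  define p where "p = \<pi> (Suc m)"
  have IH: "card {s\<in>{1..n}. \<sigma> s \<noteq> 0} = m"
    "\<And>l k. l \<in> {1..n} \<Longrightarrow> \<sigma> l = 0 \<Longrightarrow>
      card {s\<in>{1..n}. \<sigma> s \<noteq> 0 \<and> ahead n l s \<le> k} \<le> card {i\<in>{1..m}. ahead n l (\<pi> i) \<le> k}"
    using Suc by (auto simp: \<sigma>_def)
  have p: "p \<in> {1..n}" using \<pi>[of "Suc m"] Suc.prems by (simp add: p_def)
  have "\<exists>s\<in>{1..n}. \<sigma> s = 0"
  proof (rule ccontr)
    assume "\<not> ?thesis"
    then have "{s\<in>{1..n}. \<sigma> s \<noteq> 0} = {1..n}" by auto
    then show False using IH(1) Suc.prems by simp
  qed
  from park_cases[OF p this] obtain s where s: "s \<in> {1..n}" "\<sigma> s = 0" "park n \<sigma> p = \<sigma>(s := 1)"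
    "\<And>l. l \<in> {1..n} \<Longrightarrow> \<sigma> l = 0 \<Longrightarrow> l \<noteq> s \<Longrightarrow>
      ahead n l p \<le> ahead n l s" by blast
  have st: "spaces_after n \<pi> (Suc m) = \<sigma>(s := 1)" using s(3) by (simp add: \<sigma>_def p_def)
  have "{s'\<in>{1..n}. (\<sigma>(s := 1)) s' \<noteq> 0} = insert s {s'\<in>{1..n}. \<sigma> s' \<noteq> 0}" using s by auto
  then have 1: "card {s'\<in>{1..n}. (\<sigma>(s := 1)) s' \<noteq> 0} = Suc m" using IH(1) s by simp
  have 2: "card {s'\<in>{1..n}. (\<sigma>(s := 1)) s' \<noteq> 0 \<and> ahead n l s' \<le> k}
      \<le> card {i\<in>{1..Suc m}. ahead n l (\<pi> i) \<le> k}"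
    if l: "l \<in> {1..n}" "(\<sigma>(s := 1)) l = 0" for l k
  proof -
    have l': "\<sigma> l = 0" "l \<noteq> s" using l by (auto split: if_splits)
    note IHl = IH(2)[OF l(1) l'(1), of k]
    show ?thesis
    proof (cases "ahead n l s \<le> k")
      case True
      then have c: "ahead n l p \<le> k" using s(4)[OF l(1) l'] by simp
      have "{s'\<in>{1..n}. (\<sigma>(s := 1)) s' \<noteq> 0 \<and> ahead n l s' \<le> k}
          = insert s {s'\<in>{1..n}. \<sigma> s' \<noteq> 0 \<and> ahead n l s' \<le> k}"
        using s True by auto
      moreover have "{i\<in>{1..Suc m}. ahead n l (\<pi> i) \<le> k}
          = insert (Suc m) {i\<in>{1..m}. ahead n l (\<pi> i) \<le> k}"
        using c by (auto simp: p_def le_Suc_eq)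
      ultimately show ?thesis using IHl s(2) by simp
    next
      case False
      then have "{s'\<in>{1..n}. (\<sigma>(s := 1)) s' \<noteq> 0 \<and> ahead n l s' \<le> k}
          = {s'\<in>{1..n}. \<sigma> s' \<noteq> 0 \<and> ahead n l s' \<le> k}" by auto
      moreover have "card {i\<in>{1..m}. ahead n l (\<pi> i) \<le> k} \<le> card {i\<in>{1..Suc m}. ahead n l (\<pi> i) \<le> k}"
        by (rule card_mono) auto
      ultimately show ?thesis using IHl by simp
    qed
  qed
  show ?case unfolding st using 1 2 by blast
qed

text \<open>Parking functions for n - 1 cars on a line. The usual condition that the k-th smallest
  preference is at most k is put in counting form, which matches both the invariant above and order
  statistics.\<close>

definition parking_functions :: "nat \<Rightarrow> (nat \<Rightarrow> nat) set" where
  "parking_functions n = {q \<in> {1..<n} \<rightarrow>\<^sub>E {1..n}. \<forall>k\<in>{1..<n}. k \<le> card {i\<in>{1..<n}. q i \<le> k}}"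

lemma finite_parking_functions: "finite (parking_functions n)"
  unfolding parking_functions_def by (rule finite_subset[OF Collect_restrict finite_PiE]) auto

text \<open>All spaces other than the empty one are occupied, so for k < n the k spaces following it
  are full; the invariant turns these into at least k preferences within distance k.\<close>

lemma empty_space_shifted:
  assumes n: "1 \<le> n" and \<pi>: "\<And>i. i \<in> {1..<n} \<Longrightarrow> \<pi> i \<in> {1..n}"
  shows "empty_space n \<pi> \<in> {1..n}" "restrict (shifted n \<pi>) {1..<n} \<in> parking_functions n"
proof -
  define \<sigma> where "\<sigma> = spaces_after n \<pi> (n - 1)"
  define e where "e = empty_space n \<pi>"
  have inv: "card {s\<in>{1..n}. \<sigma> s \<noteq> 0} = n - 1"
    "\<And>l k. l \<in> {1..n} \<Longrightarrow> \<sigma> l = 0 \<Longrightarrow>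
      card {s\<in>{1..n}. \<sigma> s \<noteq> 0 \<and> ahead n l s \<le> k} \<le> card {i\<in>{1..n - 1}. ahead n l (\<pi> i) \<le> k}"
    using spaces_after_invariant[of n \<pi> "n - 1", OF \<pi>] n by (auto simp: \<sigma>_def)
  have "card ({1..n} - {s\<in>{1..n}. \<sigma> s \<noteq> 0}) = 1"
    using inv(1) n by (subst card_Diff_subset) auto
  then obtain l where l: "{1..n} - {s\<in>{1..n}. \<sigma> s \<noteq> 0} = {l}" by (auto simp: card_1_singleton_iff)
  then have l': "l \<in> {1..n}" "\<sigma> l = 0" "\<And>l'. l' \<in> {1..n} \<Longrightarrow> \<sigma> l' = 0 \<Longrightarrow> l' = l" by blast+
  have "e = l"
    unfolding e_def empty_space_def \<sigma>_def[symmetric] by (rule the_equality) (use l' in blast)+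
  then have e: "e \<in> {1..n}" "\<sigma> e = 0" "\<And>s. s \<in> {1..n} \<Longrightarrow> s \<noteq> e \<Longrightarrow> \<sigma> s \<noteq> 0"
    using l' by blast+
  show "empty_space n \<pi> \<in> {1..n}" using e(1) unfolding e_def .
  have sh: "shifted n \<pi> i = ahead n e (\<pi> i)" for i by (simp add: shifted_def e_def)
  have range: "shifted n \<pi> i \<in> {1..n}" if "i \<in> {1..<n}" for i
    unfolding sh using \<pi>[OF that] e by (subst circ_eq) auto
  have "k \<le> card {i\<in>{1..<n}. shifted n \<pi> i \<le> k}" if k: "k \<in> {1..<n}" for k
  proof -
    \<comment> \<open>\<open>f r\<close> is the space r steps after the empty space.\<close>
    define f where "f r = (if e + r \<le> n then e + r else e + r - n)" for r
    have "inj_on f {1..k}" using k e by (auto simp: inj_on_def f_def split: if_splits)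
    then have "k = card (f ` {1..k})" by (simp add: card_image)
    also have "\<dots> \<le> card {s\<in>{1..n}. \<sigma> s \<noteq> 0 \<and> ahead n e s \<le> k}"
    proof (rule card_mono)
      show "f ` {1..k} \<subseteq> {s\<in>{1..n}. \<sigma> s \<noteq> 0 \<and> ahead n e s \<le> k}"
      proof (rule image_subsetI)
        fix r assume r: "r \<in> {1..k}"
        have fr: "f r \<in> {1..n}" using r e(1) k by (auto simp: f_def)
        have "f r \<noteq> e" using r e(1) k by (auto simp: f_def)
        then have "\<sigma> (f r) \<noteq> 0" using e(3) fr by blast
        moreover have "ahead n e (f r) \<le> k"
          using fr e(1) r k by (subst circ_eq) (auto simp: f_def split: if_splits)
        ultimately show "f r \<in> {s\<in>{1..n}. \<sigma> s \<noteq> 0 \<and> ahead n e s \<le> k}"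
          using fr by blast
      qed
    qed simp
    also have "\<dots> \<le> card {i\<in>{1..n - 1}. ahead n e (\<pi> i) \<le> k}" by (rule inv(2)[OF e(1,2)])
    also have "{1..n - 1} = {1..<n}" using n by auto
    finally show ?thesis unfolding sh .
  qed
  moreover have "{i\<in>{1..<n}. restrict (shifted n \<pi>) {1..<n} i \<le> k} = {i\<in>{1..<n}. shifted n \<pi> i \<le> k}" for k by auto
  ultimately show "restrict (shifted n \<pi>) {1..<n} \<in> parking_functions n"
    using range by (auto simp: parking_functions_def)
qed

text \<open>The shifted preferences together with the empty space determine the preferences, since a
  known rotation can be undone. So at most n preference lists share one shifted list.\<close>

lemma sum_shifted_le:
  fixes f :: "(nat \<Rightarrow> nat) \<Rightarrow> ennreal"
  assumes n: "1 \<le> n"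
  shows "(\<Sum>\<pi>\<in>PiE_dflt {1..<n} 0 (\<lambda>_. {1..n}). f (restrict (shifted n \<pi>) {1..<n}))
    \<le> of_nat n * (\<Sum>q\<in>parking_functions n. f q)"
proof -
  let ?P = "PiE_dflt {1..<n} 0 (\<lambda>_. {1..n})"
  define F where "F \<pi> = (empty_space n \<pi>, restrict (shifted n \<pi>) {1..<n})" for \<pi>
  have P: "\<pi> i \<in> {1..n}" if "\<pi> \<in> ?P" "i \<in> {1..<n}" for \<pi> i
    using that by (auto simp: PiE_dflt_def)
  have im: "F ` ?P \<subseteq> {1..n} \<times> parking_functions n"
  proof (rule image_subsetI)
    fix \<pi> assume "\<pi> \<in> ?P"
    note P = P[OF this]
    show "F \<pi> \<in> {1..n} \<times> parking_functions n"
      unfolding F_def using empty_space_shifted(1)[OF n P] empty_space_shifted(2)[OF n P] by (rule SigmaI)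
  qed
  have inj: "inj_on F ?P"
  proof (rule inj_onI)
    fix \<pi> \<pi>' assume a: "\<pi> \<in> ?P" "\<pi>' \<in> ?P" "F \<pi> = F \<pi>'"
    define e where "e = empty_space n \<pi>"
    have e: "e \<in> {1..n}" unfolding e_def by (rule empty_space_shifted(1)[OF n P[OF a(1)]])
    show "\<pi> = \<pi>'"
    proof
      fix i
      show "\<pi> i = \<pi>' i"
      proof (cases "i \<in> {1..<n}")
        case True
        have "restrict (shifted n \<pi>) {1..<n} i = restrict (shifted n \<pi>') {1..<n} i" "empty_space n \<pi>' = e"
          using a(3) by (auto simp: F_def e_def)
        then have "ahead n e (\<pi> i) = ahead n e (\<pi>' i)"
          using True by (simp add: shifted_def e_def)
        then show ?thesis using P[OF a(1) True] P[OF a(2) True] e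
          by (subst (asm) (1 2) circ_eq) (auto split: if_splits)
      next
        case False
        then show ?thesis using a by (auto simp: PiE_dflt_def)
      qed
    qed
  qed
  have "(\<Sum>\<pi>\<in>?P. f (restrict (shifted n \<pi>) {1..<n})) = (\<Sum>r\<in>F ` ?P. f (snd r))"
    by (subst sum.reindex[OF inj]) (simp add: F_def)
  also have "\<dots> \<le> (\<Sum>r\<in>{1..n} \<times> parking_functions n. f (snd r))"
    by (rule sum_mono2[OF _ im]) (simp_all add: finite_parking_functions)
  also have "\<dots> = (\<Sum>l\<in>{1..n}. \<Sum>q\<in>parking_functions n. f q)"
    by (subst sum.cartesian_product) (simp add: split_def)
  finally show ?thesis by simp
qed

section \<open>The epochs as a triangular transform of the compensator\<close>

text \<open>Vectors carry the coordinates 1, ..., k - 1 only; writing \<open>a(0 := 0)\<close>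
  supplies the epoch of the initial event at index 0.\<close>

lemma measurable_upd0:
  assumes "j < k"
  shows "(\<lambda>a. (a(0 := 0)) j) \<in> borel_measurable (vec k)"
proof (cases "j = 0")
  case False
  then have "j \<in> {1..<k}" using assms by auto
  from measurable_component_singleton[OF this, of "\<lambda>_. borel"] False show ?thesis by simp
qed simp

definition prefix0 :: "nat \<Rightarrow> (nat \<Rightarrow> real) \<Rightarrow> nat \<Rightarrow> real" where
  "prefix0 n a = (\<lambda>i. if i \<in> {1..<n} then a i else 0)"

lemma measurable_prefix0 [measurable]:
  "prefix0 n \<in> vec n \<rightarrow>\<^sub>M seqs"
proof (rule measurable_PiM_single')
  fix i
  show "(\<lambda>a. prefix0 n a i) \<in> vec n \<rightarrow>\<^sub>M borel"
  proof (cases "i \<in> {1..<n}")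
    case True
    then show ?thesis by (simp add: prefix0_def)
  next
    case False
    then have "(\<lambda>a. prefix0 n a i) = (\<lambda>_. 0)" by (auto simp: prefix0_def)
    then show ?thesis by simp
  qed
qed (simp add: space_PiM)

definition epoch_solution :: "(real \<Rightarrow> real) \<Rightarrow> nat \<Rightarrow> (nat \<Rightarrow> real) \<Rightarrow> nat \<Rightarrow> real" where
  "epoch_solution g n L = (THE A. solves_epochs g n L A)"

section \<open>The time change between epochs and compensator values\<close>

locale subcritical_kernel =
  fixes g :: "real \<Rightarrow> real"
  assumes g_pos: "\<And>x. x \<ge> 0 \<Longrightarrow> g x > 0"
    and g_int: "set_integrable lborel {0..} g"
    and subcritical: "kernel_mass g < 1"
begin

text \<open>On the negative half-line \<open>g\<close> is arbitrary and need not be measurable;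
  cutting it off gives an integrable function on the whole line that vanishes for pairs of epochs in
  the wrong order.\<close>

definition h :: "real \<Rightarrow> real" where
  "h u = indicator {0<..} u * g u"

abbreviation \<rho> :: real where
  "\<rho> \<equiv> kernel_mass g"

abbreviation G :: "real \<Rightarrow> real" where
  "G \<equiv> kernel_primitive g"

lemma h_nonneg: "0 \<le> h u"
  using g_pos[of u] by (auto simp: h_def split: split_indicator)

lemma h_pos: "0 < u \<Longrightarrow> 0 < h u"
  using g_pos[of u] by (simp add: h_def)

lemma h_integrable: "integrable lborel h"
proof -
  have "set_integrable lborel {0<..} g"
    by (rule set_integrable_subset[OF g_int]) auto
  then show ?thesis by (simp add: set_integrable_def h_def[abs_def])
qed

lemma h_measurable [measurable]: "h \<in> borel_measurable borel"
  using h_integrable by measurable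

lemma set_integral_h:
  assumes "A \<in> sets borel"
  shows "(LINT u:A \<inter> {0<..}|lborel. g u) = (LINT u:A|lborel. h u)"
  unfolding set_lebesgue_integral_def h_def
  by (intro Bochner_Integration.integral_cong) (auto split: split_indicator)

lemma set_integral_atLeast_h:
  assumes "A \<in> sets borel"
  shows "(LINT u:A \<inter> {0..}|lborel. g u) = (LINT u:A|lborel. h u)"
proof -
  have [measurable]: "A \<in> sets borel" by fact
  have m: "(\<lambda>u. indicator (A \<inter> {0..}) u *\<^sub>R g u) \<in> borel_measurable lborel"
    using set_integrable_subset[OF g_int, of "A \<inter> {0..}"] unfolding set_integrable_def by auto
  have m': "(\<lambda>u. indicator A u *\<^sub>R h u) \<in> borel_measurable lborel" by simp
  have "AE u in lborel. u \<noteq> (0 :: real)" by (rule AE_lborel_singleton)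
  then have "AE u in lborel. indicator (A \<inter> {0..}) u *\<^sub>R g u = indicator A u *\<^sub>R h u"
    by eventually_elim (auto simp: h_def split: split_indicator)
  then show ?thesis
    unfolding set_lebesgue_integral_def by (intro integral_cong_AE m m')
qed

lemma G_eq: "G x = (LINT u:{..x}|lborel. h u)"
proof -
  have "{0..x} = {..x} \<inter> {0..}" by auto
  then show ?thesis unfolding kernel_primitive_def using set_integral_atLeast_h[of "{..x}"] by simp
qed

lemma rho_eq: "\<rho> = (LINT u|lborel. h u)"
  using set_integral_atLeast_h[of UNIV] by (simp add: kernel_mass_def set_lebesgue_integral_def)

lemma isCont_G: "isCont G x"
  unfolding G_eq[abs_def] by (rule primitive_cdf(3)[OF h_integrable h_nonneg])

lemma G_strict_mono: "0 \<le> x \<Longrightarrow> x < y \<Longrightarrow> G x < G y"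
  unfolding G_eq by (rule primitive_cdf(5)[OF h_integrable h_nonneg]) (auto intro: h_pos)

lemma G_cdf: "G = cdf (density lborel (\<lambda>u. ennreal (h u)))"
  unfolding G_eq[abs_def] by (rule primitive_cdf(2)[OF h_integrable h_nonneg, symmetric])

lemma G_mono: "x \<le> y \<Longrightarrow> G x \<le> G y"
  unfolding G_cdf
  by (rule finite_borel_measure.cdf_nondecreasing[OF primitive_cdf(1)[OF h_integrable h_nonneg]])

lemma G_tendsto: "(G \<longlongrightarrow> \<rho>) at_top"
  using finite_borel_measure.cdf_lim_at_top[OF primitive_cdf(1)[OF h_integrable h_nonneg]]
  unfolding G_cdf rho_eq primitive_cdf(4)[OF h_integrable h_nonneg] .

lemma G_0 [simp]: "G 0 = 0"
proof -
  have "AE u in lborel. u \<noteq> (0 :: real)" by (rule AE_lborel_singleton)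
  then have "AE u in lborel. indicator {..0} u *\<^sub>R h u = 0"
    by eventually_elim (auto simp: h_def split: split_indicator)
  then show ?thesis unfolding G_eq set_lebesgue_integral_def by (rule integral_eq_zero_AE)
qed

lemma G_less_rho: "G x < \<rho>"
proof -
  have "G x \<le> G (max x 0)" by (rule G_mono) simp
  also have "\<dots> < G (max x 0 + 1)" by (rule G_strict_mono) auto
  also have "\<dots> \<le> \<rho>"
    using G_mono by (intro tendsto_lowerbound[OF G_tendsto]) (auto simp: eventually_at_top_linorder)
  finally show ?thesis .
qed

lemma rho_pos: "0 < \<rho>"
  using G_less_rho[of 0] by simp

lemma G_measurable [measurable]: "G \<in> borel_measurable borel"
  by (rule borel_measurable_mono) (simp add: mono_def G_mono)

text \<open>The conditional intensity integrated up to time y, when the events so far are a 0, ...,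
  a (i - 1). The numbers \<Lambda>_i are its values at the epochs, as in the random time change of a
  point process to unit rate.\<close>

definition compensator :: "(nat \<Rightarrow> real) \<Rightarrow> nat \<Rightarrow> real \<Rightarrow> real" where
  "compensator a i y = (\<Sum>j=0..<i. G (y - a j))"

lemma compensator_mono: "x \<le> y \<Longrightarrow> compensator a i x \<le> compensator a i y"
  unfolding compensator_def by (intro sum_mono G_mono) auto

lemma compensator_strict_mono:
  assumes "1 \<le> i" "a (i - 1) \<le> x" "x < y"
  shows "compensator a i x < compensator a i y"
  unfolding compensator_def
proof (rule sum_strict_mono_ex1)
  show "\<forall>j\<in>{0..<i}. G (x - a j) \<le> G (y - a j)" using assms by (auto intro: G_mono)
  show "\<exists>j\<in>{0..<i}. G (x - a j) < G (y - a j)"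
    using assms by (intro bexI[of _ "i - 1"] G_strict_mono) auto
qed simp

lemma compensator_less:
  assumes "1 \<le> i"
  shows "compensator a i y < real i * \<rho>"
proof -
  have "compensator a i y < (\<Sum>j=0..<i. \<rho>)"
    unfolding compensator_def using assms by (intro sum_strict_mono G_less_rho) auto
  then show ?thesis by simp
qed

lemma isCont_compensator: "isCont (compensator a i) y"
  unfolding compensator_def[abs_def]
  by (intro continuous_intros isCont_o2[OF _ isCont_G]) 

lemma compensator_tendsto: "(compensator a i \<longlongrightarrow> real i * \<rho>) at_top"
proof -
  have "((\<lambda>y. \<Sum>j=0..<i. G (y - a j)) \<longlongrightarrow> (\<Sum>j=0..<i. \<rho>)) at_top"
  proof (rule tendsto_sum)
    fix j
    have "filterlim (\<lambda>y. y - a j) at_top at_top"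
      using filterlim_tendsto_add_at_top[OF tendsto_const[of "- a j"] filterlim_ident] by (simp add: algebra_simps)
    from filterlim_compose[OF G_tendsto this]
    show "((\<lambda>y. G (y - a j)) \<longlongrightarrow> \<rho>) at_top" .
  qed
  then show ?thesis by (simp add: compensator_def[abs_def])
qed

text \<open>An event contributes G 0 = 0 at its own epoch. Hence \<Lambda>_i is also the starting
  level of the equation for epoch i + 1.\<close>

lemma compensator_Suc_self: "compensator a (Suc i) (a i) = compensator a i (a i)"
  by (simp add: compensator_def)

lemma compensator_cong: "(\<And>j. j < i \<Longrightarrow> a j = b j) \<Longrightarrow> compensator a i y = compensator b i y"
  by (simp add: compensator_def)

lemma solves_epochs_iff:
  "solves_epochs g n L A \<longleftrightarrow> A 0 = 0 \<and> strict_mono_on {0..<n} A \<and>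
     (\<forall>i\<in>{1..<n}. L i = compensator A i (A i)) \<and> (\<forall>i\<ge>n. A i = 0)"
  by (simp add: solves_epochs_def compensator_def)

lemma solves_epochs_unique:
  assumes A: "solves_epochs g n L A" and B: "solves_epochs g n L B"
  shows "A = B"
proof
  fix i
  show "A i = B i"
  proof (induction i rule: less_induct)
    case (less i)
    consider "i = 0" | "i \<in> {1..<n}" | "i \<ge> n" by (metis One_nat_def Suc_le_eq atLeastLessThan_iff not_gr_zero not_le)
    then show ?case
    proof cases
      case 2
      have "A (i - 1) < A i" "B (i - 1) < B i"
        using A B 2 by (auto simp: solves_epochs_def strict_mono_on_def)
      moreover have "A (i - 1) = B (i - 1)" using less 2 by simp
      moreover have "compensator A i (A i) = compensator A i (B i)"
        using A B 2 compensator_cong[of i A B "B i"] less by (simp add: solves_epochs_iff)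
      ultimately show ?thesis
        using compensator_strict_mono[of i A "A i" "B i"] compensator_strict_mono[of i A "B i" "A i"] 2
        by (cases "A i" "B i" rule: linorder_cases) auto
    qed (use A B in \<open>auto simp: solves_epochs_def\<close>)
  qed
qed

lemma epoch_solution_eq:
  assumes "solves_epochs g n L A"
  shows "epoch_solution g n L = A"
  unfolding epoch_solution_def using assms solves_epochs_unique by (intro the_equality) auto

lemma epoch_solution_cong:
  assumes "\<And>i. i \<in> {1..<n} \<Longrightarrow> L i = L' i"
  shows "epoch_solution g n L = epoch_solution g n L'"
proof -
  have "solves_epochs g n L = solves_epochs g n L'"
    using assms by (auto simp: fun_eq_iff solves_epochs_def)
  then show ?thesis by (simp add: epoch_solution_def)
qed

text \<open>The exact range of the map from epochs to \<Lambda>: the i-th compensator maps the times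
  after A_(i-1) onto the open interval from \<Lambda>_(i-1) to i \<rho>.\<close>

definition admissible :: "nat \<Rightarrow> (nat \<Rightarrow> real) \<Rightarrow> bool" where
  "admissible n L \<longleftrightarrow> (\<forall>i\<in>{1..<n}. (L(0 := 0)) (i - 1) < L i \<and> L i < real i * \<rho>)"

lemma solves_epochs_admissible:
  assumes A: "solves_epochs g n L A"
  shows "admissible n L"
  unfolding admissible_def
proof
  fix i assume i: "i \<in> {1..<n}"
  have L: "(L(0 := 0)) j = compensator A j (A j)" if "j < n" for j
    using A that by (cases j) (auto simp: solves_epochs_iff compensator_def)
  have "(L(0 := 0)) (i - 1) = compensator A i (A (i - 1))"
  proof -
    obtain d where d: "i = Suc d" "d < n" using i by (cases i) auto
    show ?thesis unfolding d diff_Suc_1 using L[OF d(2)] compensator_Suc_self[of A d] by (simp only:)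
  qed
  also have "\<dots> < compensator A i (A i)"
    using A i by (intro compensator_strict_mono) (auto simp: solves_epochs_def strict_mono_on_def)
  finally show "(L(0 := 0)) (i - 1) < L i \<and> L i < real i * \<rho>"
    using L[of i] i compensator_less[of i A "A i"] by simp
qed

text \<open>The i-th equation involves earlier epochs only, so the epochs are found one at a time by
  the intermediate value theorem, between the level \<Lambda>_(i-1) at A_(i-1) and the limit i
  \<rho> at infinity.\<close>

lemma solves_epochs_exists:
  assumes "admissible n L"
  shows "\<exists>A. solves_epochs g n L A"
  using assms
proof (induction n)
  case 0
  then show ?case by (intro exI[of _ "\<lambda>_. 0"]) (simp add: solves_epochs_def strict_mono_on_def)
next
  case (Suc n)
  then obtain A where A: "solves_epochs g n L A" by (auto simp: admissible_def)
  show ?case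
  proof (cases "n = 0")
    case True
    then show ?thesis by (intro exI[of _ "\<lambda>_. 0"]) (auto simp: solves_epochs_def intro!: strict_mono_onI)
  next
    case False
    have "compensator A n (A (n - 1)) = (L(0 := 0)) (n - 1)"
    proof -
      obtain d where d: "n = Suc d" using False by (cases n) auto
      have "compensator A d (A d) = (L(0 := 0)) d"
        using A d by (cases d) (auto simp: solves_epochs_iff compensator_def)
      then show ?thesis unfolding d diff_Suc_1 using compensator_Suc_self[of A d] by (simp only:)
    qed
    moreover have adm: "(L(0 := 0)) (n - 1) < L n" "L n < real n * \<rho>"
      using Suc.prems False unfolding admissible_def by auto
    ultimately have lo: "compensator A n (A (n - 1)) < L n" by simp
    have "\<forall>\<^sub>F y in at_top. L n < compensator A n y"
      using order_tendstoD(1)[OF compensator_tendsto adm(2)] .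
    then obtain y0 where y0: "A (n - 1) \<le> y0" "L n < compensator A n y0"
      by (metis (mono_tags, lifting) eventually_at_top_linorder linorder_le_cases order_refl)
    obtain y where y: "A (n - 1) \<le> y" "compensator A n y = L n"
      using IVT'[of "compensator A n" "A (n - 1)" "L n" y0] lo y0 isCont_compensator
      by (metis continuous_at_imp_continuous_on less_imp_le)
    then have Ay: "A (n - 1) < y" using lo by (metis order_le_less order_less_irrefl)
    have "solves_epochs g (Suc n) L (A(n := y))"
      unfolding solves_epochs_iff
    proof (intro conjI)
      show "(A(n := y)) 0 = 0" using A False by (simp add: solves_epochs_def)
      show "strict_mono_on {0..<Suc n} (A(n := y))"
      proof (rule strict_mono_onI)
        fix r s assume rs: "r \<in> {0..<Suc n}" "s \<in> {0..<Suc n}" "r < s"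
        show "(A(n := y)) r < (A(n := y)) s"
        proof (cases "s = n")
          case True
          have "A r \<le> A (n - 1)"
            using A rs True by (intro strict_mono_on_leD[of "{0..<n}" A]) (auto simp: solves_epochs_def)
          then show ?thesis using Ay rs True by simp
        next
          case False
          then show ?thesis using A rs by (auto simp: solves_epochs_def strict_mono_on_def)
        qed
      qed
      show "\<forall>i\<in>{1..<Suc n}. L i = compensator (A(n := y)) i ((A(n := y)) i)"
      proof
        fix i assume i: "i \<in> {1..<Suc n}"
        have "compensator (A(n := y)) i z = compensator A i z" for z
          using i by (intro compensator_cong) auto
        then show "L i = compensator (A(n := y)) i ((A(n := y)) i)"
          using A i y by (auto simp: solves_epochs_iff)
      qed
      show "\<forall>i\<ge>Suc n. (A(n := y)) i = 0" using A by (simp add: solves_epochs_def)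
    qed
    then show ?thesis by blast
  qed
qed

text \<open>The inverse has no formula, but monotonicity describes its sublevel sets: A_i \<le> b
  holds iff A_(i-1) < b and \<Lambda>_i is at most the i-th compensator at b, an expression in
  earlier epochs.\<close>

lemma measurable_epoch_solution [measurable]:
  "epoch_solution g n \<in> vec n \<rightarrow>\<^sub>M seqs"
proof -
  let ?P = "vec n"
  \<comment> \<open>Without a solution, the defining predicate is constantly false, so the
    description operator returns one and the same value for all such L.\<close>
  define c :: "nat \<Rightarrow> real" where "c = (THE A. False)"
  have sol: "solves_epochs g n L (epoch_solution g n L)" if "admissible n L" for L
    using solves_epochs_exists[OF that] epoch_solution_eq by metis
  have nosol: "epoch_solution g n L = c" if "\<not> admissible n L" for L
    using that solves_epochs_admissible unfolding epoch_solution_def c_def by metis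
  have pred_adm [measurable]: "Measurable.pred ?P (admissible n)"
    unfolding admissible_def
  proof (intro pred_intros_finite pred_intros_logic)
    fix i assume i: "i \<in> {1..<n}"
    have [measurable]: "(\<lambda>L. L i) \<in> borel_measurable ?P"
      by (rule measurable_component_singleton) (fact i)
    have [measurable]: "(\<lambda>L. (L(0 := 0)) (i - 1)) \<in> borel_measurable ?P"
      by (rule measurable_upd0) (use i in auto)
    show "Measurable.pred ?P (\<lambda>L. (L(0 := 0)) (i - 1) < L i)" "Measurable.pred ?P (\<lambda>L. L i < real i * \<rho>)"
      by measurable
  qed simp
  have "(\<lambda>L. epoch_solution g n L i) \<in> borel_measurable ?P" for i
  proof (induction i rule: less_induct)
    case (less i)
    show ?case
    proof (cases "i \<in> {1..<n}")
      case False
      then have "(\<lambda>L. epoch_solution g n L i) = (\<lambda>L. if admissible n L then 0 else c i)"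
        using sol nosol by (auto simp: fun_eq_iff solves_epochs_def not_le)
      moreover have "(\<lambda>L. if admissible n L then 0 else c i) \<in> borel_measurable ?P" by measurable
      ultimately show ?thesis by (simp only:)
    next
      case True
      have comp_meas: "(\<lambda>L. compensator (epoch_solution g n L) i b) \<in> borel_measurable ?P" for b
        unfolding compensator_def using less by (intro borel_measurable_sum) simp
      have "{L \<in> space ?P. epoch_solution g n L i \<le> b} \<in> sets ?P" for b
      proof -
        have "epoch_solution g n L i \<le> b \<longleftrightarrow>
            (if admissible n L then epoch_solution g n L (i - 1) < b \<and> L i \<le> compensator (epoch_solution g n L) i b else c i \<le> b)" for L
        proof (cases "admissible n L")
          case adm: True
          define A where "A = epoch_solution g n L"
          have A: "A (i - 1) < A i" "L i = compensator A i (A i)"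
            using sol[OF adm] True by (auto simp: A_def solves_epochs_iff strict_mono_on_def)
          have "A i \<le> b \<longleftrightarrow> A (i - 1) < b \<and> L i \<le> compensator A i b"
          proof
            assume "A i \<le> b"
            then show "A (i - 1) < b \<and> L i \<le> compensator A i b" using A compensator_mono by fastforce
          next
            assume "A (i - 1) < b \<and> L i \<le> compensator A i b"
            then show "A i \<le> b"
              using A compensator_strict_mono[of i A b "A i"] True by (auto simp: not_le[symmetric])
          qed
          then show ?thesis using adm by (simp add: A_def)
        qed (simp add: nosol)
        moreover have "{L \<in> space ?P. if admissible n L then epoch_solution g n L (i - 1) < b \<and>
            L i \<le> compensator (epoch_solution g n L) i b else c i \<le> b} \<in> sets ?P"
        proof -
          define V where "V = {L \<in> space ?P. admissible n L}"
          define S where "S = {L \<in> space ?P. epoch_solution g n L (i - 1) < b}"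
          define S' where "S' = {L \<in> space ?P. L i \<le> compensator (epoch_solution g n L) i b}"
          have "V \<in> sets ?P" unfolding V_def by (rule pred_adm[unfolded pred_def])
          moreover have "S \<in> sets ?P" unfolding S_def
            by (rule borel_measurable_less[OF less.IH]) (use True in auto)
          moreover have "S' \<in> sets ?P" unfolding S'_def
            by (rule borel_measurable_le[OF measurable_component_singleton[OF True] comp_meas])
          moreover have "{L \<in> space ?P. if admissible n L then epoch_solution g n L (i - 1) < b \<and>
              L i \<le> compensator (epoch_solution g n L) i b else c i \<le> b}
            = (V \<inter> (S \<inter> S')) \<union> ((if c i \<le> b then space ?P else {}) - V)"
            by (auto simp: V_def S_def S'_def)
          moreover have "(if c i \<le> b then space ?P else {}) \<in> sets ?P" by auto
          ultimately show ?thesis by (simp only: sets.Int sets.Un sets.Diff)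
        qed
        ultimately show ?thesis by (simp only:)
      qed
      then show ?thesis unfolding borel_measurable_iff_le by simp
    qed
  qed
  then show ?thesis by (intro measurable_PiM_single') (auto simp: space_PiM)
qed

abbreviation tree_density :: "nat \<Rightarrow> (nat \<Rightarrow> nat) \<Rightarrow> (nat \<Rightarrow> real) \<Rightarrow> ennreal" where
  "tree_density n p a \<equiv> (\<Prod>i\<in>{1..<n}. ennreal (h (a i - (a(0 := 0)) (p i))))"

definition epoch_density :: "nat \<Rightarrow> (nat \<Rightarrow> real) \<Rightarrow> ennreal" where
  "epoch_density n a = (\<Prod>i\<in>{1..<n}. indicator {(a(0 := 0)) (i - 1)<..} (a i) *
    (\<Sum>j=0..<i. ennreal (h (a i - (a(0 := 0)) j))))"

text \<open>Triangular substitution along \<open>compensator\<close>. In the i-th variable it is a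
  primitive of the sum of the h (a_i - a_j), and it carries the times after a_(i-1) to the interval
  from \<Lambda>_(i-1) to i \<rho>, up to an end point of measure 0.\<close>

lemma nn_integral_compensator:
  assumes F: "F \<in> borel_measurable seqs"
  shows "(\<integral>\<^sup>+L. (\<Prod>i\<in>{1..<n}. indicator {(L(0 := 0)) (i - 1)..<real i * \<rho>} (L i)) *
        F (epoch_solution g n L) \<partial>lvec n) =
    (\<integral>\<^sup>+a. epoch_density n a * F (prefix0 n a) \<partial>lvec n)"
proof -
  define w where "w i a y = indicator {(a(0 := 0)) (i - 1)<..} y * (\<Sum>j=0..<i. ennreal (h (y - (a(0 := 0)) j)))"
    for i :: nat and a :: "nat \<Rightarrow> real" and y :: real
  define t where "t i a = compensator (a(0 := 0)) i" for i :: nat and a :: "nat \<Rightarrow> real"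
  define v where "v i L z = (indicator {(L(0 := 0)) (i - 1)..<real i * \<rho>} z :: ennreal)"
    for i :: nat and L :: "nat \<Rightarrow> real" and z :: real
  have upd_cong: "(a(0 := 0)) j = (b(0 := 0)) j" if "\<And>j. j \<in> {1..<i} \<Longrightarrow> a j = b j" "j < i \<or> j = 0"
    for a b :: "nat \<Rightarrow> real" and i j
    using that by (cases "j = 0") auto
  have upd_meas: "(\<lambda>p. ((fst p)(0 := 0)) j) \<in> borel_measurable (vec k \<Otimes>\<^sub>M (borel :: real measure))"
    if "j < k" for j k :: nat
    by (rule measurable_compose[OF measurable_fst measurable_upd0[OF that]])
  have "(\<integral>\<^sup>+a. (\<Prod>j\<in>{1..<n}. w j a (a j)) * F (epoch_solution g n (\<lambda>j\<in>{1..<n}. t j a (a j))) \<partial>lvec n) =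
    (\<integral>\<^sup>+L. (\<Prod>j\<in>{1..<n}. v j L (L j)) * F (epoch_solution g n L) \<partial>lvec n)"
  proof (rule nn_integral_triangular)
    show "sigma_finite_measure (lborel :: real measure)" by standard
    fix i :: nat and a b :: "nat \<Rightarrow> real" and y assume ab: "\<And>j. j \<in> {1..<i} \<Longrightarrow> a j = b j"
    have eq: "(a(0 := 0)) j = (b(0 := 0)) j" if "j < i \<or> j = 0" for j using upd_cong[OF ab that] .
    have eq1: "(a(0 := 0)) (i - 1) = (b(0 := 0)) (i - 1)" by (rule eq) auto
    show "w i a y = w i b y" unfolding w_def eq1 using eq by (intro arg_cong2[where f = "(*)"] sum.cong) auto
    show "t i a y = t i b y" unfolding t_def using eq by (intro compensator_cong) auto
    show "v i a y = v i b y" unfolding v_def eq1 ..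
  next
    fix i k :: nat assume ik: "1 \<le> i" "i \<le> k"
    have l: "i - 1 < k" using ik by simp
    have jk: "j < k" if "j \<in> {0..<i}" for j using that ik by simp
    have "case_prod (w i) = (\<lambda>p. (if ((fst p)(0 := 0)) (i - 1) < snd p then 1 else 0) *
        (\<Sum>j=0..<i. ennreal (h (snd p - ((fst p)(0 := 0)) j))))"
      by (rule ext) (simp add: w_def indicator_def split_def)
    also have "\<dots> \<in> borel_measurable (vec k \<Otimes>\<^sub>M borel)"
    proof (intro borel_measurable_times_ennreal borel_measurable_sum)
      have "(\<lambda>p. if f p < snd p then 1 else 0 :: ennreal) \<in> borel_measurable (vec k \<Otimes>\<^sub>M borel)"
        if [measurable]: "f \<in> borel_measurable (vec k \<Otimes>\<^sub>M borel)" for f :: "(nat \<Rightarrow> real) \<times> real \<Rightarrow> real"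
        by measurable
      from this[OF upd_meas[OF l]]
      show "(\<lambda>p :: (nat \<Rightarrow> real) \<times> real. if ((fst p)(0 := 0)) (i - 1) < snd p then 1 else 0 :: ennreal)
          \<in> borel_measurable (vec k \<Otimes>\<^sub>M borel)" .
      fix j assume "j \<in> {0..<i}"
      then show "(\<lambda>p. ennreal (h (snd p - ((fst p)(0 := 0)) j))) \<in> borel_measurable (vec k \<Otimes>\<^sub>M borel)"
        by (intro measurable_compose[OF _ measurable_ennreal] measurable_compose[OF _ h_measurable]
            borel_measurable_diff measurable_snd upd_meas jk)
    qed
    finally show "case_prod (w i) \<in> borel_measurable (vec k \<Otimes>\<^sub>M borel)" .
    have "case_prod (t i) = (\<lambda>p. \<Sum>j=0..<i. G (snd p - ((fst p)(0 := 0)) j))"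
      by (rule ext) (simp add: t_def compensator_def split_def)
    also have "\<dots> \<in> borel_measurable (vec k \<Otimes>\<^sub>M borel)"
    proof (rule borel_measurable_sum)
      fix j assume "j \<in> {0..<i}"
      then show "(\<lambda>p. G (snd p - ((fst p)(0 := 0)) j)) \<in> borel_measurable (vec k \<Otimes>\<^sub>M borel)"
        by (intro measurable_compose[OF _ G_measurable] borel_measurable_diff measurable_snd upd_meas jk)
    qed
    finally show "case_prod (t i) \<in> borel_measurable (vec k \<Otimes>\<^sub>M borel)" .
    have "case_prod (v i) = (\<lambda>p. if ((fst p)(0 := 0)) (i - 1) \<le> snd p \<and> snd p < real i * \<rho> then 1 else 0)"
      by (rule ext) (simp add: v_def indicator_def split_def)
    also have "\<dots> \<in> borel_measurable (vec k \<Otimes>\<^sub>M borel)"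
    proof -
      have "(\<lambda>p. if f p \<le> snd p \<and> snd p < real i * \<rho> then 1 else 0 :: ennreal) \<in> borel_measurable (vec k \<Otimes>\<^sub>M borel)"
        if [measurable]: "f \<in> borel_measurable (vec k \<Otimes>\<^sub>M borel)" for f :: "(nat \<Rightarrow> real) \<times> real \<Rightarrow> real"
        by measurable
      from this[OF upd_meas[OF l]] show ?thesis .
    qed
    finally show "case_prod (v i) \<in> borel_measurable (vec k \<Otimes>\<^sub>M borel)" .
  next
    fix i :: nat and a :: "nat \<Rightarrow> real" and \<psi> :: "real \<Rightarrow> ennreal"
    assume i: "1 \<le> i" and \<psi>: "\<psi> \<in> borel_measurable borel"
    define b where "b = a(0 := 0)"
    define k where "k y = (\<Sum>j=0..<i. h (y - b j))" for y
    have shift_int: "integrable lborel (\<lambda>y. h (y - c))" for c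
      using lborel_integrable_real_affine[OF h_integrable, of 1 "- c"] by (simp add: algebra_simps)
    have "integrable lborel k" unfolding k_def[abs_def] by (intro Bochner_Integration.integrable_sum shift_int)
    moreover have "0 \<le> k y" for y unfolding k_def by (intro sum_nonneg h_nonneg)
    moreover have "0 < k y" if "b (i - 1) < y" for y
      unfolding k_def using that i h_nonneg h_pos by (intro sum_pos2[of _ "i - 1"]) auto
    moreover have "(LINT u:{..y}|lborel. k u) = compensator b i y" for y
    proof -
      have "(LINT u:{..y}|lborel. h (u - c)) = G (y - c)" for c
      proof -
        have "(LINT u:{..y - c}|lborel. h u) = (LINT u:{..y}|lborel. h (u - c))"
          unfolding set_lebesgue_integral_def
          by (subst lborel_integral_real_affine[of 1 _ "- c"])
             (auto intro!: Bochner_Integration.integral_cong split: split_indicator)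
        then show ?thesis by (simp add: G_eq)
      qed
      moreover have "(LINT u:{..y}|lborel. k u) = (\<Sum>j=0..<i. LINT u:{..y}|lborel. h (u - b j))"
        unfolding k_def set_lebesgue_integral_def scaleR_sum_right
        by (intro Bochner_Integration.integral_sum integrable_mult_indicator shift_int) auto
      ultimately show ?thesis by (simp add: compensator_def)
    qed
    moreover have "(LINT u|lborel. k u) = real i * \<rho>"
    proof -
      have "(LINT u|lborel. h (u - c)) = \<rho>" for c
        using lborel_integral_real_affine[of 1 h "- c"] by (simp add: rho_eq algebra_simps)
      then show ?thesis unfolding k_def using shift_int by (subst Bochner_Integration.integral_sum) auto
    qed
    ultimately have "(\<integral>\<^sup>+y. indicator {b (i - 1)<..} y * ennreal (k y) * \<psi> (compensator b i y) \<partial>lborel) =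
      (\<integral>\<^sup>+z. indicator {compensator b i (b (i - 1))..<real i * \<rho>} z * \<psi> z \<partial>lborel)"
      using nn_integral_primitive_substitution[of k "b (i - 1)" \<psi>] \<psi> by simp
    moreover have "w i a y = indicator {b (i - 1)<..} y * ennreal (k y)" for y
      unfolding w_def k_def b_def by (simp add: sum_ennreal h_nonneg)
    \<comment> \<open>The substitution produces as lower limit the i-th compensator at epoch i - 1;
      by \<open>compensator_Suc_self\<close> this is the previous coordinate of \<Lambda>, and it is
      0 for i = 1.\<close>
    moreover have "((\<lambda>j. t j a (a j))(0 := 0)) (i - 1) = compensator b i (b (i - 1))"
    proof -
      obtain d where d: "i = Suc d" using i by (cases i) auto
      have "((\<lambda>j. t j a (a j))(0 := 0)) d = compensator b d (b d)"
        by (cases "d = 0") (simp_all add: t_def b_def compensator_def)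
      then show ?thesis unfolding d diff_Suc_1 compensator_Suc_self .
    qed
    ultimately show "(\<integral>\<^sup>+y. w i a y * \<psi> (t i a y) \<partial>lborel) = (\<integral>\<^sup>+z. v i (\<lambda>j. t j a (a j)) z * \<psi> z \<partial>lborel)"
      by (simp add: v_def t_def b_def)
  next
    show "(\<lambda>L. F (epoch_solution g n L)) \<in> borel_measurable (vec n)"
      using measurable_compose[OF measurable_epoch_solution F] .
  qed simp
  \<comment> \<open>Where the density does not vanish the epochs increase, hence they solve the
    system for their own compensator values and \<open>epoch_solution\<close> returns them.\<close>
  moreover have "(\<Prod>j\<in>{1..<n}. w j a (a j)) * F (epoch_solution g n (\<lambda>j\<in>{1..<n}. t j a (a j)))
      = (\<Prod>j\<in>{1..<n}. w j a (a j)) * F (prefix0 n a)" for a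
  proof (cases "\<forall>j\<in>{1..<n}. w j a (a j) \<noteq> 0")
    case True
    define A where "A = prefix0 n a"
    have Aa: "A j = (a(0 := 0)) j" if "j < n" for j using that by (simp add: A_def prefix0_def)
    have "strict_mono_on {0..<n} A"
    proof -
      have step: "A j < A (Suc j)" if "Suc j < n" for j
      proof -
        have "w (Suc j) a (a (Suc j)) \<noteq> 0" using True that by simp
        then have "(a(0 := 0)) j < a (Suc j)"
          unfolding w_def diff_Suc_1 by (cases "(a(0 := 0)) j < a (Suc j)") (simp_all only: indicator_def
              greaterThan_iff if_False mult_zero_left of_bool_eq not_True_eq_False simp_thms)
        then show ?thesis using that Aa[of j] Aa[of "Suc j"] by simp
      qed
      have "A r < A s" if "r < s" "s < n" for r s
        using that by (induction s rule: less_Suc_induct[of r, consumes 1, case_names 1 2]) (auto intro: step less_trans)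
      then show ?thesis by (intro strict_mono_onI) simp
    qed
    moreover have "t j a (a j) = compensator A j (A j)" if "j \<in> {1..<n}" for j
    proof -
      have "A j = a j" using that by (simp add: A_def prefix0_def)
      moreover have "compensator A j y = compensator (a(0 := 0)) j y" for y
        using that by (intro compensator_cong Aa) auto
      ultimately show ?thesis by (simp only: t_def)
    qed
    ultimately have "solves_epochs g n (\<lambda>j\<in>{1..<n}. t j a (a j)) A"
      by (simp add: solves_epochs_iff A_def prefix0_def)
    then show ?thesis by (simp add: epoch_solution_eq A_def)
  next
    case False
    then have "(\<Prod>j\<in>{1..<n}. w j a (a j)) = 0" by (intro prod_zero) auto
    then show ?thesis by (simp only: mult_zero_left)
  qed
  ultimately show ?thesis unfolding w_def v_def epoch_density_def by simp
qed

end

section \<open>Birth times along a genealogy, and the uniform draws\<close>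

text \<open>\<open>p i\<close> is the parent of i and \<open>x i\<close> the age of the parent at
  that birth, so ages are summed along the line of ancestors. The guard makes the recursion
  terminate for every p and stops it at the root 0.\<close>

fun births :: "(nat \<Rightarrow> nat) \<Rightarrow> (nat \<Rightarrow> real) \<Rightarrow> nat \<Rightarrow> real" where
  "births p x i = (if p i < i then x i + births p x (p i) else 0)"

declare births.simps [simp del]

lemma births_0 [simp]: "births p x 0 = 0"
  by (subst births.simps) simp

lemma births_cong: "(\<And>j. 1 \<le> j \<Longrightarrow> j \<le> i \<Longrightarrow> x j = y j) \<Longrightarrow> births p x i = births p y i"
proof (induction i rule: less_induct)
  case (less i)
  show ?case
  proof (cases "p i < i")
    case True
    then have "births p x (p i) = births p y (p i)" using less by auto
    moreover have "x i = y i" using less.prems[of i] True by auto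
    ultimately show ?thesis by (simp add: births.simps[of p _ i])
  qed (simp add: births.simps[of p _ i])
qed

lemma measurable_births [measurable]:
  "i < k \<Longrightarrow> (\<lambda>x. births p x i) \<in> borel_measurable (vec k)"
proof (induction i rule: less_induct)
  case (less i)
  show ?case
  proof (cases "p i < i")
    case True
    then have "i \<in> {1..<k}" using less by auto
    then show ?thesis using less True by (simp add: births.simps[of p _ i])
  qed (simp add: births.simps[of p _ i])
qed

text \<open>Passing from ages to birth times shifts each coordinate by the birth time of the parent,
  which depends on earlier coordinates only; the map is triangular with unit Jacobian.\<close>

lemma nn_integral_births:
  fixes f :: "real \<Rightarrow> ennreal"
  assumes p: "\<And>i. 1 \<le> i \<Longrightarrow> p i < i" and f [measurable]: "f \<in> borel_measurable borel"
    and \<Psi>: "\<Psi> \<in> borel_measurable (vec n)"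
  shows "(\<integral>\<^sup>+x. (\<Prod>i\<in>{1..<n}. f (x i)) * \<Psi> (\<lambda>i\<in>{1..<n}. births p x i) \<partial>lvec n) =
    (\<integral>\<^sup>+a. (\<Prod>i\<in>{1..<n}. f (a i - (a(0 := 0)) (p i))) * \<Psi> a \<partial>lvec n)"
proof -
  define t where "t i x y = y + (if i = 0 then 0 else births p x (p i))" for i :: nat and x and y :: real
  define v where "v i a z = f (z - (if i = 0 then 0 else (a(0 := 0)) (p i)))" for i :: nat and a :: "nat \<Rightarrow> real" and z
  have tb: "t i x (x i) = births p x i" if "1 \<le> i" for i x
    using p[OF that] that by (simp add: t_def births.simps[of p _ i])
  have "(\<integral>\<^sup>+x. (\<Prod>i\<in>{1..<n}. f (x i)) * \<Psi> (\<lambda>i\<in>{1..<n}. t i x (x i)) \<partial>lvec n) =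
    (\<integral>\<^sup>+a. (\<Prod>i\<in>{1..<n}. v i a (a i)) * \<Psi> a \<partial>lvec n)"
  proof (rule nn_integral_triangular)
    show "sigma_finite_measure (lborel :: real measure)" by standard
    fix i :: nat and a b :: "nat \<Rightarrow> real" and y assume ab: "\<And>j. j \<in> {1..<i} \<Longrightarrow> a j = b j"
    show "t i a y = t i b y"
      using p[of i] ab births_cong[of "p i" a b p] by (cases "i = 0") (auto simp: t_def)
    show "v i a y = v i b y"
      using p[of i] ab[of "p i"] by (cases "i = 0") (auto simp: v_def)
  next
    fix i k :: nat assume ik: "1 \<le> i" "i \<le> k"
    have pk: "p i < k" using p[OF ik(1)] ik by simp
    show "(\<lambda>(a, y). f y) \<in> borel_measurable (vec k \<Otimes>\<^sub>M borel)" by measurable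
    have "(\<lambda>x. snd x + births p (fst x) (p i)) \<in> borel_measurable (vec k \<Otimes>\<^sub>M borel)"
      by (intro borel_measurable_add measurable_snd measurable_compose[OF measurable_fst measurable_births[OF pk]])
    then show "case_prod (t i) \<in> borel_measurable (vec k \<Otimes>\<^sub>M borel)"
      using ik by (simp add: t_def split_def)
    have "(\<lambda>x. ((fst x)(0 := 0)) (p i)) \<in> borel_measurable (vec k \<Otimes>\<^sub>M (borel :: real measure))"
      by (rule measurable_compose[OF measurable_fst measurable_upd0[OF pk]])
    from measurable_compose[OF borel_measurable_diff[OF measurable_snd this] f]
    show "case_prod (v i) \<in> borel_measurable (vec k \<Otimes>\<^sub>M borel)"
      using ik by (simp add: v_def split_def)
  next
    fix i :: nat and a :: "nat \<Rightarrow> real" and \<psi> :: "real \<Rightarrow> ennreal"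
    assume i: "1 \<le> i" and \<psi> [measurable]: "\<psi> \<in> borel_measurable borel"
    define s where "s = births p a (p i)"
    have "((\<lambda>j. t j a (a j))(0 := 0)) (p i) = s"
      using tb[of "p i" a] by (cases "p i = 0") (auto simp: s_def)
    then have "(\<integral>\<^sup>+z. v i (\<lambda>j. t j a (a j)) z * \<psi> z \<partial>lborel) = (\<integral>\<^sup>+z. f (z - s) * \<psi> z \<partial>lborel)"
      using i by (simp add: v_def)
    also have "\<dots> = (\<integral>\<^sup>+y. f y * \<psi> (y + s) \<partial>lborel)"
      by (subst nn_integral_real_affine[where c = 1 and t = s]) (auto simp: add.commute)
    finally show "(\<integral>\<^sup>+y. f y * \<psi> (t i a y) \<partial>lborel) = (\<integral>\<^sup>+z. v i (\<lambda>j. t j a (a j)) z * \<psi> z \<partial>lborel)"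
      using i by (simp add: t_def s_def)
  qed (use \<Psi> in auto)
  moreover have "(\<lambda>i\<in>{1..<n}. t i x (x i)) = (\<lambda>i\<in>{1..<n}. births p x i)" for x
    using tb by (auto simp: fun_eq_iff)
  moreover have "(\<Prod>i\<in>{1..<n}. v i a (a i)) = (\<Prod>i\<in>{1..<n}. f (a i - (a(0 := 0)) (p i)))" for a
    by (intro prod.cong) (auto simp: v_def)
  ultimately show ?thesis by simp
qed

text \<open>The diagonal case of the triangular substitution, with the uniform law as source
  measure: each coordinate becomes uniform on the interval of length c that ends at c q_i.\<close>

lemma nn_integral_uniform_affine:
  fixes c :: real and q :: "nat \<Rightarrow> real"
  assumes c: "0 < c" and \<Psi>: "\<Psi> \<in> borel_measurable (vec n)"
  shows "(\<integral>\<^sup>+U. \<Psi> (\<lambda>i\<in>{1..<n}. c * (q i - U i)) \<partial>uvec n) =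
    (\<integral>\<^sup>+L. (\<Prod>i\<in>{1..<n}. ennreal (1 / c) * indicator {c * (q i - 1)<..<c * q i} (L i)) * \<Psi> L \<partial>lvec n)"
proof -
  define w where "w i a y = (1 :: ennreal)" for i :: nat and a :: "nat \<Rightarrow> real" and y :: real
  define t where "t i a y = c * (q i - y)" for i :: nat and a :: "nat \<Rightarrow> real" and y :: real
  define v where "v i a z = ennreal (1 / c) * indicator {c * (q i - 1)<..<c * q i} z" for i :: nat and a :: "nat \<Rightarrow> real" and z :: real
  have "(\<integral>\<^sup>+U. (\<Prod>i\<in>{1..<n}. w i U (U i)) * \<Psi> (\<lambda>i\<in>{1..<n}. t i U (U i)) \<partial>uvec n) =
    (\<integral>\<^sup>+L. (\<Prod>i\<in>{1..<n}. v i L (L i)) * \<Psi> L \<partial>lvec n)"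
  proof (rule nn_integral_triangular)
    interpret prob_space "uniform_measure lborel {0<..<1 :: real}"
      by (rule prob_space_uniform_measure) auto
    show "sigma_finite_measure (uniform_measure lborel {0<..<1 :: real})" by unfold_locales
    show "case_prod (w i) \<in> borel_measurable (vec k \<Otimes>\<^sub>M borel)" for i k
      unfolding w_def by measurable
    show "case_prod (t i) \<in> borel_measurable (vec k \<Otimes>\<^sub>M borel)" for i k
      unfolding t_def by measurable
    show "case_prod (v i) \<in> borel_measurable (vec k \<Otimes>\<^sub>M borel)" for i k
      unfolding v_def by measurable
    fix i :: nat and a :: "nat \<Rightarrow> real" and \<psi> :: "real \<Rightarrow> ennreal"
    assume \<psi> [measurable]: "\<psi> \<in> borel_measurable borel"
    have "(\<integral>\<^sup>+z. v i (\<lambda>j. t j a (a j)) z * \<psi> z \<partial>lborel)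
        = ennreal \<bar>- c\<bar> * (\<integral>\<^sup>+y. v i a (c * q i + (- c) * y) * \<psi> (c * q i + (- c) * y) \<partial>lborel)"
      using c unfolding v_def by (subst nn_integral_real_affine[where c = "- c" and t = "c * q i"]) auto
    also have "\<dots> = (\<integral>\<^sup>+y. ennreal c * (v i a (c * q i + (- c) * y) * \<psi> (c * q i + (- c) * y)) \<partial>lborel)"
      using c unfolding v_def by (subst nn_integral_cmult) auto
    also have "\<dots> = (\<integral>\<^sup>+y. \<psi> (t i a y) * indicator {0<..<1} y \<partial>lborel)"
    proof (rule nn_integral_cong)
      fix y
      have cancel: "ennreal c * (ennreal (1 / c) * x) = x" for x
        using c by (simp add: mult.assoc[symmetric] ennreal_mult[symmetric])
      have "c * q i + - c * y \<in> {c * (q i - 1)<..<c * q i} \<longleftrightarrow> y \<in> {0<..<1}"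
      proof -
        have "c * (q i - 1) < c * q i + - c * y \<longleftrightarrow> c * y < c * 1" by (simp add: algebra_simps)
        then show ?thesis using c by (auto simp: zero_less_mult_iff)
      qed
      then have ind: "indicator {c * (q i - 1)<..<c * q i} (c * q i + - c * y) = (indicator {0<..<1} y :: ennreal)"
        unfolding indicator_def by (simp only:)
      have t: "c * q i + - c * y = c * (q i - y)" by (simp add: algebra_simps)
      show "ennreal c * (v i a (c * q i + (- c) * y) * \<psi> (c * q i + (- c) * y)) = \<psi> (t i a y) * indicator {0<..<1} y"
        unfolding v_def t_def ind mult.assoc cancel unfolding t by (rule mult.commute)
    qed
    also have "\<dots> = (\<integral>\<^sup>+y. w i a y * \<psi> (t i a y) \<partial>uniform_measure lborel {0<..<1})"
      unfolding w_def t_def by (subst nn_integral_uniform_measure) (auto simp: divide_ennreal_def)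
    finally show "(\<integral>\<^sup>+y. w i a y * \<psi> (t i a y) \<partial>uniform_measure lborel {0<..<1}) = (\<integral>\<^sup>+z. v i (\<lambda>j. t j a (a j)) z * \<psi> z \<partial>lborel)"
      by simp
  qed (use \<Psi> in \<open>auto simp: w_def t_def v_def\<close>)
  then show ?thesis by (simp add: w_def t_def v_def)
qed

section \<open>The law of the sampler\<close>

definition sorted_entry :: "nat \<Rightarrow> (nat \<Rightarrow> real) \<Rightarrow> nat \<Rightarrow> real" where
  "sorted_entry n x i = sort (map x [1..<n]) ! (i - 1)"

abbreviation sorted_vec :: "nat \<Rightarrow> (nat \<Rightarrow> real) \<Rightarrow> nat \<Rightarrow> real" where
  "sorted_vec n x \<equiv> \<lambda>i\<in>{1..<n}. sorted_entry n x i"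

lemma sorted_entry_mono:
  assumes "1 \<le> i" "i \<le> j" "j < n"
  shows "sorted_entry n x i \<le> sorted_entry n x j"
  unfolding sorted_entry_def using assms by (intro sorted_nth_mono) auto

lemma sorted_entry_permutes:
  obtains \<sigma> where "\<sigma> permutes {1..<n}" "\<And>i. i \<in> {1..<n} \<Longrightarrow> sorted_entry n x i = x (\<sigma> i)"
proof -
  define xs where "xs = map x [1..<n]"
  have lx: "length xs = n - 1" by (simp add: xs_def)
  have "mset (sort xs) = mset xs" by simp
  from mset_eq_permutation[OF this] obtain p where
    p: "p permutes {..<n - 1}" "permute_list p xs = sort xs" by (metis lx)
  define \<sigma> where "\<sigma> i = (if i \<in> {1..<n} then Suc (p (i - 1)) else i)" for i
  have b1: "bij_betw (\<lambda>i. i - 1) {1..<n} {..<n - 1}"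
    by (rule bij_betw_byWitness[where f' = Suc]) auto
  have b2: "bij_betw p {..<n - 1} {..<n - 1}" using p(1) by (rule permutes_imp_bij)
  have b3: "bij_betw Suc {..<n - 1} {1..<n}"
    by (rule bij_betw_byWitness[where f' = "\<lambda>i. i - 1"]) auto
  have "bij_betw (Suc \<circ> (p \<circ> (\<lambda>i. i - 1))) {1..<n} {1..<n}"
    by (rule bij_betw_trans[OF bij_betw_trans[OF b1 b2] b3])
  then have "bij_betw \<sigma> {1..<n} {1..<n}"
    by (rule iffD1[OF bij_betw_cong, rotated]) (auto simp: \<sigma>_def)
  then have "\<sigma> permutes {1..<n}" by (rule bij_imp_permutes) (auto simp: \<sigma>_def)
  moreover have "sorted_entry n x i = x (\<sigma> i)" if i: "i \<in> {1..<n}" for i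
  proof -
    have pi: "p (i - 1) < n - 1" using permutes_in_image[OF p(1), of "i - 1"] i by auto
    have "sorted_entry n x i = permute_list p xs ! (i - 1)"
      unfolding p(2) by (simp add: sorted_entry_def xs_def)
    also have "\<dots> = xs ! p (i - 1)" using p(1) i lx by (subst permute_list_nth) auto
    also have "\<dots> = x (\<sigma> i)" using pi i by (simp add: xs_def \<sigma>_def)
    finally show ?thesis .
  qed
  ultimately show thesis by (rule that)
qed

text \<open>Counting replaces sorting. This gives measurability of the order statistics and links
  them to the counting form of the parking condition.\<close>

lemma sorted_entry_le_iff:
  assumes i: "i \<in> {1..<n}"
  shows "sorted_entry n x i \<le> c \<longleftrightarrow> i \<le> card {j\<in>{1..<n}. x j \<le> c}"
proof -
  obtain \<sigma> where \<sigma>: "\<sigma> permutes {1..<n}" "\<And>i. i \<in> {1..<n} \<Longrightarrow> sorted_entry n x i = x (\<sigma> i)"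
    by (rule sorted_entry_permutes[of n x]) blast
  have "{j\<in>{1..<n}. x j \<le> c} = \<sigma> ` {k\<in>{1..<n}. sorted_entry n x k \<le> c}"
  proof -
    have "j \<in> \<sigma> ` {k\<in>{1..<n}. sorted_entry n x k \<le> c}" if "j \<in> {1..<n}" "x j \<le> c" for j
    proof -
      have "j \<in> \<sigma> ` {1..<n}" using that(1) permutes_image[OF \<sigma>(1)] by blast
      then show ?thesis using that \<sigma>(2) by auto
    qed
    moreover have "\<sigma> k \<in> {1..<n}" if "k \<in> {1..<n}" for k using that permutes_in_image[OF \<sigma>(1)] by blast
    ultimately show ?thesis using \<sigma>(2) by auto
  qed
  then have card: "card {j\<in>{1..<n}. x j \<le> c} = card {k\<in>{1..<n}. sorted_entry n x k \<le> c}"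
    using permutes_inj_on[OF \<sigma>(1)] by (simp add: card_image)
  show ?thesis
  proof
    assume "sorted_entry n x i \<le> c"
    then have "{1..i} \<subseteq> {k\<in>{1..<n}. sorted_entry n x k \<le> c}"
    proof (intro subsetI)
      fix k assume "k \<in> {1..i}"
      then show "k \<in> {k\<in>{1..<n}. sorted_entry n x k \<le> c}"
        using i sorted_entry_mono[of k i n x] \<open>sorted_entry n x i \<le> c\<close> by auto
    qed
    from card_mono[OF _ this] show "i \<le> card {j\<in>{1..<n}. x j \<le> c}" unfolding card by simp
  next
    assume le: "i \<le> card {j\<in>{1..<n}. x j \<le> c}"
    show "sorted_entry n x i \<le> c"
    proof (rule ccontr)
      assume "\<not> sorted_entry n x i \<le> c"
      then have "{k\<in>{1..<n}. sorted_entry n x k \<le> c} \<subseteq> {1..<i}"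
      proof (intro subsetI)
        fix k assume "k \<in> {k\<in>{1..<n}. sorted_entry n x k \<le> c}"
        then show "k \<in> {1..<i}"
          using i sorted_entry_mono[of i k n x] \<open>\<not> sorted_entry n x i \<le> c\<close> by (cases "i \<le> k") auto
      qed
      from card_mono[OF _ this] have "card {k\<in>{1..<n}. sorted_entry n x k \<le> c} \<le> i - 1" by simp
      then show False using le card i unfolding atLeastLessThan_iff by linarith
    qed
  qed
qed

lemma measurable_sorted_entry:
  "(\<lambda>x. sorted_vec n x) \<in> vec n \<rightarrow>\<^sub>M vec n"
proof (rule measurable_restrict)
  fix i assume i: "i \<in> {1..<n}"
  have "{x \<in> space (vec n). sorted_entry n x i \<le> c} \<in> sets (vec n)" for c
  proof -
    have eq: "sorted_entry n x i \<le> c \<longleftrightarrow> real i \<le> (\<Sum>j\<in>{1..<n}. indicator {..c} (x j))" for x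
    proof -
      have "(\<Sum>j\<in>{1..<n}. indicator {..c} (x j)) = real (card {j\<in>{1..<n}. x j \<le> c})"
        by (simp add: indicator_def sum.If_cases Int_def flip: of_bool_def)
      then show ?thesis unfolding sorted_entry_le_iff[OF i] by simp
    qed
    have "(\<lambda>x. \<Sum>j\<in>{1..<n}. indicator {..c} (x j) :: real) \<in> borel_measurable (vec n)"
      by (intro borel_measurable_sum measurable_compose[OF measurable_component_singleton]) auto
    then show ?thesis unfolding eq by measurable
  qed
  then show "(\<lambda>x. sorted_entry n x i) \<in> borel_measurable (vec n)"
    unfolding borel_measurable_iff_le by simp
qed

text \<open>An upper bound is enough later on, so that ties need not be excluded.\<close>

lemma nn_integral_sorted_entry_le:
  fixes f :: "(nat \<Rightarrow> real) \<Rightarrow> ennreal"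
  assumes f: "f \<in> borel_measurable (vec n)"
  shows "(\<integral>\<^sup>+x. f (sorted_vec n x) \<partial>lvec n)
    \<le> fact (n - 1) * (\<integral>\<^sup>+x. f x \<partial>lvec n)"
proof -
  let ?P = "lvec n"
  let ?S = "{\<sigma>. \<sigma> permutes {1..<n}}"
  have f': "f \<in> borel_measurable ?P"
    using f by (simp cong: measurable_cong_sets sets_PiM_cong)
  have fin: "finite ?S" by (rule finite_permutations) simp
  \<comment> \<open>The sorting permutation depends on x and is ambiguous under ties; the sum over
    all permutations dominates whichever one is chosen.\<close>
  have "(\<integral>\<^sup>+x. f (sorted_vec n x) \<partial>?P) \<le> (\<integral>\<^sup>+x. (\<Sum>\<sigma>\<in>?S. f (\<lambda>i\<in>{1..<n}. x (\<sigma> i))) \<partial>?P)"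
  proof (rule nn_integral_mono)
    fix x
    obtain \<sigma> where \<sigma>: "\<sigma> permutes {1..<n}" "\<And>i. i \<in> {1..<n} \<Longrightarrow> sorted_entry n x i = x (\<sigma> i)"
      by (rule sorted_entry_permutes[of n x]) blast
    then have "f (sorted_vec n x) = f (\<lambda>i\<in>{1..<n}. x (\<sigma> i))"
      by (intro arg_cong[where f = f] restrict_ext)
    also have "\<dots> \<le> (\<Sum>\<sigma>\<in>?S. f (\<lambda>i\<in>{1..<n}. x (\<sigma> i)))"
      using \<sigma> fin by (intro member_le_sum) auto
    finally show "f (sorted_vec n x) \<le> (\<Sum>\<sigma>\<in>?S. f (\<lambda>i\<in>{1..<n}. x (\<sigma> i)))" .
  qed
  also have "\<dots> = (\<Sum>\<sigma>\<in>?S. \<integral>\<^sup>+x. f (\<lambda>i\<in>{1..<n}. x (\<sigma> i)) \<partial>?P)"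
  proof (rule nn_integral_sum)
    fix \<sigma> assume "\<sigma> \<in> ?S"
    then have "(\<lambda>x. \<lambda>i\<in>{1..<n}. x (\<sigma> i)) \<in> ?P \<rightarrow>\<^sub>M ?P"
      by (intro measurable_restrict measurable_component_singleton) (simp add: permutes_in_image del: atLeastLessThan_iff)
    from measurable_compose[OF this f']
    show "(\<lambda>x. f (\<lambda>i\<in>{1..<n}. x (\<sigma> i))) \<in> borel_measurable ?P" .
  qed
  also have "\<dots> = (\<Sum>\<sigma>\<in>?S. \<integral>\<^sup>+x. f x \<partial>?P)"
    by (intro sum.cong refl nn_integral_PiM_permute f) auto
  also have "\<dots> = fact (n - 1) * (\<integral>\<^sup>+x. f x \<partial>?P)"
    using card_permutations[of "{1..<n}" "n - 1"] by (simp add: of_nat_fact)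
  finally show ?thesis .
qed

lemma sorted_entry_mult:
  assumes c: "0 \<le> c" and i: "i \<in> {1..<n}"
  shows "sorted_entry n (\<lambda>k. c * x k) i = c * sorted_entry n x i"
proof -
  have "sort (map (\<lambda>k. c * x k) [1..<n]) = map ((*) c) (sort (map x [1..<n]))"
  proof (rule properties_for_sort)
    show "mset (map ((*) c) (sort (map x [1..<n]))) = mset (map (\<lambda>k. c * x k) [1..<n])"
      unfolding mset_map mset_sort by (simp add: multiset.map_comp o_def)
    have "sorted_wrt (\<lambda>a b. c * a \<le> c * b) (sort (map x [1..<n]))"
      by (rule sorted_wrt_mono_rel[OF _ sorted_sort]) (use c in \<open>auto intro: mult_left_mono\<close>)
    then show "sorted (map ((*) c) (sort (map x [1..<n])))" by (simp add: sorted_wrt_map)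
  qed
  moreover have "i - 1 < length (sort (map x [1..<n]))" using i by auto
  ultimately show ?thesis unfolding sorted_entry_def by (simp only: nth_map)
qed

context subcritical_kernel
begin

text \<open>Differs from \<open>admissible\<close> only by allowing equality on the left, that is,
  on a null set.\<close>

definition region :: "nat \<Rightarrow> (nat \<Rightarrow> real) \<Rightarrow> ennreal" where
  "region n L = (\<Prod>i\<in>{1..<n}. indicator {(L(0 := 0)) (i - 1)..<real i * \<rho>} (L i))"

lemma region_measurable: "region n \<in> borel_measurable (vec n)"
  unfolding region_def[abs_def]
proof (rule borel_measurable_prod_ennreal)
  fix i assume i: "i \<in> {1..<n}"
  have m: "(\<lambda>L. (L(0 := 0)) (i - 1)) \<in> borel_measurable (vec n)"
    by (rule measurable_upd0) (use i in auto)
  have "(\<lambda>L. if f L \<le> f' L \<and> f' L < real i * \<rho> then 1 else 0 :: ennreal) \<in> borel_measurable M"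
    if [measurable]: "f \<in> borel_measurable M" "f' \<in> borel_measurable M" for f f' :: "_ \<Rightarrow> real" and M
    by measurable
  from this[OF m measurable_component_singleton[OF i]]
  show "(\<lambda>L. indicator {(L(0 := 0)) (i - 1)..<real i * \<rho>} (L i) :: ennreal) \<in> borel_measurable (vec n)"
    by (simp only: indicator_def atLeastLessThan_iff of_bool_def)
qed

text \<open>The open cells are disjoint, so at most one q contributes. If x lies in the cell of a
  parking function, at least i of its coordinates are below i \<rho>, which puts the sorted vector
  into the region.\<close>

lemma sum_parking_cells_le:
  "(\<Sum>q\<in>parking_functions n. \<Prod>i\<in>{1..<n}. ennreal (1 / \<rho>) * indicator {\<rho> * (real (q i) - 1)<..<\<rho> * real (q i)} (x i))
    \<le> ennreal (1 / \<rho>) ^ (n - 1) * region n (sorted_vec n x)"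
proof -
  let ?y = "\<lambda>i\<in>{1..<n}. sorted_entry n x i"
  define c where "c q = (\<Prod>i\<in>{1..<n}. indicator {\<rho> * (real (q i) - 1)<..<\<rho> * real (q i)} (x i) :: ennreal)" for q :: "nat \<Rightarrow> nat"
  have "(\<Sum>q\<in>parking_functions n. c q) \<le> region n ?y"
  proof (cases "\<exists>q\<in>parking_functions n. c q \<noteq> 0")
    case False
    then show ?thesis by (simp add: sum.neutral)
  next
    case True
    then obtain q where q: "q \<in> parking_functions n" "c q \<noteq> 0" by auto
    have cq: "\<rho> * (real (q' i) - 1) < x i \<and> x i < \<rho> * real (q' i)" if "c q' \<noteq> 0" "i \<in> {1..<n}" for q' i
    proof -
      have "indicator {\<rho> * (real (q' i) - 1)<..<\<rho> * real (q' i)} (x i) \<noteq> (0 :: ennreal)"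
        using that unfolding c_def by auto
      then show ?thesis by (auto split: split_indicator_asm)
    qed
    have uniq: "q' = q" if "q' \<in> parking_functions n" "c q' \<noteq> 0" for q'
    proof (rule PiE_ext)
      show "q' \<in> (\<Pi>\<^sub>E i\<in>{1..<n}. {1..n})" "q \<in> (\<Pi>\<^sub>E i\<in>{1..<n}. {1..n})"
        using that q by (auto simp: parking_functions_def)
      fix i assume i: "i \<in> {1..<n}"
      have "\<rho> * (real (q' i) - 1) < \<rho> * real (q i)" "\<rho> * (real (q i) - 1) < \<rho> * real (q' i)"
        using cq[OF that(2) i] cq[OF q(2) i] by linarith+
      then show "q' i = q i" using rho_pos by (simp add: mult_less_cancel_left)
    qed
    have "c q' \<le> 1" for q'
      unfolding c_def by (intro prod_le_1) (auto split: split_indicator)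
    have "(\<Sum>q\<in>parking_functions n. c q) = (\<Sum>q'\<in>{q}. c q')"
    proof (rule sum.mono_neutral_right[OF finite_parking_functions])
      show "{q} \<subseteq> parking_functions n" using q(1) by simp
      show "\<forall>q'\<in>parking_functions n - {q}. c q' = 0" using uniq by blast
    qed
    also have "\<dots> \<le> 1" using \<open>\<And>q'. c q' \<le> 1\<close> by simp
    also have "1 = region n ?y"
      unfolding region_def
    proof (rule prod.neutral[symmetric], rule ballI)
      fix i assume i: "i \<in> {1..<n}"
      have "(?y(0 := 0)) (i - 1) \<le> ?y i"
      proof (cases "i = 1")
        case True
        obtain \<sigma> where \<sigma>: "\<sigma> permutes {1..<n}" "\<And>i. i \<in> {1..<n} \<Longrightarrow> sorted_entry n x i = x (\<sigma> i)"
          by (rule sorted_entry_permutes[of n x]) blast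
        have s: "\<sigma> i \<in> {1..<n}" using i permutes_in_image[OF \<sigma>(1)] by blast
        have "1 \<le> q (\<sigma> i)" using q(1) s by (auto simp: parking_functions_def)
        then have "0 \<le> \<rho> * (real (q (\<sigma> i)) - 1)" using rho_pos by simp
        then show ?thesis using cq[OF q(2) s] \<sigma>(2)[OF i] i True by simp
      next
        case False
        then have "1 \<le> i - 1" "i - 1 < n" using i by auto
        then show ?thesis using i sorted_entry_mono[of "i - 1" i n x] by simp
      qed
      moreover have "sorted_entry n x i < real i * \<rho>"
      proof -
        \<comment> \<open>The counting criterion has a weak inequality, so the strict bound by
          \<rho> i is replaced by the largest coordinate below it. The entry \<rho> i - 1 keeps the
          maximum defined on a nonempty set.\<close>
        define M where "M = Max (insert (\<rho> * real i - 1) (x ` {j\<in>{1..<n}. x j < \<rho> * real i}))"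
        have M: "M < \<rho> * real i" unfolding M_def by (subst Max_less_iff) auto
        have "i \<le> card {j\<in>{1..<n}. q j \<le> i}" using q(1) i by (auto simp: parking_functions_def)
        also have "\<dots> \<le> card {j\<in>{1..<n}. x j \<le> M}"
        proof (rule card_mono, simp, rule subsetI)
          fix j assume "j \<in> {j\<in>{1..<n}. q j \<le> i}"
          then have j: "j \<in> {1..<n}" "q j \<le> i" by auto
          have "x j < \<rho> * real (q j)" using cq[OF q(2) j(1)] by simp
          also have "\<dots> \<le> \<rho> * real i" using j rho_pos by simp
          finally have "x j \<le> M" unfolding M_def using j by (intro Max_ge) auto
          then show "j \<in> {j\<in>{1..<n}. x j \<le> M}" using j by simp
        qed
        finally have "sorted_entry n x i \<le> M" unfolding sorted_entry_le_iff[OF i] .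
        then show ?thesis using M by (simp add: mult.commute)
      qed
      ultimately show "indicator {(?y(0 := 0)) (i - 1)..<real i * \<rho>} (?y i) = (1 :: ennreal)"
        using i by (simp add: indicator_def)
    qed
    finally show ?thesis .
  qed
  then have "ennreal (1 / \<rho>) ^ (n - 1) * (\<Sum>q\<in>parking_functions n. c q) \<le> ennreal (1 / \<rho>) ^ (n - 1) * region n ?y"
    by (rule mult_left_mono) simp
  then show ?thesis by (simp add: c_def prod.distrib sum_distrib_left)
qed

text \<open>The integral of \<open>F\<close> against the measure \<nu>_n of the overview.\<close>

definition cluster_mass :: "nat \<Rightarrow> ((nat \<Rightarrow> real) \<Rightarrow> ennreal) \<Rightarrow> ennreal" where
  "cluster_mass n F = ennreal (exp (- \<rho> * real n)) *
    (\<integral>\<^sup>+a. epoch_density n a * F (prefix0 n a) \<partial>lvec n)"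

lemma Lam_eq_sorted_entry:
  assumes "i \<in> {1..<n}"
  shows "Lam \<rho> n \<pi> U i = sorted_entry n (\<lambda>k. \<rho> * (real (shifted n \<pi> k) - U k)) i"
  using assms rho_pos by (subst sorted_entry_mult) (auto simp: Lam_def sorted_entry_def)

lemma sorted_entry_cong:
  assumes "\<And>i. i \<in> {1..<n} \<Longrightarrow> x i = y i"
  shows "sorted_entry n x = sorted_entry n y"
proof -
  have "map x [1..<n] = map y [1..<n]" using assms by simp
  then show ?thesis by (intro ext) (simp only: sorted_entry_def)
qed

text \<open>Exhibits the output as a composition of measurable maps between finite products, which
  depends on the preferences through a parking function alone.\<close>

lemma epoch_solution_Lam:
  "epoch_solution g n (Lam \<rho> n \<pi> U) =
    epoch_solution g n (\<lambda>i\<in>{1..<n}. sorted_entry n (\<lambda>k\<in>{1..<n}. \<rho> * (real (restrict (shifted n \<pi>) {1..<n} k) - U k)) i)"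
proof (rule epoch_solution_cong)
  fix i assume i: "i \<in> {1..<n}"
  have "sorted_entry n (\<lambda>k. \<rho> * (real (shifted n \<pi> k) - U k)) =
      sorted_entry n (\<lambda>k\<in>{1..<n}. \<rho> * (real (restrict (shifted n \<pi>) {1..<n} k) - U k))"
    by (rule sorted_entry_cong) simp
  then show "Lam \<rho> n \<pi> U i =
      (\<lambda>i\<in>{1..<n}. sorted_entry n (\<lambda>k\<in>{1..<n}. \<rho> * (real (restrict (shifted n \<pi>) {1..<n} k) - U k)) i) i"
    unfolding Lam_eq_sorted_entry[OF i] using i by simp
qed

text \<open>Here the constants meet: n from the rotations, 1 / n^(n-1) from the uniform preferences,
  1 / \<rho>^(n-1) from the cells and (n - 1)! from sorting cancel the Borel weight down to exp (- n
  \<rho>).\<close>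

lemma sampler_le_cluster_mass:
  assumes n: "1 \<le> n" and F: "F \<in> borel_measurable seqs"
  shows "ennreal (exp (- \<rho> * real n) / fact n * (\<rho> * real n) ^ (n - 1)) *
    (\<integral>\<^sup>+\<pi>. (\<integral>\<^sup>+U. F (epoch_solution g n (Lam \<rho> n \<pi> U)) \<partial>uvec n)
      \<partial>measure_pmf (Pi_pmf {1..<n} 0 (\<lambda>_. pmf_of_set {1..n}))) \<le> cluster_mass n F"
proof -
  let ?PU = "uvec n"
  let ?PL = "lvec n"
  let ?D = "PiE_dflt {1..<n} 0 (\<lambda>_. {1..n})"
  define \<Phi> where "\<Phi> L = F (epoch_solution g n L)" for L
  define \<Psi> where "\<Psi> x = \<Phi> (sorted_vec n x)" for x
  have \<Phi>: "\<Phi> \<in> borel_measurable (vec n)"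
    unfolding \<Phi>_def[abs_def] by (rule measurable_compose[OF measurable_epoch_solution F])
  have \<Psi>: "\<Psi> \<in> borel_measurable (vec n)"
    unfolding \<Psi>_def[abs_def] by (rule measurable_compose[OF measurable_sorted_entry \<Phi>])
  have PLm: "f \<in> borel_measurable ?PL" if "f \<in> borel_measurable (vec n)" for f :: "_ \<Rightarrow> ennreal"
    using that by (simp cong: measurable_cong_sets sets_PiM_cong)
  define J where "J q = (\<integral>\<^sup>+U. \<Psi> (\<lambda>k\<in>{1..<n}. \<rho> * (real (q k) - U k)) \<partial>?PU)" for q :: "nat \<Rightarrow> nat"
  define W where "W q x = (\<Prod>i\<in>{1..<n}. ennreal (1 / \<rho>) * indicator {\<rho> * (real (q i) - 1)<..<\<rho> * real (q i)} (x i))"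
    for q :: "nat \<Rightarrow> nat" and x
  have Wm: "W q \<in> borel_measurable (vec n)" for q
    unfolding W_def[abs_def]
  proof (rule borel_measurable_prod_ennreal)
    fix i assume "i \<in> {1..<n}"
    then have [measurable]: "(\<lambda>x. x i) \<in> borel_measurable (vec n)"
      by (rule measurable_component_singleton)
    show "(\<lambda>x. ennreal (1 / \<rho>) * indicator {\<rho> * (real (q i) - 1)<..<\<rho> * real (q i)} (x i))
        \<in> borel_measurable (vec n)" by measurable
  qed
  have "(\<integral>\<^sup>+\<pi>. (\<integral>\<^sup>+U. F (epoch_solution g n (Lam \<rho> n \<pi> U)) \<partial>?PU) \<partial>measure_pmf (Pi_pmf {1..<n} 0 (\<lambda>_. pmf_of_set {1..n})))
    = (\<integral>\<^sup>+\<pi>. J (restrict (shifted n \<pi>) {1..<n}) \<partial>measure_pmf (pmf_of_set ?D))"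
    unfolding J_def \<Psi>_def \<Phi>_def epoch_solution_Lam using n by (subst Pi_pmf_of_set) auto
  also have "\<dots> = (\<Sum>\<pi>\<in>?D. J (restrict (shifted n \<pi>) {1..<n})) / of_nat (n ^ (n - 1))"
  proof -
    have card: "card ?D = n ^ (n - 1)" by (subst card_PiE_dflt) auto
    then have "?D \<noteq> {}" using n by (metis card.empty power_not_zero not_one_le_zero)
    moreover have "finite ?D" by (rule finite_PiE_dflt) auto
    ultimately show ?thesis
      using card by (subst nn_integral_pmf_of_set) (simp_all add: ennreal_of_nat_eq_real_of_nat del: One_nat_def)
  qed
  also have "\<dots> \<le> of_nat n * (\<Sum>q\<in>parking_functions n. J q) / of_nat (n ^ (n - 1))"
    by (intro divide_right_mono_ennreal sum_shifted_le n)
  also have "(\<Sum>q\<in>parking_functions n. J q) \<le> ennreal (1 / \<rho>) ^ (n - 1) * (fact (n - 1) * (\<integral>\<^sup>+L. region n L * \<Phi> L \<partial>?PL))"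
  proof -
    have "J q = (\<integral>\<^sup>+x. W q x * \<Psi> x \<partial>?PL)" for q
      unfolding J_def W_def by (rule nn_integral_uniform_affine[OF rho_pos \<Psi>])
    then have "(\<Sum>q\<in>parking_functions n. J q) = (\<integral>\<^sup>+x. (\<Sum>q\<in>parking_functions n. W q x * \<Psi> x) \<partial>?PL)"
      using Wm \<Psi> by (simp add: nn_integral_sum PLm del: One_nat_def)
    also have "\<dots> \<le> (\<integral>\<^sup>+x. ennreal (1 / \<rho>) ^ (n - 1) *
        (region n (sorted_vec n x) * \<Phi> (sorted_vec n x)) \<partial>?PL)"
    proof (rule nn_integral_mono)
      fix x
      have "(\<Sum>q\<in>parking_functions n. W q x * \<Psi> x) = (\<Sum>q\<in>parking_functions n. W q x) * \<Psi> x"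
        by (simp only: sum_distrib_right)
      also have "\<dots> \<le> (ennreal (1 / \<rho>) ^ (n - 1) * region n (sorted_vec n x)) * \<Psi> x"
        unfolding W_def by (intro mult_right_mono sum_parking_cells_le) simp
      finally show "(\<Sum>q\<in>parking_functions n. W q x * \<Psi> x) \<le> ennreal (1 / \<rho>) ^ (n - 1) *
          (region n (sorted_vec n x) * \<Phi> (sorted_vec n x))"
        by (simp only: \<Psi>_def mult.assoc)
    qed
    also have "\<dots> = ennreal (1 / \<rho>) ^ (n - 1) *
        (\<integral>\<^sup>+x. region n (sorted_vec n x) * \<Phi> (sorted_vec n x) \<partial>?PL)"
      by (intro nn_integral_cmult PLm borel_measurable_times_ennreal
          measurable_compose[OF measurable_sorted_entry region_measurable] measurable_compose[OF measurable_sorted_entry \<Phi>])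
    also have "\<dots> \<le> ennreal (1 / \<rho>) ^ (n - 1) * (fact (n - 1) * (\<integral>\<^sup>+L. region n L * \<Phi> L \<partial>?PL))"
      by (intro mult_left_mono nn_integral_sorted_entry_le[where f = "\<lambda>L. region n L * \<Phi> L"]
          borel_measurable_times_ennreal region_measurable \<Phi>) simp
    finally show ?thesis .
  qed
  finally have le: "(\<integral>\<^sup>+\<pi>. (\<integral>\<^sup>+U. F (epoch_solution g n (Lam \<rho> n \<pi> U)) \<partial>?PU) \<partial>measure_pmf (Pi_pmf {1..<n} 0 (\<lambda>_. pmf_of_set {1..n})))
    \<le> of_nat n * (ennreal (1 / \<rho>) ^ (n - 1) * (fact (n - 1) * (\<integral>\<^sup>+L. region n L * \<Phi> L \<partial>?PL))) / of_nat (n ^ (n - 1))"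
    by (simp add: mult_left_mono divide_right_mono_ennreal)
  define I where "I = (\<integral>\<^sup>+L. region n L * \<Phi> L \<partial>?PL)"
  have I: "I = (\<integral>\<^sup>+a. epoch_density n a * F (prefix0 n a) \<partial>?PL)"
    unfolding I_def region_def \<Phi>_def by (rule nn_integral_compensator[OF F])
  define b where "b = exp (- \<rho> * real n) / fact n * (\<rho> * real n) ^ (n - 1)"
  have b0: "0 \<le> b" using rho_pos by (simp add: b_def)
  have "ennreal b * (of_nat n * (ennreal (1 / \<rho>) ^ (n - 1) * (fact (n - 1) * I)) / of_nat (n ^ (n - 1)))
    = ennreal (b * (real n * ((1 / \<rho>) ^ (n - 1) * fact (n - 1)) / real n ^ (n - 1))) * I"
  proof -
    have "ennreal (b * (real n * ((1 / \<rho>) ^ (n - 1) * fact (n - 1)) / real n ^ (n - 1)))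
      = ennreal b * (of_nat n * (ennreal (1 / \<rho>) ^ (n - 1) * fact (n - 1)) * inverse (of_nat (n ^ (n - 1))))"
      using b0 rho_pos n
      by (simp add: ennreal_mult ennreal_power divide_inverse ennreal_of_nat_eq_real_of_nat
          inverse_ennreal flip: ennreal_fact)
    then show ?thesis by (simp only: divide_ennreal_def mult_ac)
  qed
  also have "b * (real n * ((1 / \<rho>) ^ (n - 1) * fact (n - 1)) / real n ^ (n - 1)) = exp (- \<rho> * real n)"
  proof -
    have "fact n = real n * fact (n - 1)" using n by (simp add: fact_reduce)
    then show ?thesis
      unfolding b_def using n rho_pos by (simp add: power_mult_distrib power_one_over)
  qed
  finally have eq: "ennreal b * (of_nat n * (ennreal (1 / \<rho>) ^ (n - 1) * (fact (n - 1) * I)) / of_nat (n ^ (n - 1)))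
    = cluster_mass n F" unfolding cluster_mass_def I .
  show ?thesis
    unfolding b_def[symmetric] eq[symmetric] I_def by (rule mult_left_mono[OF le]) simp
qed

end

section \<open>Clusters and recursive trees\<close>

lemma sorted_nth_le_iff:
  fixes c :: "'a :: linorder"
  assumes "sorted xs" "i < length xs"
  shows "xs ! i \<le> c \<longleftrightarrow> i < length (filter (\<lambda>x. x \<le> c) xs)"
  using assms
proof (induction xs arbitrary: i)
  case (Cons x xs)
  show ?case
  proof (cases "x \<le> c")
    case True
    then show ?thesis using Cons by (cases i) auto
  next
    case False
    then have "c < (x # xs) ! i" using Cons.prems by (cases i) (auto simp: not_le intro: less_le_trans)
    moreover have "filter (\<lambda>x. x \<le> c) (x # xs) = []"
      using False Cons.prems by (auto simp: filter_empty_conv not_le intro: less_le_trans)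
    ultimately show ?thesis by (metis linorder_not_le list.size(3) not_less_zero)
  qed
qed simp

lemma sorted_list_of_multiset_nth_le_iff:
  fixes m :: "'a :: linorder multiset"
  assumes "i < size m"
  shows "sorted_list_of_multiset m ! i \<le> c \<longleftrightarrow> i < size (filter_mset (\<lambda>x. x \<le> c) m)"
proof -
  define xs where "xs = sorted_list_of_multiset m"
  have m: "m = mset xs" by (simp add: xs_def)
  have "sorted xs" unfolding xs_def by (rule sorted_sorted_list_of_multiset)
  moreover have "size (filter_mset (\<lambda>x. x \<le> c) m) = length (filter (\<lambda>x. x \<le> c) xs)"
    unfolding m by (simp flip: mset_filter)
  moreover have "i < length xs" using assms unfolding m by simp
  ultimately show ?thesis using sorted_nth_le_iff[of xs i c] unfolding xs_def by (simp only:)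
qed

lemma sorted_list_of_set_nth_le_iff:
  fixes C :: "'a :: linorder set"
  assumes "finite C" "i < card C"
  shows "sorted_list_of_set C ! i \<le> c \<longleftrightarrow> i < card (C \<inter> {..c})"
  using sorted_list_of_multiset_nth_le_iff[of i "mset_set C" c] assms
  by (simp add: sorted_list_of_mset_set Int_def)

lemma card_less_sorted_list_of_set_nth:
  fixes C :: "'a :: linorder set"
  assumes C: "finite C" and k: "k < card C"
  shows "card {j\<in>C. j < sorted_list_of_set C ! k} = k"
proof -
  define xs where "xs = sorted_list_of_set C"
  have xs: "sorted_wrt (<) xs" "set xs = C" "length xs = card C" "distinct xs"
    using C by (simp_all add: xs_def)
  have mono: "xs ! i < xs ! j" if "i < j" "j < length xs" for i j
    using sorted_wrt_nth_less[OF xs(1) that] .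
  have "{j\<in>C. j < xs ! k} = (!) xs ` {..<k}"
  proof
    show "{j\<in>C. j < xs ! k} \<subseteq> (!) xs ` {..<k}"
    proof
      fix j assume "j \<in> {j\<in>C. j < xs ! k}"
      then obtain i where i: "i < length xs" "j = xs ! i" "xs ! i < xs ! k"
        unfolding xs(2)[symmetric] by (auto simp: in_set_conv_nth)
      have "i < k" using mono[of k i] i k by (cases i k rule: linorder_cases) auto
      then show "j \<in> (!) xs ` {..<k}" using i by auto
    qed
    show "(!) xs ` {..<k} \<subseteq> {j\<in>C. j < xs ! k}"
    proof (rule image_subsetI)
      fix i assume "i \<in> {..<k}"
      then have "i < k" by simp
      then have "xs ! i < xs ! k" "xs ! i \<in> set xs" using mono[of i k] k xs by auto
      then show "xs ! i \<in> {j\<in>C. j < xs ! k}" using xs by simp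
    qed
  qed
  moreover have "inj_on ((!) xs) {..<k}"
    using xs k by (intro inj_on_nth) auto
  ultimately show ?thesis unfolding xs_def by (simp add: card_image)
qed

lemma sorted_list_of_set_nth_card_less:
  fixes C :: "'a :: linorder set"
  assumes C: "finite C" and i: "i \<in> C"
  shows "sorted_list_of_set C ! card {j\<in>C. j < i} = i" "card {j\<in>C. j < i} < card C"
proof -
  have "i \<in> set (sorted_list_of_set C)" using i C by simp
  then obtain k where k: "k < card C" "sorted_list_of_set C ! k = i"
    unfolding in_set_conv_nth by auto
  then have "card {j\<in>C. j < i} = k" using card_less_sorted_list_of_set_nth[OF C k(1)] by simp
  then show "sorted_list_of_set C ! card {j\<in>C. j < i} = i" "card {j\<in>C. j < i} < card C" using k by auto
qed

lemma sorted_list_of_set_nth_mem: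
  "finite C \<Longrightarrow> k < card C \<Longrightarrow> sorted_list_of_set C ! k \<in> C"
  using nth_mem[of k "sorted_list_of_set C"] by simp

text \<open>If the boxes are ordered like their indices, then points in distinct boxes are sorted
  automatically. A statement about the ordered points thus becomes one about counts on disjoint
  sets, which is what the definition of a Poisson process controls.\<close>

lemma separated_counts_iff:
  fixes C :: "real set" and K :: "nat set"
  assumes C: "finite C" and K: "finite K"
    and sep: "\<And>j k x y. j \<in> K \<Longrightarrow> k \<in> K \<Longrightarrow> j < k \<Longrightarrow> x \<in> B j \<Longrightarrow> y \<in> B k \<Longrightarrow> x < y"
  shows "card C = card K \<and> (\<forall>j\<in>K. sorted_list_of_set C ! card {i\<in>K. i < j} \<in> B j) \<longleftrightarrow>
    (\<forall>j\<in>K. card (C \<inter> B j) = 1) \<and> card (C \<inter> - (\<Union>j\<in>K. B j)) = 0"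
    (is "?L \<longleftrightarrow> ?R")
proof
  assume L: ?L
  define y where "y k = sorted_list_of_set C ! k" for k
  define r where "r j = card {i\<in>K. i < j}" for j
  have yB: "y (r j) \<in> B j" if "j \<in> K" for j using L that by (simp add: y_def r_def)
  have yC: "y k \<in> C" if "k < card C" for k
    unfolding y_def by (rule sorted_list_of_set_nth_mem[OF C that])
  have cov: "\<exists>j\<in>K. c = y (r j)" if c: "c \<in> C" for c
  proof -
    obtain k where k: "k < card C" "c = y k"
      using sorted_list_of_set_nth_card_less[OF C c] unfolding y_def by metis
    define j where "j = sorted_list_of_set K ! k"
    have kK: "k < card K" using k L by simp
    have "j \<in> K" unfolding j_def by (rule sorted_list_of_set_nth_mem[OF K kK])
    moreover have "r j = k" unfolding r_def j_def by (rule card_less_sorted_list_of_set_nth[OF K kK])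
    ultimately show ?thesis using k by auto
  qed
  have "C \<inter> B j = {y (r j)}" if j: "j \<in> K" for j
  proof -
    have "y (r j) \<in> C"
      using yC sorted_list_of_set_nth_card_less(2)[OF K j] L by (simp add: r_def)
    moreover have "c = y (r j)" if c: "c \<in> C" "c \<in> B j" for c
    proof -
      obtain i where i: "i \<in> K" "c = y (r i)" using cov[OF c(1)] by auto
      have "c \<in> B i" using yB[OF i(1)] i by simp
      then have "i = j" using sep[of i j c c] sep[of j i c c] i j c by (cases i j rule: linorder_cases) auto
      then show ?thesis using i by simp
    qed
    ultimately show ?thesis using yB[OF j] by blast
  qed
  moreover have "C \<inter> - (\<Union>j\<in>K. B j) = {}"
  proof -
    have "c \<in> (\<Union>j\<in>K. B j)" if "c \<in> C" for c
    proof -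
      from cov[OF that] obtain j where "j \<in> K" "c = y (r j)" ..
      then show ?thesis using yB[of j] by blast
    qed
    then show ?thesis by blast
  qed
  ultimately show ?R by simp
next
  assume R: ?R
  then have "\<forall>j\<in>K. \<exists>z. C \<inter> B j = {z}" by (auto simp: card_1_singleton_iff)
  then obtain z where z: "\<And>j. j \<in> K \<Longrightarrow> C \<inter> B j = {z j}" by metis
  have CU: "C \<inter> - (\<Union>j\<in>K. B j) = {}" using R C by simp
  have Cz: "C = z ` K"
  proof
    show "C \<subseteq> z ` K"
    proof
      fix c assume "c \<in> C"
      then obtain j where "j \<in> K" "c \<in> B j" using CU by blast
      then show "c \<in> z ` K" using z[of j] \<open>c \<in> C\<close> by blast
    qed
    show "z ` K \<subseteq> C" using z by blast
  qed
  have zm: "z i < z j" if "i \<in> K" "j \<in> K" "i < j" for i j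
    using sep[OF that, of "z i" "z j"] z[OF that(1)] z[OF that(2)] by blast
  have inj: "inj_on z K"
    by (rule linorder_inj_onI) (use zm in \<open>auto simp: less_le\<close>)
  have "sorted_list_of_set C ! card {i\<in>K. i < j} \<in> B j" if j: "j \<in> K" for j
  proof -
    have zless: "z i < z j \<longleftrightarrow> i < j" if "i \<in> K" for i
      using zm[of i j] zm[of j i] that j by (cases i j rule: linorder_cases) auto
    have "{c\<in>C. c < z j} = z ` {i\<in>K. i < j}"
      unfolding Cz by (auto simp: zless)
    moreover have "inj_on z {i\<in>K. i < j}" by (rule inj_on_subset[OF inj]) auto
    ultimately have "card {c\<in>C. c < z j} = card {i\<in>K. i < j}"
      by (simp add: card_image)
    moreover have "z j \<in> C" unfolding Cz using j by (rule imageI)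
    ultimately have "sorted_list_of_set C ! card {i\<in>K. i < j} = z j"
      using sorted_list_of_set_nth_card_less(1)[OF C, of "z j"] by simp
    then show ?thesis using z[OF j] by blast
  qed
  moreover have "card C = card K" unfolding Cz by (rule card_image[OF inj])
  ultimately show ?L by blast
qed

section \<open>Labels, genealogies and the events of a cluster\<close>

definition alive :: "(nat list \<Rightarrow> real set) \<Rightarrow> nat list \<Rightarrow> bool" where
  "alive Y u \<longleftrightarrow> (\<forall>i<length u. u ! i < card (Y (take i u)))"

definition birth_time :: "(nat list \<Rightarrow> real set) \<Rightarrow> nat list \<Rightarrow> real" where
  "birth_time Y u = (\<Sum>i<length u. sorted_list_of_set (Y (take i u)) ! (u ! i))"

text \<open>Resolves the inductive set label by label: membership and birth time of u involve only
  the finitely many offspring sets along its line of ancestors, which makes them measurable.\<close>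

lemma cluster_events_eq: "cluster_events Y = (\<lambda>u. (u, birth_time Y u)) ` {u. alive Y u}"
proof -
  have "alive Y u \<and> s = birth_time Y u" if "(u, s) \<in> cluster_events Y" for u s
    using that
  proof (induction rule: cluster_events.induct)
    case initial
    then show ?case by (simp add: alive_def birth_time_def)
  next
    case (offspring u s k)
    then show ?case by (auto simp: alive_def birth_time_def nth_append less_Suc_eq)
  qed
  moreover have "(u, birth_time Y u) \<in> cluster_events Y" if "alive Y u" for u
    using that
  proof (induction u rule: rev_induct)
    case Nil
    then show ?case using cluster_events.initial by (simp add: birth_time_def)
  next
    case (snoc k u)
    have "alive Y u"
      unfolding alive_def
    proof (intro allI impI)
      fix i assume "i < length u"
      then show "u ! i < card (Y (take i u))"
        using snoc.prems by (auto simp: alive_def nth_append dest: spec[of _ i])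
    qed
    moreover have "k < card (Y u)"
      using snoc.prems by (auto simp: alive_def nth_append dest: spec[of _ "length u"])
    ultimately have "alive Y u" "k < card (Y u)" by auto
    then show ?case using cluster_events.offspring[OF snoc.IH, of k] by (simp add: birth_time_def nth_append)
  qed
  ultimately show ?thesis by auto
qed

text \<open>Numbers follow the order of time, so the earlier siblings of i are those with a smaller
  number, and their count is the last entry of its label.\<close>

definition sibling_rank :: "(nat \<Rightarrow> nat) \<Rightarrow> nat \<Rightarrow> nat" where
  "sibling_rank p i = card {j\<in>{1..<i}. p j = p i}"

text \<open>
  If the events are numbered in order of time and \<open>p i\<close> is the number of the parent of event \<open>i\<close>,
  then \<open>label p i\<close> is the Ulam--Harris label of event \<open>i\<close>.
\<close>

fun label :: "(nat \<Rightarrow> nat) \<Rightarrow> nat \<Rightarrow> nat list" where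
  "label p i = (if p i < i then label p (p i) @ [sibling_rank p i] else [])"

declare label.simps [simp del]

text \<open>Recursive trees on \<open>{0..<n}\<close>. The default 0 outside makes the function
  itself unique for each tree and keeps \<open>p i < i\<close> valid for all i \<ge> 1.\<close>

definition parent_maps :: "nat \<Rightarrow> (nat \<Rightarrow> nat) set" where
  "parent_maps n = PiE_dflt {1..<n} 0 (\<lambda>i. {..<i})"

lemma parent_less: "p \<in> parent_maps n \<Longrightarrow> 1 \<le> i \<Longrightarrow> p i < i"
  by (cases "i < n") (auto simp: parent_maps_def PiE_dflt_def)

lemma label_0 [simp]: "label p 0 = []"
  by (subst label.simps) simp

lemma label_parent: "p \<in> parent_maps n \<Longrightarrow> 1 \<le> i \<Longrightarrow> label p i = label p (p i) @ [sibling_rank p i]"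
  by (subst label.simps) (simp add: parent_less)

lemma births_parent: "p \<in> parent_maps n \<Longrightarrow> 1 \<le> i \<Longrightarrow> births p x i = x i + births p x (p i)"
  by (subst births.simps) (simp add: parent_less)

lemma sibling_rank_children:
  assumes "j \<in> {1..<n}" "p j = i"
  shows "sibling_rank p j = card {j'\<in>{j'\<in>{1..<n}. p j' = i}. j' < j}"
  unfolding sibling_rank_def using assms by (intro arg_cong[where f = card]) auto

text \<open>A label contains the label of the parent, which determines the parent by induction, and
  the rank among its children, which determines the child.\<close>

lemma label_inj:
  assumes p: "p \<in> parent_maps n"
  shows "label p i = label p j \<Longrightarrow> i = j"
proof (induction i arbitrary: j rule: less_induct)
  case (less i)
  show ?case
  proof (cases "i = 0 \<or> j = 0")
    case True
    then show ?thesis using less.prems label_parent[OF p, of i] label_parent[OF p, of j] by (cases "i = 0"; cases "j = 0") auto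
  next
    case False
    then have ij: "1 \<le> i" "1 \<le> j" by auto
    have eq: "label p (p i) = label p (p j)" "sibling_rank p i = sibling_rank p j"
      using less.prems unfolding label_parent[OF p ij(1)] label_parent[OF p ij(2)] by auto
    have pij: "p i = p j" using less.IH[OF parent_less[OF p ij(1)] eq(1)] .
    define C where "C = {k\<in>{1..<Suc (max i j)}. p k = p i}"
    have "i \<in> C" "j \<in> C" "finite C" using ij pij by (auto simp: C_def)
    moreover have "sibling_rank p i = card {k\<in>C. k < i}" "sibling_rank p j = card {k\<in>C. k < j}"
      unfolding C_def by (rule sibling_rank_children; use ij pij in simp)+
    ultimately show ?thesis using eq(2) sorted_list_of_set_nth_card_less(1)[of C] by metis
  qed
qed

definition ages :: "(nat list \<Rightarrow> real set) \<Rightarrow> (nat \<Rightarrow> nat) \<Rightarrow> nat \<Rightarrow> real" where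
  "ages Y p j = sorted_list_of_set (Y (label p (p j))) ! sibling_rank p j"

definition child_count :: "nat \<Rightarrow> (nat \<Rightarrow> nat) \<Rightarrow> nat \<Rightarrow> nat" where
  "child_count n p i = card {j\<in>{1..<n}. p j = i}"

text \<open>The cluster has exactly n events and genealogy p when listed in time. Prescribing all n
  child counts rules out further events; strict increase says that the numbering is chronological
  and there are no ties.\<close>

definition cluster_tree :: "nat \<Rightarrow> (nat \<Rightarrow> nat) \<Rightarrow> (nat list \<Rightarrow> real set) \<Rightarrow> bool" where
  "cluster_tree n p Y \<longleftrightarrow> (\<forall>i<n. card (Y (label p i)) = child_count n p i) \<and>
    strict_mono_on {0..<n} (births p (ages Y p))"

text \<open>With exactly these child counts the labels given by p are closed under taking offspring,
  and each of them is reached from its parent.\<close>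

lemma cluster_events_tree:
  assumes n: "1 \<le> n" and p: "p \<in> parent_maps n" and tree: "cluster_tree n p Y"
  shows "cluster_events Y = (\<lambda>i. (label p i, births p (ages Y p) i)) ` {..<n}" (is "_ = ?e ` _")
proof -
  have cc: "card (Y (label p i)) = child_count n p i" if "i < n" for i
    using tree that by (simp add: cluster_tree_def)
  have pn: "p i < n" if "i < n" for i
    using parent_less[OF p, of i] that p by (cases "i = 0") (auto simp: parent_maps_def PiE_dflt_def)
  have "z \<in> ?e ` {..<n}" if "z \<in> cluster_events Y" for z
    using that
  proof (cases z)
    case (Pair u s)
    have "(u, s) \<in> ?e ` {..<n}" using that unfolding Pair
    proof (induction rule: cluster_events.induct)
      case initial
      then show ?case using n by (intro image_eqI[of _ _ 0]) auto
    next
      case (offspring u s k)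
      then obtain i where i: "i < n" "u = label p i" "s = births p (ages Y p) i" by auto
      define C where "C = {j\<in>{1..<n}. p j = i}"
      have C: "finite C" "k < card C" using offspring i cc by (auto simp: C_def child_count_def)
      define j where "j = sorted_list_of_set C ! k"
      have "j \<in> C" unfolding j_def by (rule sorted_list_of_set_nth_mem[OF C])
      then have j: "j \<in> {1..<n}" "p j = i" by (auto simp: C_def)
      have "sibling_rank p j = card {j'\<in>C. j' < j}"
        unfolding C_def using j by (rule sibling_rank_children)
      also have "\<dots> = k" unfolding j_def by (rule card_less_sorted_list_of_set_nth[OF C])
      finally have "sibling_rank p j = k" .
      moreover have j1: "1 \<le> j" "j \<in> {..<n}" using j(1) by auto
      ultimately have "?e j = (u @ [k], s + sorted_list_of_set (Y u) ! k)"
        unfolding label_parent[OF p j1(1)] births_parent[OF p j1(1)] ages_def j(2) i(2,3) by (simp add: add.commute)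
      then show ?case using imageI[OF j1(2), of ?e] by (simp only:)
    qed
    then show ?thesis using Pair by simp
  qed
  moreover have "?e i \<in> cluster_events Y" if "i < n" for i
    using that
  proof (induction i rule: less_induct)
    case (less i)
    show ?case
    proof (cases "i = 0")
      case True
      then show ?thesis using cluster_events.initial by simp
    next
      case False
      then have i: "1 \<le> i" by simp
      have "sibling_rank p i < child_count n p (p i)"
        using sorted_list_of_set_nth_card_less(2)[of "{j\<in>{1..<n}. p j = p i}" i] i less.prems
        by (simp add: sibling_rank_children[of i n] child_count_def)
      then have "sibling_rank p i < card (Y (label p (p i)))" using cc pn less.prems by simp
      moreover have "?e (p i) \<in> cluster_events Y"
        using less.IH parent_less[OF p i] pn[OF less.prems] by blast
      ultimately have "(label p (p i) @ [sibling_rank p i],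
          births p (ages Y p) (p i) + ages Y p i) \<in> cluster_events Y"
        unfolding ages_def[of Y p i] by (intro cluster_events.offspring)
      then show ?thesis
        unfolding label_parent[OF p i] births_parent[OF p i] by (simp only: add.commute)
    qed
  qed
  ultimately show ?thesis by auto
qed

lemma cluster_tree_outcome:
  assumes n: "1 \<le> n" and p: "p \<in> parent_maps n" and tree: "cluster_tree n p Y"
  shows "cluster_size Y = n" "cluster_epochs Y = prefix0 n (births p (ages Y p))"
proof -
  let ?b = "births p (ages Y p)"
  let ?e = "\<lambda>i. (label p i, ?b i)"
  note ev = cluster_events_tree[OF n p tree]
  have inj: "inj_on ?e {..<n}" using label_inj[OF p] by (auto simp: inj_on_def)
  show size: "cluster_size Y = n" unfolding cluster_size_def ev using inj by (simp add: card_image)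
  have "image_mset snd (mset_set (cluster_events Y)) = image_mset ?b (mset_set {..<n})"
    unfolding ev using inj by (simp add: image_mset_mset_set[symmetric] multiset.map_comp o_def)
  also have "\<dots> = mset (map ?b [0..<n])"
    by (metis atLeast_upt mset_map mset_set_upto_eq_mset_upto)
  finally have "sorted_list_of_multiset (image_mset snd (mset_set (cluster_events Y))) = sort (map ?b [0..<n])"
    by (simp only: sorted_list_of_multiset_mset)
  also have "sort (map ?b [0..<n]) = map ?b [0..<n]"
  proof (rule sorted_sort_id)
    have sm: "strict_mono_on {0..<n} ?b" using tree by (simp add: cluster_tree_def)
    show "sorted (map ?b [0..<n])"
      unfolding sorted_iff_nth_mono
    proof (intro allI impI)
      fix i j assume "i \<le> j" "j < length (map ?b [0..<n])"
      then show "map ?b [0..<n] ! i \<le> map ?b [0..<n] ! j"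
        using strict_mono_on_leD[OF sm, of i j] by simp
    qed
  qed
  finally show "cluster_epochs Y = prefix0 n ?b"
    by (intro ext) (auto simp: cluster_epochs_def size prefix0_def not_le Suc_le_eq)
qed

text \<open>The outcome fixes n and the epochs. As these increase strictly, an epoch identifies its
  label, so both numberings carry the same labels, and labels reveal the parents. This yields
  disjointness of the events for different genealogies.\<close>

lemma cluster_tree_unique:
  assumes n: "1 \<le> n" "p \<in> parent_maps n" "cluster_tree n p Y"
    and m: "1 \<le> m" "q \<in> parent_maps m" "cluster_tree m q Y"
  shows "n = m \<and> p = q"
proof
  show nm: "n = m" using cluster_tree_outcome(1)[OF n] cluster_tree_outcome(1)[OF m] by simp
  let ?a = "births p (ages Y p)" and ?b = "births q (ages Y q)"
  have "prefix0 n ?a = prefix0 n ?b"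
    using cluster_tree_outcome(2)[OF n] cluster_tree_outcome(2)[OF m] nm by simp
  then have ab: "?a i = ?b i" if "i < n" for i
    using that by (cases "i = 0") (auto simp: prefix0_def fun_eq_iff dest!: spec[of _ i])
  have lab: "label p i = label q i" if "i < n" for i
  proof -
    have "(label p i, ?a i) \<in> (\<lambda>i. (label q i, ?b i)) ` {..<n}"
      using cluster_events_tree[OF n] cluster_events_tree[OF m] nm that by blast
    then obtain j where j: "j < n" "label p i = label q j" "?a i = ?b j" by auto
    have "?b i = ?b j" using j ab[OF that] by simp
    then have "i = j"
      using m(3) nm that j strict_mono_on_eqD[of "{0..<n}" ?b i j] by (auto simp: cluster_tree_def)
    then show ?thesis using j by simp
  qed
  show "p = q"
  proof
    fix i
    show "p i = q i"
    proof (cases "i \<in> {1..<n}")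
      case True
      then have i: "1 \<le> i" "i < n" by auto
      have qi: "q i < n" using parent_less[OF m(2) i(1)] i by simp
      have "label p (p i) = label q (q i)"
        using lab[OF i(2)] label_parent[OF n(2) i(1)] label_parent[OF m(2) i(1)] by simp
      also have "\<dots> = label p (q i)" using lab[OF qi] by simp
      finally show ?thesis by (rule label_inj[OF n(2)])
    next
      case False
      then show ?thesis using n(2) m(2) nm by (auto simp: parent_maps_def PiE_dflt_def)
    qed
  qed
qed

section \<open>The law of the cluster\<close>

lemma space_config_space: "space config_space = {C. finite C \<and> C \<subseteq> {0<..}}"
  unfolding config_space_def by (rule space_measure_of) auto

lemma measurable_config_count:
  assumes "B \<in> sets borel"
  shows "(\<lambda>C. card (C \<inter> B)) \<in> config_space \<rightarrow>\<^sub>M count_space UNIV"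
  unfolding measurable_count_space_eq2_countable
proof (intro conjI ballI)
  fix k :: nat
  have "(\<lambda>C. card (C \<inter> B)) -` {k} \<inter> space config_space = {C. finite C \<and> C \<subseteq> {0<..} \<and> card (C \<inter> B) = k}"
    unfolding space_config_space by auto
  also have "\<dots> \<in> sets config_space"
    unfolding config_space_def using assms by (subst sets_measure_of) (auto intro!: sigma_sets.Basic)
  finally show "(\<lambda>C. card (C \<inter> B)) -` {k} \<inter> space config_space \<in> sets config_space" .
qed simp

section \<open>Measurability of the cluster outcome\<close>

lemma measurable_card_Collect:
  fixes Q :: "'i :: countable \<Rightarrow> 'w \<Rightarrow> bool"
  assumes [measurable]: "\<And>u. Measurable.pred M (Q u)"
  shows "(\<lambda>\<omega>. card {u. Q u \<omega>}) \<in> M \<rightarrow>\<^sub>M count_space UNIV"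
proof -
  interpret sigma_finite_measure "count_space (UNIV :: 'i set)"
    by (rule sigma_finite_measure_count_space_countable) simp
  have "(\<lambda>(\<omega>, u). if Q u \<omega> then 1 else 0 :: ennreal) \<in> borel_measurable (M \<Otimes>\<^sub>M count_space (UNIV :: 'i set))"
    unfolding measurable_pair_swap_iff[of _ M] split_def
    by (rule measurable_pair_measure_countable1) auto
  from borel_measurable_nn_integral[OF this]
  have [measurable]: "(\<lambda>\<omega>. \<integral>\<^sup>+u. (if Q u \<omega> then 1 else 0) \<partial>count_space UNIV) \<in> borel_measurable M" .
  \<comment> \<open>The identity includes infinite sets, for which both \<open>card\<close> and
    \<open>enn2real\<close> of \<infinity> are 0.\<close>
  have eq: "real (card {u. Q u \<omega>}) = enn2real (\<integral>\<^sup>+u. (if Q u \<omega> then 1 else 0) \<partial>count_space UNIV)" for \<omega>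
  proof -
    have "(\<integral>\<^sup>+u. (if Q u \<omega> then 1 else 0) \<partial>count_space UNIV) = (\<integral>\<^sup>+u. indicator {u. Q u \<omega>} u \<partial>count_space UNIV)"
      by (intro nn_integral_cong) (simp add: indicator_def)
    also have "\<dots> = emeasure (count_space UNIV) {u. Q u \<omega>}" by simp
    finally have e: "(\<integral>\<^sup>+u. (if Q u \<omega> then 1 else 0) \<partial>count_space UNIV) = emeasure (count_space UNIV) {u. Q u \<omega>}" .
    show ?thesis unfolding e measure_def[symmetric] using Measure_Space.measure_count_space[of UNIV "{u. Q u \<omega>}"] by simp
  qed
  have "{\<omega> \<in> space M. card {u. Q u \<omega>} = k} \<in> sets M" for k
  proof -
    have "{\<omega> \<in> space M. card {u. Q u \<omega>} = k} =
        {\<omega> \<in> space M. enn2real (\<integral>\<^sup>+u. (if Q u \<omega> then 1 else 0) \<partial>count_space UNIV) = real k}"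
      unfolding eq[symmetric] by simp
    also have "\<dots> \<in> sets M" by measurable
    finally show ?thesis .
  qed
  then show ?thesis
    by (subst measurable_count_space_eq2_countable) (auto simp: vimage_def Int_def conj_commute)
qed

lemma cluster_size_eq: "cluster_size Y = card {u. alive Y u}"
  unfolding cluster_size_def cluster_events_eq by (rule card_image) (simp add: inj_on_def)

lemma cluster_epochs_le_iff:
  assumes i: "i < cluster_size Y"
  shows "cluster_epochs Y i \<le> c \<longleftrightarrow> i < card {u. alive Y u \<and> birth_time Y u \<le> c}"
proof -
  let ?E = "cluster_events Y"
  \<comment> \<open>An infinite cluster has size 0 by convention, so \<open>i\<close> could not be
    below it.\<close>
  have fin: "finite ?E" using i unfolding cluster_size_def by (metis card.infinite not_less_zero)
  have "cluster_epochs Y i \<le> c \<longleftrightarrow> i < size (filter_mset (\<lambda>x. x \<le> c) (image_mset snd (mset_set ?E)))"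
    using i fin sorted_list_of_multiset_nth_le_iff[of i "image_mset snd (mset_set ?E)" c]
    by (simp add: cluster_epochs_def cluster_size_def)
  also have "size (filter_mset (\<lambda>x. x \<le> c) (image_mset snd (mset_set ?E))) = card {e\<in>?E. snd e \<le> c}"
    using fin by (simp add: filter_mset_image_mset filter_mset_mset_set)
  also have "{e\<in>?E. snd e \<le> c} = (\<lambda>u. (u, birth_time Y u)) ` {u. alive Y u \<and> birth_time Y u \<le> c}"
    unfolding cluster_events_eq by auto
  also have "card \<dots> = card {u. alive Y u \<and> birth_time Y u \<le> c}"
    by (rule card_image) (simp add: inj_on_def)
  finally show ?thesis .
qed

locale hawkes_process = subcritical_kernel g + prob_space M
  for g :: "real \<Rightarrow> real" and M :: "'w measure" +
  fixes X :: "nat list \<Rightarrow> 'w \<Rightarrow> real set"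
  assumes poisson: "\<And>u. poisson_process M g (X u)"
    and indep: "indep_vars (\<lambda>_. config_space) X UNIV"
begin

abbreviation Y :: "'w \<Rightarrow> nat list \<Rightarrow> real set" where
  "Y \<omega> \<equiv> \<lambda>u. X u \<omega>"

abbreviation outcome :: "'w \<Rightarrow> nat \<times> (nat \<Rightarrow> real)" where
  "outcome \<equiv> \<lambda>\<omega>. (cluster_size (Y \<omega>), cluster_epochs (Y \<omega>))"

lemma X_measurable: "X u \<in> M \<rightarrow>\<^sub>M config_space"
  using poisson[of u] by (simp add: poisson_process_def)

lemma X_finite: "\<omega> \<in> space M \<Longrightarrow> finite (X u \<omega>)"
  using measurable_space[OF X_measurable, of \<omega> u] by (simp add: space_config_space)

lemma X_count_measurable: "B \<in> sets borel \<Longrightarrow> (\<lambda>\<omega>. card (X u \<omega> \<inter> B)) \<in> M \<rightarrow>\<^sub>M count_space UNIV"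
  by (rule measurable_compose[OF X_measurable measurable_config_count])

lemma X_card_measurable [measurable]: "(\<lambda>\<omega>. card (X u \<omega>)) \<in> M \<rightarrow>\<^sub>M count_space UNIV"
  using X_count_measurable[of UNIV u] by simp

text \<open>List entries beyond the end are unspecified; the default 0 makes a measurable function
  on all of \<open>M\<close>, and on the labels of the cluster the condition holds anyway.\<close>

definition point :: "nat list \<Rightarrow> nat \<Rightarrow> 'w \<Rightarrow> real" where
  "point u k \<omega> = (if k < card (X u \<omega>) then sorted_list_of_set (X u \<omega>) ! k else 0)"

lemma point_measurable [measurable]: "point u k \<in> borel_measurable M"
  unfolding borel_measurable_iff_le
proof
  fix c
  have [measurable]: "(\<lambda>\<omega>. card (X u \<omega> \<inter> {..c})) \<in> M \<rightarrow>\<^sub>M count_space UNIV"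
    by (rule X_count_measurable) simp
  have "{\<omega> \<in> space M. point u k \<omega> \<le> c} =
      {\<omega> \<in> space M. if k < card (X u \<omega>) then k < card (X u \<omega> \<inter> {..c}) else 0 \<le> c}"
    using sorted_list_of_set_nth_le_iff[OF X_finite] by (auto simp: point_def)
  also have "\<dots> \<in> sets M" by measurable
  finally show "{\<omega> \<in> space M. point u k \<omega> \<le> c} \<in> sets M" .
qed

lemma alive_measurable [measurable]: "Measurable.pred M (\<lambda>\<omega>. alive (Y \<omega>) u)"
proof -
  have "(\<lambda>\<omega>. alive (Y \<omega>) u) = (\<lambda>\<omega>. \<forall>i\<in>{..<length u}. u ! i < card (X (take i u) \<omega>))"
    by (auto simp: alive_def fun_eq_iff)
  also have "Measurable.pred M \<dots>" by measurable
  finally show ?thesis .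
qed

lemma alive_birth_time_measurable:
  "Measurable.pred M (\<lambda>\<omega>. alive (Y \<omega>) u \<and> birth_time (Y \<omega>) u \<le> c)"
proof -
  have "(\<lambda>\<omega>. alive (Y \<omega>) u \<and> birth_time (Y \<omega>) u \<le> c) =
      (\<lambda>\<omega>. alive (Y \<omega>) u \<and> (\<Sum>i<length u. point (take i u) (u ! i) \<omega>) \<le> c)"
    by (intro ext conj_cong) (auto simp: birth_time_def point_def alive_def)
  also have "Measurable.pred M \<dots>" by measurable
  finally show ?thesis .
qed

lemma outcome_measurable:
  "outcome \<in> M \<rightarrow>\<^sub>M outcome_space"
proof -
  have size [measurable]: "(\<lambda>\<omega>. cluster_size (Y \<omega>)) \<in> M \<rightarrow>\<^sub>M count_space UNIV"
    unfolding cluster_size_eq by (rule measurable_card_Collect) simp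
  have "(\<lambda>\<omega>. cluster_epochs (Y \<omega>) i) \<in> borel_measurable M" for i
    unfolding borel_measurable_iff_le
  proof
    fix c
    have [measurable]: "(\<lambda>\<omega>. card {u. alive (Y \<omega>) u \<and> birth_time (Y \<omega>) u \<le> c}) \<in> M \<rightarrow>\<^sub>M count_space UNIV"
      by (rule measurable_card_Collect[OF alive_birth_time_measurable])
    have "{\<omega> \<in> space M. cluster_epochs (Y \<omega>) i \<le> c} =
      {\<omega> \<in> space M. if i < cluster_size (Y \<omega>)
        then i < card {u. alive (Y \<omega>) u \<and> birth_time (Y \<omega>) u \<le> c} else 0 \<le> c}"
      using cluster_epochs_le_iff[of i] by (auto simp: cluster_epochs_def)
    also have "\<dots> \<in> sets M" by measurable
    finally show "{\<omega> \<in> space M. cluster_epochs (Y \<omega>) i \<le> c} \<in> sets M" .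
  qed
  then have "(\<lambda>\<omega>. cluster_epochs (Y \<omega>)) \<in> M \<rightarrow>\<^sub>M seqs"
    by (intro measurable_PiM_single') auto
  then show ?thesis unfolding outcome_space_def using size by (rule measurable_Pair[rotated])
qed

section \<open>Probability and density of a genealogy\<close>

lemma prob_count:
  assumes "B \<in> sets borel"
  shows "prob {\<omega> \<in> space M. card (X u \<omega> \<inter> B) = k} =
    exp (- (LINT t:B|lborel. h t)) * (LINT t:B|lborel. h t) ^ k / fact k"
proof -
  have "prob {\<omega> \<in> space M. card (X u \<omega> \<inter> B) = k} =
          exp (- (LINT t:B \<inter> {0<..}|lborel. g t)) * (LINT t:B \<inter> {0<..}|lborel. g t) ^ k / fact k"
    using poisson[of u] assms unfolding poisson_process_def by blast
  then show ?thesis unfolding set_integral_h[OF assms] .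
qed

text \<open>Index 0, which is not in K, is given to the complement of the boxes, so that the counts
  run over a partition of the line. The exponential factors then combine to exp (- \<rho>), whatever
  the boxes are.\<close>

lemma prob_single_counts:
  fixes K :: "nat set"
  assumes K: "finite K" "0 \<notin> K" and B: "\<And>j. j \<in> K \<Longrightarrow> B j \<in> sets borel"
    and disj: "disjoint_family_on B K"
  shows "prob {\<omega> \<in> space M. (\<forall>j\<in>K. card (X u \<omega> \<inter> B j) = 1) \<and> card (X u \<omega> \<inter> - (\<Union>j\<in>K. B j)) = 0} =
    exp (- \<rho>) * (\<Prod>j\<in>K. LINT t:B j|lborel. h t)"
proof -
  define B' where "B' j = (if j \<in> K then B j else if j = 0 then - (\<Union>j\<in>K. B j) else {})" for j
  define kk :: "nat \<Rightarrow> nat" where "kk j = (if j = 0 then 0 else 1)" for j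
  define m where "m A = (LINT t:A|lborel. h t)" for A
  have "- (\<Union>j\<in>K. B j) \<in> sets borel" using K(1) B by (intro borel_comp sets.finite_UN)
  then have B'm: "B' j \<in> sets borel" for j using B by (simp add: B'_def)
  have B'0: "B' 0 = - (\<Union>j\<in>K. B j)" and B'K: "\<And>j. j \<in> K \<Longrightarrow> B' j = B j"
    using K(2) by (auto simp: B'_def)
  have dj: "disjoint_family B'"
    using disj unfolding disjoint_family_on_def B'_def by auto
  have iv: "indep_vars (\<lambda>_. count_space UNIV) (\<lambda>i \<omega>. card (X u \<omega> \<inter> B' i)) UNIV"
    using poisson[of u] B'm dj unfolding poisson_process_def by blast
  have "{\<omega> \<in> space M. (\<forall>j\<in>K. card (X u \<omega> \<inter> B j) = 1) \<and> card (X u \<omega> \<inter> - (\<Union>j\<in>K. B j)) = 0}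
    = (\<Inter>j\<in>insert 0 K. (\<lambda>\<omega>. card (X u \<omega> \<inter> B' j)) -` {kk j} \<inter> space M)"
    unfolding B'0[symmetric] using K(2) by (auto simp: B'K kk_def split: if_splits)
  then have "prob {\<omega> \<in> space M. (\<forall>j\<in>K. card (X u \<omega> \<inter> B j) = 1) \<and> card (X u \<omega> \<inter> - (\<Union>j\<in>K. B j)) = 0}
    = (\<Prod>j\<in>insert 0 K. prob ((\<lambda>\<omega>. card (X u \<omega> \<inter> B' j)) -` {kk j} \<inter> space M))"
    using indep_varsD[OF iv, of "insert 0 K" "\<lambda>j. {kk j}"] K by simp
  also have "\<dots> = (\<Prod>j\<in>insert 0 K. exp (- m (B' j)) * m (B' j) ^ kk j)"
  proof (rule prod.cong[OF refl])
    fix j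
    have "(\<lambda>\<omega>. card (X u \<omega> \<inter> B' j)) -` {kk j} \<inter> space M = {\<omega> \<in> space M. card (X u \<omega> \<inter> B' j) = kk j}" by auto
    then show "prob ((\<lambda>\<omega>. card (X u \<omega> \<inter> B' j)) -` {kk j} \<inter> space M) = exp (- m (B' j)) * m (B' j) ^ kk j"
      using prob_count[OF B'm, of u j "kk j"] by (simp add: m_def kk_def)
  qed
  also have "\<dots> = exp (- (\<Sum>j\<in>insert 0 K. m (B' j))) * (\<Prod>j\<in>insert 0 K. m (B' j) ^ kk j)"
    using K by (simp only: prod.distrib exp_sum[symmetric] finite_insert sum_negf[symmetric])
  also have "(\<Prod>j\<in>insert 0 K. m (B' j) ^ kk j) = (\<Prod>j\<in>K. m (B j))"
    using K by (simp add: kk_def B'K) (intro prod.cong, auto)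
  also have "(\<Sum>j\<in>insert 0 K. m (B' j)) = \<rho>"
  proof -
    have "(\<Sum>j\<in>insert 0 K. m (B' j)) = (LINT t|lborel. (\<Sum>j\<in>insert 0 K. indicator (B' j) t *\<^sub>R h t))"
      unfolding m_def set_lebesgue_integral_def using B'm
      by (intro Bochner_Integration.integral_sum[symmetric] integrable_mult_indicator h_integrable) auto
    also have "\<dots> = (LINT t|lborel. h t)"
    proof (rule Bochner_Integration.integral_cong[OF refl])
      fix t
      have "\<exists>i\<in>insert 0 K. t \<in> B' i" using B'0 B'K by blast
      then obtain i where i: "i \<in> insert 0 K" "t \<in> B' i" ..
      have "indicator (B' j) t = (if j = i then 1 else 0 :: real)" for j
        using dj i by (auto simp: disjoint_family_on_def indicator_def)
      then have "(\<Sum>j\<in>insert 0 K. indicator (B' j) t) = (1 :: real)"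
        using i K by (simp only: sum.delta finite_insert if_True)
      then show "(\<Sum>j\<in>insert 0 K. indicator (B' j) t *\<^sub>R h t) = h t"
        by (simp only: scaleR_sum_left[symmetric] scaleR_one)
    qed
    finally show ?thesis by (simp only: rho_eq)
  qed
  finally show ?thesis unfolding m_def .
qed

text \<open>The event splits into one condition per individual, on the ages of its children.
  Distinct individuals have distinct labels, so the conditions are independent, and each of the n
  individuals contributes one factor exp (- \<rho>).\<close>

lemma prob_tree_box:
  assumes n: "1 \<le> n" and p: "p \<in> parent_maps n" and B: "\<And>j. j \<in> {1..<n} \<Longrightarrow> B j \<in> sets borel"
    and sep: "\<And>j k x y. j \<in> {1..<n} \<Longrightarrow> k \<in> {1..<n} \<Longrightarrow> j < k \<Longrightarrow> p j = p k \<Longrightarrow> x \<in> B j \<Longrightarrow> y \<in> B k \<Longrightarrow> x < y"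
  shows "prob {\<omega> \<in> space M. (\<forall>i<n. card (X (label p i) \<omega>) = child_count n p i) \<and>
      (\<forall>j\<in>{1..<n}. ages (Y \<omega>) p j \<in> B j)} =
    exp (- \<rho> * real n) * (\<Prod>j\<in>{1..<n}. LINT t:B j|lborel. h t)"
proof -
  define K where "K i = {j\<in>{1..<n}. p j = i}" for i
  have K: "finite (K i)" "0 \<notin> K i" for i by (auto simp: K_def)
  define Q where "Q i C \<longleftrightarrow> (\<forall>j\<in>K i. card (C \<inter> B j) = 1) \<and> card (C \<inter> - (\<Union>j\<in>K i. B j)) = 0" for i and C :: "real set"
  define ix where "ix = inv_into {..<n} (label p)"
  have inj: "inj_on (label p) {..<n}" using label_inj[OF p] by (auto simp: inj_on_def)
  have ix: "ix (label p i) = i" if "i < n" for i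
    unfolding ix_def using inj that by (intro inv_into_f_f) auto
  have pn: "p j < n" if "j \<in> {1..<n}" for j using parent_less[OF p, of j] that by auto
  have Qm: "{C \<in> space config_space. Q i C} \<in> sets config_space" for i
  proof -
    have [measurable]: "Measurable.pred config_space (\<lambda>C. card (C \<inter> B j) = 1)" if "j \<in> K i" for j
      using measurable_config_count[OF B, of j] that by (simp add: K_def)
    have "(\<Union>j\<in>K i. B j) \<in> sets borel" using K B by (intro sets.finite_UN) (auto simp: K_def)
    then have [measurable]: "(\<lambda>C. card (C \<inter> - (\<Union>j\<in>K i. B j))) \<in> config_space \<rightarrow>\<^sub>M count_space UNIV"
      by (intro measurable_config_count borel_comp)
    show ?thesis unfolding Q_def using K by measurable
  qed
  have Q_iff: "card (X (label p i) \<omega>) = child_count n p i \<and> (\<forall>j\<in>K i. ages (Y \<omega>) p j \<in> B j) \<longleftrightarrow> Q i (X (label p i) \<omega>)"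
    if "\<omega> \<in> space M" for i \<omega>
  proof -
    have "ages (Y \<omega>) p j = sorted_list_of_set (X (label p i) \<omega>) ! card {i'\<in>K i. i' < j}" if "j \<in> K i" for j
      using that sibling_rank_children[of j n p i] by (simp add: ages_def K_def)
    then have ag: "(\<forall>j\<in>K i. ages (Y \<omega>) p j \<in> B j) \<longleftrightarrow>
        (\<forall>j\<in>K i. sorted_list_of_set (X (label p i) \<omega>) ! card {i'\<in>K i. i' < j} \<in> B j)"
      by (simp only: cong: ball_cong)
    have "x < y" if "j \<in> K i" "k \<in> K i" "j < k" "x \<in> B j" "y \<in> B k" for j k x y
      using sep[of j k x y] that by (simp add: K_def)
    from separated_counts_iff[OF X_finite[OF \<open>\<omega> \<in> space M\<close>, of "label p i"] K(1) this]
    show ?thesis unfolding Q_def child_count_def K_def[symmetric] ag .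
  qed
  have "{\<omega> \<in> space M. (\<forall>i<n. card (X (label p i) \<omega>) = child_count n p i) \<and>
      (\<forall>j\<in>{1..<n}. ages (Y \<omega>) p j \<in> B j)} = {\<omega> \<in> space M. \<forall>i<n. Q i (X (label p i) \<omega>)}"
  proof (rule Collect_cong, rule conj_cong[OF refl])
    fix \<omega> assume \<omega>: "\<omega> \<in> space M"
    have "(\<forall>j\<in>{1..<n}. ages (Y \<omega>) p j \<in> B j) \<longleftrightarrow> (\<forall>i<n. \<forall>j\<in>K i. ages (Y \<omega>) p j \<in> B j)"
      unfolding K_def using pn by blast
    then show "((\<forall>i<n. card (X (label p i) \<omega>) = child_count n p i) \<and>
      (\<forall>j\<in>{1..<n}. ages (Y \<omega>) p j \<in> B j)) \<longleftrightarrow> (\<forall>i<n. Q i (X (label p i) \<omega>))"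
      unfolding Q_iff[OF \<omega>, symmetric] by blast
  qed
  also have "\<dots> = (\<Inter>u\<in>label p ` {..<n}. X u -` {C \<in> space config_space. Q (ix u) C} \<inter> space M)"
  proof -
    have "{..<n} \<noteq> {}" using n by (simp add: lessThan_empty_iff)
    then show ?thesis
      using measurable_space[OF X_measurable] by (auto simp: ix)
  qed
  also have "prob \<dots> = (\<Prod>u\<in>label p ` {..<n}. prob (X u -` {C \<in> space config_space. Q (ix u) C} \<inter> space M))"
    using n Qm by (intro indep_varsD[OF indep]) (auto simp: lessThan_empty_iff)
  also have "\<dots> = (\<Prod>i<n. prob (X (label p i) -` {C \<in> space config_space. Q i C} \<inter> space M))"
    by (subst prod.reindex[OF inj]) (auto simp: ix intro!: prod.cong)
  also have "\<dots> = (\<Prod>i<n. exp (- \<rho>) * (\<Prod>j\<in>K i. LINT t:B j|lborel. h t))"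
  proof (rule prod.cong[OF refl])
    fix i
    have dj: "disjoint_family_on B (K i)"
      unfolding disjoint_family_on_def
    proof (intro ballI impI)
      fix j k assume jk: "j \<in> K i" "k \<in> K i" "j \<noteq> k"
      then have jk': "j \<in> {1..<n}" "k \<in> {1..<n}" "p j = p k" by (auto simp: K_def)
      have False if "x \<in> B j" "x \<in> B k" for x
        using sep[of j k x x] sep[of k j x x] jk(3) jk' that by (cases j k rule: linorder_cases) auto
      then show "B j \<inter> B k = {}" by blast
    qed
    have "X (label p i) -` {C \<in> space config_space. Q i C} \<inter> space M = {\<omega> \<in> space M. Q i (X (label p i) \<omega>)}"
      using measurable_space[OF X_measurable] by auto
    then show "prob (X (label p i) -` {C \<in> space config_space. Q i C} \<inter> space M) =
        exp (- \<rho>) * (\<Prod>j\<in>K i. LINT t:B j|lborel. h t)"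
      unfolding Q_def using prob_single_counts[OF K _ dj, of "label p i"] B by (simp add: K_def)
  qed
  also have "\<dots> = exp (- \<rho>) ^ n * (\<Prod>i<n. \<Prod>j\<in>K i. LINT t:B j|lborel. h t)"
    by (simp add: prod.distrib)
  also have "(\<Prod>i<n. \<Prod>j\<in>K i. LINT t:B j|lborel. h t) = (\<Prod>j\<in>{1..<n}. LINT t:B j|lborel. h t)"
    unfolding K_def by (rule prod.group) (use pn in auto)
  also have "exp (- \<rho>) ^ n = exp (- \<rho> * real n)"
    by (simp add: exp_of_nat_mult[symmetric] mult.commute)
  finally show ?thesis .
qed

definition increasing_weight :: "nat \<Rightarrow> (nat \<Rightarrow> real) \<Rightarrow> ennreal" where
  "increasing_weight n a = (\<Prod>i\<in>{1..<n}. indicator {(a(0 := 0)) (i - 1)<..} (a i))"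

lemma increasing_weight_measurable: "increasing_weight n \<in> borel_measurable (vec n)"
  unfolding increasing_weight_def[abs_def]
proof (rule borel_measurable_prod_ennreal)
  fix i assume i: "i \<in> {1..<n}"
  have m: "(\<lambda>L. (L(0 := 0)) (i - 1)) \<in> borel_measurable (vec n)"
    by (rule measurable_upd0) (use i in auto)
  have "(\<lambda>L. if f L < f' L then 1 else 0 :: ennreal) \<in> borel_measurable N"
    if [measurable]: "f \<in> borel_measurable N" "f' \<in> borel_measurable N" for f f' :: "_ \<Rightarrow> real" and N
    by measurable
  from this[OF m measurable_component_singleton[OF i]]
  show "(\<lambda>L :: nat \<Rightarrow> real. indicator {(L(0 := 0)) (i - 1)<..} (L i) :: ennreal) \<in> borel_measurable (vec n)"
    by (simp only: indicator_def greaterThan_iff of_bool_def)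
qed

lemma increasing_weight_eq:
  assumes b: "b 0 = 0" "\<And>i. i \<in> {1..<n} \<Longrightarrow> a i = b i"
  shows "increasing_weight n a = (if strict_mono_on {0..<n} b then 1 else 0)"
proof -
  have ab: "(a(0 := 0)) (i - 1) = b (i - 1)" if "i \<in> {1..<n}" for i
  proof (cases "i = 1")
    case False
    then have "i - 1 \<in> {1..<n}" "i - 1 \<noteq> 0" using that by auto
    then show ?thesis using b(2) by simp
  qed (simp add: b(1))
  have w: "increasing_weight n a = (\<Prod>i\<in>{1..<n}. if b (i - 1) < b i then 1 else 0)"
    unfolding increasing_weight_def
  proof (rule prod.cong[OF refl])
    fix i assume i: "i \<in> {1..<n}"
    show "indicator {(a(0 := 0)) (i - 1)<..} (a i) = (if b (i - 1) < b i then 1 else 0 :: ennreal)"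
      unfolding ab[OF i] b(2)[OF i] by (simp add: indicator_def)
  qed
  show ?thesis
  proof (cases "strict_mono_on {0..<n} b")
    case True
    have "b (i - 1) < b i" if "i \<in> {1..<n}" for i
      using that by (intro strict_mono_onD[OF True]) auto
    then show ?thesis unfolding w using True by simp
  next
    case False
    have "\<exists>i\<in>{1..<n}. \<not> b (i - 1) < b i"
    proof (rule ccontr)
      assume "\<not> (\<exists>i\<in>{1..<n}. \<not> b (i - 1) < b i)"
      then have step: "b j < b (Suc j)" if "Suc j < n" for j
        using that by (metis One_nat_def Suc_le_mono atLeastLessThan_iff diff_Suc_1 le0)
      have "b r < b s" if "r < s" "s < n" for r s
        using that by (induction s rule: less_Suc_induct[of r, consumes 1, case_names 1 2]) (auto intro: step less_trans)
      then have "strict_mono_on {0..<n} b" by (intro strict_mono_onI) simp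
      then show False using False by simp
    qed
    then have "increasing_weight n a = 0" unfolding w by (intro prod_zero) auto
    then show ?thesis using False by simp
  qed
qed

definition tree_event :: "nat \<Rightarrow> (nat \<Rightarrow> nat) \<Rightarrow> (nat \<Rightarrow> real) set \<Rightarrow> 'w set" where
  "tree_event n p D = {\<omega> \<in> space M. cluster_tree n p (Y \<omega>) \<and>
    prefix0 n (births p (ages (Y \<omega>) p)) \<in> D}"

text \<open>First the joint density of the ages is found on the event with the prescribed child
  counts; then \<open>nn_integral_births\<close> moves it to the birth times.\<close>

lemma tree_event_emeasure:
  assumes n: "1 \<le> n" and p: "p \<in> parent_maps n" and D: "D \<in> sets (seqs)"
  shows "tree_event n p D \<in> events" "emeasure M (tree_event n p D) = ennreal (exp (- \<rho> * real n)) *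
    (\<integral>\<^sup>+a. tree_density n p a *
      (increasing_weight n a * indicator D (prefix0 n a)) \<partial>lvec n)"
proof -
  let ?B = "vec n"
  let ?L = "lvec n"
  have sL: "sets ?L = sets ?B" by (rule sets_PiM_cong) auto
  define E where "E = {\<omega> \<in> space M. \<forall>i\<in>{..<n}. card (X (label p i) \<omega>) = child_count n p i}"
  define x where "x \<omega> = (\<lambda>j\<in>{1..<n}. point (label p (p j)) (sibling_rank p j) \<omega>)" for \<omega>
  have E [measurable]: "E \<in> events" unfolding E_def by measurable
  have xm: "x \<in> M \<rightarrow>\<^sub>M ?B" unfolding x_def[abs_def] by (rule measurable_restrict) simp
  have xa: "x \<omega> j = ages (Y \<omega>) p j" if "\<omega> \<in> E" "j \<in> {1..<n}" for \<omega> j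
  proof -
    have "sibling_rank p j < child_count n p (p j)"
      using sorted_list_of_set_nth_card_less(2)[of "{k\<in>{1..<n}. p k = p j}" j] that(2)
        sibling_rank_children[of j n p "p j"] by (simp add: child_count_def)
    moreover have "p j < n" using parent_less[OF p, of j] that(2) by simp
    ultimately show ?thesis using that by (simp add: x_def point_def ages_def E_def)
  qed
  define T where "T y = (\<lambda>i\<in>{1..<n}. births p y i)" for y
  have Tm: "T \<in> ?B \<rightarrow>\<^sub>M ?B" unfolding T_def[abs_def] by (rule measurable_restrict, rule measurable_births) simp
  define \<Psi> where "\<Psi> a = increasing_weight n a * indicator D (prefix0 n a)" for a
  have \<Psi>m: "\<Psi> \<in> borel_measurable ?B"
    unfolding \<Psi>_def[abs_def]
    by (intro borel_measurable_times_ennreal increasing_weight_measurable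
        measurable_compose[OF measurable_prefix0 borel_measurable_indicator[OF D]])
  define A where "A = {y \<in> space ?B. strict_mono_on {0..<n} (births p y) \<and> prefix0 n (births p y) \<in> D}"
  have pT: "prefix0 n (T y) = prefix0 n (births p y)" for y by (auto simp: prefix0_def T_def fun_eq_iff)
  have \<Psi>T: "\<Psi> (T y) = indicator A y" if "y \<in> space ?B" for y
  proof -
    have "increasing_weight n (T y) = (if strict_mono_on {0..<n} (births p y) then 1 else 0)"
      by (rule increasing_weight_eq) (simp_all add: T_def)
    then show ?thesis unfolding \<Psi>_def pT A_def using that by (auto simp: indicator_def)
  qed
  have Am: "A \<in> sets ?B"
  proof -
    have "A = (\<lambda>y. \<Psi> (T y)) -` {1} \<inter> space ?B"
    proof (rule set_eqI)
      fix y
      show "y \<in> A \<longleftrightarrow> y \<in> (\<lambda>y. \<Psi> (T y)) -` {1} \<inter> space ?B"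
        using \<Psi>T[of y] by (cases "y \<in> space ?B") (simp_all add: A_def indicator_def)
    qed
    moreover have "(\<lambda>y. \<Psi> (T y)) -` {1} \<inter> space ?B \<in> sets ?B"
      by (rule measurable_sets[OF measurable_compose[OF Tm \<Psi>m]]) simp
    ultimately show ?thesis by (simp only:)
  qed
  have ev: "tree_event n p D = E \<inter> (x -` A \<inter> space M)"
  proof -
    have "\<omega> \<in> tree_event n p D \<longleftrightarrow> x \<omega> \<in> A" if "\<omega> \<in> E" for \<omega>
    proof -
      have "births p (x \<omega>) i = births p (ages (Y \<omega>) p) i" if "i < n" for i
        using xa[OF \<open>\<omega> \<in> E\<close>] that by (intro births_cong) auto
      moreover have "\<omega> \<in> space M" using that by (simp add: E_def)
      moreover have "x \<omega> \<in> space ?B" using measurable_space[OF xm \<open>\<omega> \<in> space M\<close>] .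
      ultimately show ?thesis
        using that unfolding tree_event_def A_def cluster_tree_def E_def
        by (simp add: prefix0_def strict_mono_on_def cong: if_cong)
    qed
    moreover have "tree_event n p D \<subseteq> E" by (auto simp: tree_event_def cluster_tree_def E_def)
    ultimately show ?thesis by (auto simp: E_def)
  qed
  then show "tree_event n p D \<in> events" using E measurable_sets[OF xm Am] by simp
  \<comment> \<open>\<open>\<mu>\<close> is the law of the ages on \<open>E\<close> and lives on
    sorted siblings; \<open>\<nu>\<close> has the product density without that restriction. The two
    are compared on \<open>A\<close>, where siblings are sorted.\<close>
  define \<mu> where "\<mu> = distr (density M (indicator E)) ?B x"
  define \<nu> where "\<nu> = density ?L (\<lambda>y. ennreal (exp (- \<rho> * real n)) * (\<Prod>j\<in>{1..<n}. ennreal (h (y j))))"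
  have mu: "emeasure \<mu> S = emeasure M (E \<inter> (x -` S \<inter> space M))" if "S \<in> sets ?B" for S
  proof -
    have "emeasure \<mu> S = emeasure (density M (indicator E)) (x -` S \<inter> space M)"
      unfolding \<mu>_def using xm that by (subst emeasure_distr) simp_all
    also have "\<dots> = emeasure M (E \<inter> (x -` S \<inter> space M))"
      using measurable_sets[OF xm that] by (subst emeasure_density) (auto simp: indicator_inter_arith[symmetric])
    finally show ?thesis .
  qed
  have hm: "(\<lambda>y. \<Prod>j\<in>{1..<n}. ennreal (h (y j))) \<in> borel_measurable ?B"
    by (intro borel_measurable_prod_ennreal measurable_compose[OF _ measurable_ennreal]
        measurable_compose[OF _ h_measurable] measurable_component_singleton)
  then have hm': "(\<lambda>y. \<Prod>j\<in>{1..<n}. ennreal (h (y j))) \<in> borel_measurable ?L"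
    unfolding measurable_cong_sets[OF sL refl] .
  have nu: "emeasure \<nu> S = ennreal (exp (- \<rho> * real n)) * (\<integral>\<^sup>+y. (\<Prod>j\<in>{1..<n}. ennreal (h (y j))) * indicator S y \<partial>?L)"
    if "S \<in> sets ?B" for S
  proof -
    have "emeasure \<nu> S = (\<integral>\<^sup>+y. ennreal (exp (- \<rho> * real n)) * ((\<Prod>j\<in>{1..<n}. ennreal (h (y j))) * indicator S y) \<partial>?L)"
      unfolding \<nu>_def using hm' that sL
      by (subst emeasure_density) (auto intro!: borel_measurable_times_ennreal simp: mult.assoc simp del: One_nat_def)
    also have "\<dots> = ennreal (exp (- \<rho> * real n)) * (\<integral>\<^sup>+y. (\<Prod>j\<in>{1..<n}. ennreal (h (y j))) * indicator S y \<partial>?L)"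
      using hm' that sL by (intro nn_integral_cmult borel_measurable_times_ennreal borel_measurable_indicator) auto
    finally show ?thesis .
  qed
  \<comment> \<open>Box probabilities are available if the sides belonging to siblings are
    separated, so \<open>R\<close> consists of the sibling pairs. On \<open>A\<close> the ages of
    siblings are ordered: they share the birth time of the parent, so births and ages have the same
    order.\<close>
  have "emeasure \<mu> A = emeasure \<nu> A"
  proof (rule emeasure_eq_on_ordered[where I = "{1..<n}" and R = "{(j, k). j \<in> {1..<n} \<and> k \<in> {1..<n} \<and> j < k \<and> p j = p k}"])
    show "sets \<mu> = sets ?B" by (simp add: \<mu>_def)
    show "sets \<nu> = sets ?B" unfolding \<nu>_def sets_density by (fact sL)
    show "finite_measure \<mu>"
    proof (rule finite_measureI)
      show "emeasure \<mu> (space \<mu>) \<noteq> \<infinity>" using mu[of "space ?B"] by (simp add: \<mu>_def)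
    qed
    show "A \<in> sets \<mu>" using Am by (simp add: \<mu>_def)
  next
    fix B :: "nat \<Rightarrow> real set"
    assume B: "\<And>i. i \<in> {1..<n} \<Longrightarrow> B i \<in> sets borel"
      and sep: "\<And>j k y z. (j, k) \<in> {(j, k). j \<in> {1..<n} \<and> k \<in> {1..<n} \<and> j < k \<and> p j = p k} \<Longrightarrow> y \<in> B j \<Longrightarrow> z \<in> B k \<Longrightarrow> y < z"
    have Bs: "Pi\<^sub>E {1..<n} B \<in> sets ?B" using B by (intro sets_PiM_I_finite) auto
    have "E \<inter> (x -` Pi\<^sub>E {1..<n} B \<inter> space M) = {\<omega> \<in> space M. (\<forall>i<n. card (X (label p i) \<omega>) = child_count n p i) \<and>
      (\<forall>j\<in>{1..<n}. ages (Y \<omega>) p j \<in> B j)}"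
    proof -
      have "x \<omega> \<in> Pi\<^sub>E {1..<n} B \<longleftrightarrow> (\<forall>j\<in>{1..<n}. ages (Y \<omega>) p j \<in> B j)" if "\<omega> \<in> E" for \<omega>
      proof -
        have "x \<omega> \<in> extensional {1..<n}" by (simp add: x_def)
        then show ?thesis using xa[OF that] by (simp add: PiE_iff)
      qed
      then show ?thesis by (auto simp: E_def)
    qed
    note Ebox = this
    have "emeasure \<mu> (Pi\<^sub>E {1..<n} B) = ennreal (exp (- \<rho> * real n) * (\<Prod>j\<in>{1..<n}. LINT t:B j|lborel. h t))"
    proof -
      have "y < z" if "j \<in> {1..<n}" "k \<in> {1..<n}" "j < k" "p j = p k" "y \<in> B j" "z \<in> B k" for j k y z
        using sep[of j k y z] that by simp
      from prob_tree_box[of n p B, OF n p B this] show ?thesis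
        unfolding mu[OF Bs] Ebox by (simp only: emeasure_eq_measure)
    qed
    also have "\<dots> = ennreal (exp (- \<rho> * real n)) * (\<Prod>j\<in>{1..<n}. \<integral>\<^sup>+t. ennreal (h t) * indicator (B j) t \<partial>lborel)"
    proof -
      have hB: "(\<integral>\<^sup>+t. ennreal (h t) * indicator (B j) t \<partial>lborel) = ennreal (LINT t:B j|lborel. h t)" if "j \<in> {1..<n}" for j
      proof -
        have "(\<integral>\<^sup>+t. ennreal (h t) * indicator (B j) t \<partial>lborel) = (\<integral>\<^sup>+t. ennreal (indicator (B j) t *\<^sub>R h t) \<partial>lborel)"
          by (intro nn_integral_cong) (auto split: split_indicator)
        also have "\<dots> = ennreal (LINT t:B j|lborel. h t)"
          unfolding set_lebesgue_integral_def using B[OF that] h_nonneg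
          by (intro nn_integral_eq_integral integrable_mult_indicator h_integrable) auto
        finally show ?thesis .
      qed
      have m0: "0 \<le> (LINT t:B j|lborel. h t)" for j
        unfolding set_lebesgue_integral_def using h_nonneg by (intro integral_nonneg_AE) auto
      have "(\<Prod>j\<in>{1..<n}. \<integral>\<^sup>+t. ennreal (h t) * indicator (B j) t \<partial>lborel) =
          (\<Prod>j\<in>{1..<n}. ennreal (LINT t:B j|lborel. h t))"
        by (rule prod.cong[OF refl hB])
      also have "\<dots> = ennreal (\<Prod>j\<in>{1..<n}. LINT t:B j|lborel. h t)"
        by (rule prod_ennreal) (rule m0)
      finally show ?thesis
        by (simp only: ennreal_mult[OF exp_ge_zero prod_nonneg] m0)
    qed
    also have "(\<Prod>j\<in>{1..<n}. \<integral>\<^sup>+t. ennreal (h t) * indicator (B j) t \<partial>lborel) =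
        (\<integral>\<^sup>+y. (\<Prod>j\<in>{1..<n}. ennreal (h (y j)) * indicator (B j) (y j)) \<partial>?L)"
    proof -
      interpret product_sigma_finite "\<lambda>_ :: nat. lborel :: real measure" by standard
      show ?thesis using B by (intro product_nn_integral_prod[symmetric]) auto
    qed
    also have "\<dots> = (\<integral>\<^sup>+y. (\<Prod>j\<in>{1..<n}. ennreal (h (y j))) * indicator (Pi\<^sub>E {1..<n} B) y \<partial>?L)"
    proof (rule nn_integral_cong)
      fix y assume "y \<in> space ?L"
      then have ext: "y \<in> extensional {1..<n}" by (auto simp: space_PiM PiE_def)
      have "(\<Prod>j\<in>{1..<n}. indicator (B j) (y j)) = (indicator (Pi\<^sub>E {1..<n} B) y :: ennreal)"
      proof (cases "\<forall>j\<in>{1..<n}. y j \<in> B j")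
        case True
        then show ?thesis using ext by (auto simp: PiE_iff indicator_def)
      next
        case False
        then have "y \<notin> Pi\<^sub>E {1..<n} B" by (auto simp: PiE_iff)
        moreover have "(\<Prod>j\<in>{1..<n}. indicator (B j) (y j)) = (0 :: ennreal)"
          using False by (intro prod_zero) (auto simp: indicator_def)
        ultimately show ?thesis by simp
      qed
      then show "(\<Prod>j\<in>{1..<n}. ennreal (h (y j)) * indicator (B j) (y j)) =
          (\<Prod>j\<in>{1..<n}. ennreal (h (y j))) * indicator (Pi\<^sub>E {1..<n} B) y"
        by (simp only: prod.distrib)
    qed
    finally show "emeasure \<mu> (Pi\<^sub>E {1..<n} B) = emeasure \<nu> (Pi\<^sub>E {1..<n} B)" unfolding nu[OF Bs] .
  next
    fix y j k assume y: "y \<in> A" and "(j, k) \<in> {(j, k). j \<in> {1..<n} \<and> k \<in> {1..<n} \<and> j < k \<and> p j = p k}"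
    then have jk: "1 \<le> j" "1 \<le> k" "j < k" "k < n" "p j = p k" by auto
    have "births p y j < births p y k"
      using y jk by (auto simp: A_def intro: strict_mono_onD)
    then show "y j < y k" using jk(5) births_parent[OF p jk(1), of y] births_parent[OF p jk(2), of y] by simp
  qed auto
  then have "emeasure M (tree_event n p D) = emeasure \<nu> A" using mu[OF Am] ev by simp
  also have "\<dots> = ennreal (exp (- \<rho> * real n)) * (\<integral>\<^sup>+y. (\<Prod>j\<in>{1..<n}. ennreal (h (y j))) * \<Psi> (T y) \<partial>?L)"
    unfolding nu[OF Am] using \<Psi>T sets_eq_imp_space_eq[OF sL]
    by (intro arg_cong2[where f = "(*)"] nn_integral_cong) auto
  also have "(\<integral>\<^sup>+y. (\<Prod>j\<in>{1..<n}. ennreal (h (y j))) * \<Psi> (T y) \<partial>?L) =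
      (\<integral>\<^sup>+a. tree_density n p a * \<Psi> a \<partial>?L)"
    unfolding T_def by (rule nn_integral_births[where f = "\<lambda>t. ennreal (h t)"]) (use parent_less[OF p] \<Psi>m in auto)
  finally show "emeasure M (tree_event n p D) = ennreal (exp (- \<rho> * real n)) *
    (\<integral>\<^sup>+a. tree_density n p a *
      (increasing_weight n a * indicator D (prefix0 n a)) \<partial>lvec n)"
    unfolding \<Psi>_def .
qed

end

section \<open>Comparison of the two laws\<close>

lemma sum_parent_maps:
  fixes f :: "nat \<Rightarrow> nat \<Rightarrow> ennreal"
  shows "(\<Sum>p\<in>parent_maps n. \<Prod>i\<in>{1..<n}. f i (p i)) = (\<Prod>i\<in>{1..<n}. \<Sum>j=0..<i. f i j)"
proof -
  have "(\<Prod>i\<in>{1..<n}. \<Sum>j=0..<i. f i j) = (\<Sum>q\<in>(\<Pi>\<^sub>E i\<in>{1..<n}. {0..<i}). \<Prod>i\<in>{1..<n}. f i (q i))"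
    by (rule prod_sum_PiE) auto
  also have "\<dots> = (\<Sum>p\<in>parent_maps n. \<Prod>i\<in>{1..<n}. f i (p i))"
    by (rule sum.reindex_bij_witness[of _ "\<lambda>p. restrict p {1..<n}" "\<lambda>q i. if i \<in> {1..<n} then q i else 0"])
       (auto simp: parent_maps_def PiE_dflt_def PiE_iff extensional_def fun_eq_iff)
  finally show ?thesis by simp
qed

lemma finite_parent_maps: "finite (parent_maps n)"
  unfolding parent_maps_def by (rule finite_PiE_dflt) auto

lemma space_outcome_space [simp]: "space outcome_space = UNIV"
  by (auto simp: outcome_space_def space_pair_measure space_PiM)

text \<open>The inequality for the complement is the reverse inequality for the set.\<close>

lemma prob_space_eqI_le:
  assumes "prob_space M" "prob_space N" and sets: "sets M = sets N"
    and le: "\<And>A. A \<in> sets M \<Longrightarrow> emeasure M A \<le> emeasure N A"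
  shows "M = N"
proof (rule measure_eqI[OF sets])
  interpret M: prob_space M by fact
  interpret N: prob_space N by fact
  fix A assume A: "A \<in> sets M"
  have sp: "space M = space N" by (rule sets_eq_imp_space_eq[OF sets])
  have le': "measure M B \<le> measure N B" if "B \<in> sets M" for B
    using le[OF that] by (simp add: M.emeasure_eq_measure N.emeasure_eq_measure)
  have "measure M (space M - A) \<le> measure N (space N - A)"
    using le'[OF sets.compl_sets[OF A]] by (simp only: sp)
  then have "measure N A \<le> measure M A"
    using M.prob_compl[OF A] N.prob_compl[of A] A sets by simp
  then show "emeasure M A = emeasure N A"
    using le'[OF A] by (simp add: M.emeasure_eq_measure N.emeasure_eq_measure)
qed

context hawkes_process
begin

lemma tree_event_sum:
  assumes n: "1 \<le> n" and D: "D \<in> sets (seqs)"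
  shows "emeasure M (\<Union>p\<in>parent_maps n. tree_event n p D) = cluster_mass n (indicator D)"
proof -
  let ?L = "lvec n"
  have sL: "sets ?L = sets (vec n)" by (rule sets_PiM_cong) auto
  have "disjoint_family_on (\<lambda>p. tree_event n p D) (parent_maps n)"
    unfolding disjoint_family_on_def
  proof (intro ballI impI)
    fix p q assume pq: "p \<in> parent_maps n" "q \<in> parent_maps n" "p \<noteq> q"
    then show "tree_event n p D \<inter> tree_event n q D = {}"
      using cluster_tree_unique[OF n pq(1) _ n pq(2)] unfolding tree_event_def by blast
  qed
  then have "emeasure M (\<Union>p\<in>parent_maps n. tree_event n p D) = (\<Sum>p\<in>parent_maps n. emeasure M (tree_event n p D))"
    using tree_event_emeasure(1)[OF n _ D] by (intro sum_emeasure[symmetric] finite_parent_maps) auto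
  also have "\<dots> = (\<Sum>p\<in>parent_maps n. ennreal (exp (- \<rho> * real n)) *
    (\<integral>\<^sup>+a. tree_density n p a * (increasing_weight n a * indicator D (prefix0 n a)) \<partial>?L))"
    by (rule sum.cong[OF refl tree_event_emeasure(2)[OF n _ D]])
  also have "\<dots> = ennreal (exp (- \<rho> * real n)) * (\<Sum>p\<in>parent_maps n.
    (\<integral>\<^sup>+a. tree_density n p a * (increasing_weight n a * indicator D (prefix0 n a)) \<partial>?L))"
    by (simp only: sum_distrib_left)
  also have "(\<Sum>p\<in>parent_maps n.
    (\<integral>\<^sup>+a. tree_density n p a * (increasing_weight n a * indicator D (prefix0 n a)) \<partial>?L)) =
    (\<integral>\<^sup>+a. (\<Sum>p\<in>parent_maps n. tree_density n p a * (increasing_weight n a * indicator D (prefix0 n a))) \<partial>?L)"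
  proof (rule nn_integral_sum[symmetric])
    fix p assume p: "p \<in> parent_maps n"
    have "(\<lambda>a. tree_density n p a * (increasing_weight n a * indicator D (prefix0 n a)))
        \<in> borel_measurable (vec n)"
    proof (intro borel_measurable_times_ennreal increasing_weight_measurable borel_measurable_prod_ennreal
        measurable_compose[OF measurable_prefix0 borel_measurable_indicator[OF D]])
      fix i assume i: "i \<in> {1..<n}"
      have "(\<lambda>a. (a(0 := 0)) (p i)) \<in> borel_measurable (vec n)"
        by (rule measurable_upd0) (use parent_less[OF p, of i] i in auto)
      from borel_measurable_diff[OF measurable_component_singleton[OF i] this]
      show "(\<lambda>a. ennreal (h (a i - (a(0 := 0)) (p i)))) \<in> borel_measurable (vec n)"
        by (intro measurable_compose[OF _ measurable_ennreal] measurable_compose[OF _ h_measurable])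
    qed
    then show "(\<lambda>a. tree_density n p a * (increasing_weight n a * indicator D (prefix0 n a)))
        \<in> borel_measurable ?L" unfolding measurable_cong_sets[OF sL refl] .
  qed
  also have "ennreal (exp (- \<rho> * real n)) * \<dots> = cluster_mass n (indicator D)"
    unfolding cluster_mass_def
  proof (intro arg_cong2[where f = "(*)"] refl nn_integral_cong)
    fix a
    have "(\<Sum>p\<in>parent_maps n. tree_density n p a * (increasing_weight n a * indicator D (prefix0 n a)))
      = (\<Prod>i\<in>{1..<n}. \<Sum>j=0..<i. ennreal (h (a i - (a(0 := 0)) j))) * (increasing_weight n a * indicator D (prefix0 n a))"
      unfolding sum_distrib_right[symmetric] by (subst sum_parent_maps) (rule refl)
    also have "\<dots> = epoch_density n a * indicator D (prefix0 n a)"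
      unfolding increasing_weight_def epoch_density_def prod.distrib by (simp only: mult_ac)
    finally show "(\<Sum>p\<in>parent_maps n. tree_density n p a * (increasing_weight n a * indicator D (prefix0 n a)))
      = epoch_density n a * indicator D (prefix0 n a)" .
  qed
  finally show ?thesis .
qed

text \<open>The sum starts at size 1 because size 0 encodes infinite clusters. These, and clusters
  with ties, are dropped from the lower bound.\<close>

lemma cluster_law_ge:
  assumes D: "D \<in> sets outcome_space"
  shows "(\<Sum>n. cluster_mass (Suc n) (indicator {A. (Suc n, A) \<in> D})) \<le> emeasure (cluster_law M X) D"
proof -
  define S where "S n = {A. (n, A) \<in> D}" for n
  have Sm: "S n \<in> sets (seqs)" for n
  proof -
    have "Pair n -` D \<in> sets (seqs)"
      using D unfolding outcome_space_def by (rule sets_Pair1)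
    then show ?thesis by (simp add: S_def vimage_def)
  qed
  define V where "V n = (\<Union>p\<in>parent_maps (Suc n). tree_event (Suc n) p (S (Suc n)))" for n
  have Vm: "V n \<in> events" for n
    unfolding V_def using tree_event_emeasure(1)[OF _ _ Sm] by (intro sets.finite_UN finite_parent_maps) auto
  have dj: "disjoint_family V"
    unfolding disjoint_family_on_def
  proof (intro ballI impI)
    fix n m :: nat assume nm: "n \<noteq> m"
    have False if V: "\<omega> \<in> V n" "\<omega> \<in> V m" for \<omega>
    proof -
      obtain p where p: "p \<in> parent_maps (Suc n)" "cluster_tree (Suc n) p (Y \<omega>)"
        using V(1) by (auto simp: V_def tree_event_def)
      obtain q where q: "q \<in> parent_maps (Suc m)" "cluster_tree (Suc m) q (Y \<omega>)"
        using V(2) by (auto simp: V_def tree_event_def)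
      show False using cluster_tree_unique[OF _ p _ q] nm by simp
    qed
    then show "V n \<inter> V m = {}" by blast
  qed
  have "(\<Sum>n. cluster_mass (Suc n) (indicator (S (Suc n)))) = (\<Sum>n. emeasure M (V n))"
    unfolding V_def by (intro suminf_cong tree_event_sum[symmetric] Sm) simp
  also have "\<dots> = emeasure M (\<Union>n. V n)"
    using Vm dj by (intro suminf_emeasure) auto
  also have "\<dots> \<le> emeasure M (outcome -` D \<inter> space M)"
  proof (rule emeasure_mono)
    show "(\<Union>n. V n) \<subseteq> outcome -` D \<inter> space M"
    proof
      fix \<omega> assume "\<omega> \<in> (\<Union>n. V n)"
      then obtain n p where p: "p \<in> parent_maps (Suc n)" "\<omega> \<in> tree_event (Suc n) p (S (Suc n))"
        by (auto simp: V_def)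
      then have tree: "cluster_tree (Suc n) p (Y \<omega>)" by (simp add: tree_event_def)
      have n1: "1 \<le> Suc n" by simp
      show "\<omega> \<in> outcome -` D \<inter> space M"
        using p(2) cluster_tree_outcome[OF n1 p(1) tree] by (simp add: tree_event_def S_def)
    qed
    show "outcome -` D \<inter> space M \<in> events"
      by (rule measurable_sets[OF outcome_measurable D])
  qed
  also have "\<dots> = emeasure (cluster_law M X) D"
    unfolding cluster_law_def by (rule emeasure_distr[OF outcome_measurable D, symmetric])
  finally show ?thesis unfolding S_def .
qed

lemma prob_space_cluster_law: "prob_space (cluster_law M X)"
  unfolding cluster_law_def by (rule prob_space_distr[OF outcome_measurable])

end

context subcritical_kernel
begin

lemma Lam_solution_measurable:
  "(\<lambda>U. (n, epoch_solution g n (Lam \<rho> n \<pi> U)))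
    \<in> uvec n \<rightarrow>\<^sub>M outcome_space"
proof -
  have s: "sets (uvec n) = sets (vec n)"
    by (rule sets_PiM_cong) auto
  have "(\<lambda>U. \<lambda>k\<in>{1..<n}. \<rho> * (real (q k) - U k)) \<in> vec n \<rightarrow>\<^sub>M vec n"
    for q :: "nat \<Rightarrow> nat"
  proof (rule measurable_restrict)
    fix k assume "k \<in> {1..<n}"
    then have [measurable]: "(\<lambda>U. U k) \<in> borel_measurable (vec n)"
      by (rule measurable_component_singleton)
    show "(\<lambda>U. \<rho> * (real (q k) - U k)) \<in> borel_measurable (vec n)" by measurable
  qed
  from measurable_compose[OF measurable_compose[OF this measurable_sorted_entry] measurable_epoch_solution]
  have "(\<lambda>U. epoch_solution g n (Lam \<rho> n \<pi> U)) \<in> vec n \<rightarrow>\<^sub>M seqs"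
    unfolding epoch_solution_Lam .
  then show ?thesis
    unfolding outcome_space_def measurable_cong_sets[OF s refl] by (intro measurable_Pair) auto
qed

definition epoch_kernel :: "nat \<Rightarrow> (nat \<Rightarrow> nat) \<Rightarrow> (nat \<times> (nat \<Rightarrow> real)) measure" where
  "epoch_kernel n \<pi> = distr (uvec n) outcome_space
       (\<lambda>U. (n, epoch_solution g n (Lam \<rho> n \<pi> U)))"

definition size_kernel :: "nat \<Rightarrow> (nat \<times> (nat \<Rightarrow> real)) measure" where
  "size_kernel n = measure_pmf (Pi_pmf {1..<n} 0 (\<lambda>_. pmf_of_set {1..n})) \<bind> epoch_kernel n"

lemma sampler_law_eq: "sampler_law g = borel_dist \<rho> \<bind> size_kernel"
  by (simp add: sampler_law_def size_kernel_def[abs_def] epoch_kernel_def[abs_def] epoch_solution_def)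

lemma prob_space_epoch_kernel: "prob_space (epoch_kernel n \<pi>)"
proof -
  have "prob_space (uvec n)"
    by (intro prob_space_PiM prob_space_uniform_measure) auto
  then show ?thesis
    unfolding epoch_kernel_def by (rule prob_space.prob_space_distr[OF _ Lam_solution_measurable])
qed

lemma epoch_kernel_measurable: "epoch_kernel n \<in> measure_pmf q \<rightarrow>\<^sub>M subprob_algebra outcome_space"
proof -
  have "epoch_kernel n \<pi> \<in> space (subprob_algebra outcome_space)" for \<pi>
    using prob_space_epoch_kernel[of n \<pi>]
    by (simp add: space_subprob_algebra epoch_kernel_def prob_space_imp_subprob_space)
  then show ?thesis by simp
qed

lemma prob_space_size_kernel: "prob_space (size_kernel n)"
  unfolding size_kernel_def
  by (rule prob_space.prob_space_bind[OF measure_pmf.prob_space_axioms _ epoch_kernel_measurable])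
     (simp add: prob_space_epoch_kernel)

lemma sets_size_kernel: "sets (size_kernel n) = sets outcome_space"
  unfolding size_kernel_def by (rule sets_bind) (auto simp: epoch_kernel_def)

lemma size_kernel_measurable: "size_kernel \<in> borel_dist \<rho> \<rightarrow>\<^sub>M subprob_algebra outcome_space"
proof -
  have "size_kernel n \<in> space (subprob_algebra outcome_space)" for n
    using prob_space_size_kernel[of n] sets_size_kernel[of n]
    by (simp add: space_subprob_algebra prob_space_imp_subprob_space)
  then have "size_kernel \<in> count_space UNIV \<rightarrow>\<^sub>M subprob_algebra outcome_space" by simp
  moreover have "sets (borel_dist \<rho>) = sets (count_space UNIV)" by simp
  ultimately show ?thesis using measurable_cong_sets by blast
qed

lemma prob_space_borel_dist: "prob_space (borel_dist \<rho>)"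
  using emeasure_borel_dist[of \<rho>] rho_pos subcritical by (intro prob_spaceI) simp

lemma prob_space_sampler_law: "prob_space (sampler_law g)"
  unfolding sampler_law_eq
  by (rule prob_space.prob_space_bind[OF prob_space_borel_dist _ size_kernel_measurable])
     (simp add: prob_space_size_kernel)

lemma sets_sampler_law: "sets (sampler_law g) = sets outcome_space"
  unfolding sampler_law_eq by (rule sets_bind) (auto simp: sets_size_kernel)

lemma sampler_law_le:
  assumes D: "D \<in> sets outcome_space"
  shows "emeasure (sampler_law g) D \<le> (\<Sum>n. cluster_mass (Suc n) (indicator {A. (Suc n, A) \<in> D}))"
proof -
  define F where "F n = (indicator {A. (n, A) \<in> D} :: (nat \<Rightarrow> real) \<Rightarrow> ennreal)" for n :: nat
  have Fm: "F n \<in> borel_measurable seqs" for n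
  proof -
    have "Pair n -` D \<in> sets (seqs)"
      using D unfolding outcome_space_def by (rule sets_Pair1)
    then show ?thesis unfolding F_def by (simp add: vimage_def)
  qed
  define I where "I n = (\<integral>\<^sup>+\<pi>. (\<integral>\<^sup>+U. F n (epoch_solution g n (Lam \<rho> n \<pi> U)) \<partial>uvec n)
      \<partial>measure_pmf (Pi_pmf {1..<n} 0 (\<lambda>_. pmf_of_set {1..n})))" for n :: nat
  have ek: "emeasure (epoch_kernel n \<pi>) D =
      (\<integral>\<^sup>+U. F n (epoch_solution g n (Lam \<rho> n \<pi> U)) \<partial>uvec n)" for n \<pi>
  proof -
    have "emeasure (epoch_kernel n \<pi>) D = (\<integral>\<^sup>+z. indicator D z \<partial>epoch_kernel n \<pi>)"
      using D by (simp add: epoch_kernel_def)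
    also have "\<dots> = (\<integral>\<^sup>+U. indicator D (n, epoch_solution g n (Lam \<rho> n \<pi> U)) \<partial>uvec n)"
      unfolding epoch_kernel_def by (rule nn_integral_distr[OF Lam_solution_measurable]) (use D in simp)
    finally show ?thesis by (simp add: F_def indicator_def)
  qed
  have sk: "emeasure (size_kernel n) D = I n" for n
    unfolding size_kernel_def I_def ek[symmetric]
    by (rule emeasure_bind[OF _ epoch_kernel_measurable D]) simp
  have "emeasure (sampler_law g) D = (\<integral>\<^sup>+n. I n \<partial>borel_dist \<rho>)"
    unfolding sampler_law_eq sk[symmetric]
    by (rule emeasure_bind[OF _ size_kernel_measurable D]) simp
  also have "\<dots> = (\<integral>\<^sup>+n. (if n = 0 then 0 else I n) \<partial>borel_dist \<rho>)"
  proof (rule nn_integral_cong_AE)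
    show "AE n in borel_dist \<rho>. I n = (if n = 0 then 0 else I n)"
      unfolding borel_dist_def by (subst AE_density) (auto simp: AE_count_space)
  qed
  also have "\<dots> = (\<Sum>k. ennreal (exp (- \<rho> * real (Suc k)) / fact (Suc k) * (\<rho> * real (Suc k)) ^ k) * I (Suc k))"
    by (subst nn_integral_borel_dist) simp_all
  also have "\<dots> \<le> (\<Sum>k. cluster_mass (Suc k) (F (Suc k)))"
  proof (rule suminf_le)
    fix k
    show "ennreal (exp (- \<rho> * real (Suc k)) / fact (Suc k) * (\<rho> * real (Suc k)) ^ k) * I (Suc k) \<le> cluster_mass (Suc k) (F (Suc k))"
      using sampler_le_cluster_mass[of "Suc k" "F (Suc k)"] Fm unfolding I_def by simp
  qed (auto intro: summableI)
  finally show ?thesis unfolding F_def .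
qed

end

theorem proposition4:
  fixes g :: "real \<Rightarrow> real"
    and M :: "'w measure"
    and X :: "nat list \<Rightarrow> 'w \<Rightarrow> real set"
  assumes "\<And>x. x \<ge> 0 \<Longrightarrow> g x > 0"
    and "set_integrable lborel {0..} g"
    and "kernel_mass g < 1"
    and "hawkes_cluster M g X"
  shows "sampler_law g = cluster_law M X"
proof -
  interpret subcritical_kernel g by standard (use assms in auto)
  interpret hawkes_process g M X
    using assms(4) unfolding hawkes_cluster_def
    by (intro hawkes_process.intro hawkes_process_axioms.intro subcritical_kernel_axioms) auto
  show ?thesis
  proof (rule prob_space_eqI_le[OF prob_space_sampler_law prob_space_cluster_law])
    show "sets (sampler_law g) = sets (cluster_law M X)"
      by (simp add: sets_sampler_law cluster_law_def)
    fix A assume "A \<in> sets (sampler_law g)"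
    then have "A \<in> sets outcome_space" by (simp add: sets_sampler_law)
    from order_trans[OF sampler_law_le[OF this] cluster_law_ge[OF this]]
    show "emeasure (sampler_law g) A \<le> emeasure (cluster_law M X) A" .
  qed
qed

end
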